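(* Let $f\in L^2(\Omega;\mathbb R^2)$, let $(\sigma,u)\in\Sigma\times V$ be the solution of the mixed formulation $$(A\sigma,\tau)+(\operatorname{div}\tau,u)=0\quad\forall\,\tau\in\Sigma,\qquad (\operatorname{div}\sigma,v)=(f,v)\quad\forall\,v\in V,$$ and let $(\sigma_h,u_h)\in\Sigma_h\times V_h$ be the solution of the mixed finite element method $$(A\sigma_h,\tau_h)+(\operatorname{div}\tau_h,u_h)=0\quad\forall\,\tau_h\in\Sigma_h,\qquad (\operatorname{div}\sigma_h,v_h)=(f,v_h)\quad\forall\,v_h\in V_h.$$ If the compliance tensor $A$ is continuous, then there exists a positive constant $C_2$ depending only on the shape-regularity of the triangulation $\mathcal T_h$ and the polynomial degree $k$ such that $$C_2\,\eta(\sigma_h,\mathcal T_h)\le\|\sigma-\sigma_h\|_A.$$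
   Context: **Continuous setting.** $\Omega\subset\mathbb R^2$ is a bounded polygonal domain with boundary $\Gamma=\partial\Omega$. $\mathbb S\subset\mathbb R^{2\times2}$ is the space of symmetric matrices. $\Sigma:=H(\operatorname{div},\Omega;\mathbb S)$ is the space of symmetric $L^2$ tensor fields with row-wise divergence in $L^2(\Omega;\mathbb R^2)$, and $V:=L^2(\Omega;\mathbb R^2)$. $(\cdot,\cdot)$ is the $L^2(\Omega)$ inner product, and $\|\cdot\|_{0,K}$, $\|\cdot\|_{0,e}$ are the $L^2$ norms on $K$, $e$. The compliance tensor $A:\mathbb S\to\mathbb S$ is bounded and symmetric positive definite, and throughout is assumed constant in space (so the continuity hypothesis on $A$ is met). In the homogeneous isotropic case $A\tau=\frac1{2\mu}\big(\tau-\frac{\lambda}{2\mu+2\lambda}(\operatorname{tr}\tau)I\big)$ with Lamé constants $\mu>0$, $\lambda\ge0$. The norm $\|\cdot\|_A$ is given by $\|\tau\|_A^2=(A\tau,\tau)$. **Differential operators.** For a tensor field $\tau=(\tau_{ij})$, $\operatorname{curl}\tau=(\partial_{x_1}\tau_{12}-\partial_{x_2}\tau_{11},\ \partial_{x_1}\tau_{22}-\partial_{x_2}\tau_{21})^T$; for a vector field $w$, $\operatorname{curl}w=\partial_{x_1}w_2-\partial_{x_2}w_1$; $\operatorname{div}$ acts on tensors row-wise. In the estimator they are applied elementwise. **Mesh.** $\mathcal T_h$ is a shape-regular triangulation of $\bar\Omega$ into triangles, $\mathcal E_h=\mathcal E_h(\Omega)\cup\mathcal E_h(\Gamma)$ is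 its set of edges (interior edges and boundary edges, respectively), $h_K$ is the diameter of $K\in\mathcal T_h$, $h_e$ the length of $e\in\mathcal E_h$, and $h=\max_K h_K$. For an edge $e$ with unit normal $\nu_e=(n_1,n_2)^T$ (outward on $\Gamma$), $t_e=(-n_2,n_1)^T$ is the unit tangent and $\partial_{t_e}$ the tangential derivative. For an interior edge $e=\bar K_+\cap\bar K_-$, $[w]_e:=(w|_{K_+})|_e-(w|_{K_-})|_e$. **Hu–Zhang element.** Fix an integer $k\ge3$. $P_k(K;\mathbb S)$ and $P_k(K;\mathbb R^2)$ denote symmetric-matrix-valued and vector-valued polynomials of total degree $\le k$ on $K$. Let $B_{K,k}=\{\tau\in P_k(K;\mathbb S):\tau\nu|_{\partial K}=0\}$, where $\nu$ is the unit outward normal of $K$, $B_{k,h}=\{\tau\in H(\operatorname{div},\Omega;\mathbb S):\tau|_K\in B_{K,k}\ \forall K\in\mathcal T_h\}$, $\widetilde\Sigma_{k,h}=\{\tau\in H^1(\Omega;\mathbb S):\tau|_K\in P_k(K;\mathbb S)\ \forall K\in\mathcal T_h\}$. Then $\Sigma_h:=\widetilde\Sigma_{k,h}+B_{k,h}$ and $V_h:=\{v\in L^2(\Omega;\mathbb R^2):v|_K\in P_{k-1}(K;\mathbb R^2)\ \forall K\in\mathcal T_h\}$. **Estimator.** $$\eta^2(\sigma_h,\mathcal T_h):=\sum_{K\in\mathcal T_h}h_K^4\|\operatorname{curl}\operatorname{curl}(A\sigma_h)\|_{0,K}^2+\sum_{e\in\mathcal E_h}\big(h_e\|\mathcal J_{e,1}\|_{0,e}^2+h_e^3\|\mathcal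 J_{e,2}\|_{0,e}^2\big),$$ where for $e\in\mathcal E_h(\Omega)$: $\mathcal J_{e,1}=[(A\sigma_h)t_e\cdot t_e]_e$ and $\mathcal J_{e,2}=[\operatorname{curl}(A\sigma_h)\cdot t_e]_e$; and for $e\in\mathcal E_h(\Gamma)$: $\mathcal J_{e,1}=((A\sigma_h)t_e\cdot t_e)|_e$ and $\mathcal J_{e,2}=\big(\operatorname{curl}(A\sigma_h)\cdot t_e-\partial_{t_e}((A\sigma_h)t_e\cdot\nu_e)\big)|_e$. **Constants.** The paper's constants are understood to be independent of $h$ and of the Lamé constant $\lambda$.
   Formalization: The constant C_2 may also depend on ellipticity and boundedness constants of A (for isotropic A only on μ, uniformly in λ ≥ 0): as A → cA the estimator scales by c but the A-norm by √c, so dependence on shape-regularity and k alone is impossible. *)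

theory Defs
  imports "HOL-Analysis.Analysis"
begin

section \<open>Function spaces on the continuous level\<close>

text \<open>Elements of Lebesgue and Sobolev spaces are represented by functions on the whole plane of
  which only the values almost everywhere in the domain matter. On \<^typ>\<open>real^2^2\<close> the library's
  inner product and norm are the Frobenius ones.\<close>

definition Sym :: "(real^2^2) set" where
  "Sym = {\<tau>. transpose \<tau> = \<tau>}"

definition L2 :: "(real^2) set \<Rightarrow> (real^2 \<Rightarrow> 'b::euclidean_space) set" where
  "L2 \<Omega> = {f. f \<in> borel_measurable (lebesgue_on \<Omega>) \<and>
               integrable (lebesgue_on \<Omega>) (\<lambda>x. (norm (f x))\<^sup>2)}"

definition L2_inner :: "(real^2) set \<Rightarrow> (real^2 \<Rightarrow> 'b::euclidean_space) \<Rightarrow> (real^2 \<Rightarrow> 'b) \<Rightarrow> real" where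
  "L2_inner \<Omega> f g = (LINT x|lebesgue_on \<Omega>. f x \<bullet> g x)"

definition pd :: "2 \<Rightarrow> (real^2 \<Rightarrow> 'b::real_normed_vector) \<Rightarrow> real^2 \<Rightarrow> 'b" where
  "pd i f x = frechet_derivative f (at x) (axis i 1)"

definition grad :: "(real^2 \<Rightarrow> real) \<Rightarrow> real^2 \<Rightarrow> real^2" where
  "grad \<phi> x = (\<chi> j. pd j \<phi> x)"

text \<open>\<open>C\<^sub>c\<^sup>\<infinity>\<close>: all iterated partial derivatives exist and are (totally) differentiable everywhere.\<close>

definition smooth :: "(real^2 \<Rightarrow> real) \<Rightarrow> bool" where
  "smooth \<phi> \<longleftrightarrow> (\<forall>is x. foldr pd is \<phi> differentiable (at x))"

definition test_functions :: "(real^2) set \<Rightarrow> (real^2 \<Rightarrow> real) set" where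
  "test_functions \<Omega> =
     {\<phi>. smooth \<phi> \<and> compact (closure {x. \<phi> x \<noteq> 0}) \<and> closure {x. \<phi> x \<noteq> 0} \<subseteq> \<Omega>}"

definition has_weak_pd ::
    "(real^2) set \<Rightarrow> 2 \<Rightarrow> (real^2 \<Rightarrow> 'b::euclidean_space) \<Rightarrow> (real^2 \<Rightarrow> 'b) \<Rightarrow> bool" where
  "has_weak_pd \<Omega> j f g \<longleftrightarrow>
     (\<forall>\<phi>\<in>test_functions \<Omega>.
        (LINT x|lebesgue_on \<Omega>. pd j \<phi> x *\<^sub>R f x) = - (LINT x|lebesgue_on \<Omega>. \<phi> x *\<^sub>R g x))"

text \<open>The \<open>i\<close>-th component of \<open>\<tau> *v grad \<phi>\<close> is the sum over \<open>j\<close> of \<open>\<tau>\<^sub>i\<^sub>j \<partial>\<^sub>j \<phi>\<close>, so the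
  following is the row-wise divergence.\<close>

definition has_weak_div ::
    "(real^2) set \<Rightarrow> (real^2 \<Rightarrow> real^2^2) \<Rightarrow> (real^2 \<Rightarrow> real^2) \<Rightarrow> bool" where
  "has_weak_div \<Omega> \<tau> g \<longleftrightarrow>
     (\<forall>\<phi>\<in>test_functions \<Omega>.
        (LINT x|lebesgue_on \<Omega>. \<tau> x *v grad \<phi> x) = - (LINT x|lebesgue_on \<Omega>. \<phi> x *\<^sub>R g x))"

text \<open>Unique up to null sets in \<open>\<Omega>\<close>.\<close>

definition wdiv :: "(real^2) set \<Rightarrow> (real^2 \<Rightarrow> real^2^2) \<Rightarrow> real^2 \<Rightarrow> real^2" where
  "wdiv \<Omega> \<tau> = (SOME g. g \<in> L2 \<Omega> \<and> has_weak_div \<Omega> \<tau> g)"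

definition Hdiv_Sym :: "(real^2) set \<Rightarrow> (real^2 \<Rightarrow> real^2^2) set" where
  "Hdiv_Sym \<Omega> = {\<tau> \<in> L2 \<Omega>. (AE x in lebesgue_on \<Omega>. \<tau> x \<in> Sym) \<and>
                              (\<exists>g\<in>L2 \<Omega>. has_weak_div \<Omega> \<tau> g)}"

definition H1_Sym :: "(real^2) set \<Rightarrow> (real^2 \<Rightarrow> real^2^2) set" where
  "H1_Sym \<Omega> = {\<tau> \<in> L2 \<Omega>. (AE x in lebesgue_on \<Omega>. \<tau> x \<in> Sym) \<and>
                            (\<forall>j. \<exists>g\<in>L2 \<Omega>. has_weak_pd \<Omega> j \<tau> g)}"

section \<open>Compliance tensors\<close>

text \<open>A map on symmetric matrices is represented by a linear map on all matrices, of which only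
  the values on \<^const>\<open>Sym\<close> matter.\<close>

definition compliance_tensor :: "(real^2^2 \<Rightarrow> real^2^2) \<Rightarrow> bool" where
  "compliance_tensor A \<longleftrightarrow> linear A \<and> A ` Sym \<subseteq> Sym \<and>
     (\<forall>\<tau>\<in>Sym. \<forall>\<rho>\<in>Sym. A \<tau> \<bullet> \<rho> = \<tau> \<bullet> A \<rho>) \<and> (\<forall>\<tau>\<in>Sym. \<tau> \<noteq> 0 \<longrightarrow> 0 < A \<tau> \<bullet> \<tau>)"

definition isotropic_compliance :: "real \<Rightarrow> real \<Rightarrow> real^2^2 \<Rightarrow> real^2^2" where
  "isotropic_compliance \<mu> lam \<tau> =
     (1 / (2 * \<mu>)) *\<^sub>R (\<tau> - (lam / (2 * \<mu> + 2 * lam) * trace \<tau>) *\<^sub>R mat 1)"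

definition norm_A ::
    "(real^2) set \<Rightarrow> (real^2^2 \<Rightarrow> real^2^2) \<Rightarrow> (real^2 \<Rightarrow> real^2^2) \<Rightarrow> real" where
  "norm_A \<Omega> A \<tau> = sqrt (L2_inner \<Omega> (\<lambda>x. A (\<tau> x)) \<tau>)"

section \<open>Domain and mesh\<close>

text \<open>The condition \<^term>\<open>interior (closure \<Omega>) = \<Omega>\<close> excludes slits, for which an edge inside the
  closure of \<open>\<Omega>\<close> would lie on the boundary and yet belong to two triangles.\<close>

definition polygonal_domain :: "(real^2) set \<Rightarrow> bool" where
  "polygonal_domain \<Omega> \<longleftrightarrow> \<Omega> \<noteq> {} \<and> open \<Omega> \<and> connected \<Omega> \<and> bounded \<Omega> \<and>
     interior (closure \<Omega>) = \<Omega> \<and>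
     (\<exists>S. finite S \<and> frontier \<Omega> = (\<Union>(a, b)\<in>S. closed_segment a b))"

definition mesh :: "(real^2) set \<Rightarrow> (real^2) set set \<Rightarrow> bool" where
  "mesh \<Omega> \<T> \<longleftrightarrow> triangulation \<T> \<and> (\<forall>K\<in>\<T>. 2 simplex K) \<and> \<Union>\<T> = closure \<Omega>"

definition inball_diameter :: "(real^2) set \<Rightarrow> real" where
  "inball_diameter K = Sup {2 * r | r. 0 \<le> r \<and> (\<exists>x. cball x r \<subseteq> K)}"

definition shape_regular :: "real \<Rightarrow> (real^2) set set \<Rightarrow> bool" where
  "shape_regular \<kappa> \<T> \<longleftrightarrow> (\<forall>K\<in>\<T>. diameter K \<le> \<kappa> * inball_diameter K)"

definition edges :: "(real^2) set set \<Rightarrow> (real^2) set set" where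
  "edges \<T> = {e. \<exists>K\<in>\<T>. e edge_of K}"

definition boundary_edges :: "(real^2) set \<Rightarrow> (real^2) set set \<Rightarrow> (real^2) set set" where
  "boundary_edges \<Omega> \<T> = {e \<in> edges \<T>. e \<subseteq> frontier \<Omega>}"

definition interior_edges :: "(real^2) set \<Rightarrow> (real^2) set set \<Rightarrow> (real^2) set set" where
  "interior_edges \<Omega> \<T> = edges \<T> - boundary_edges \<Omega> \<T>"

definition outward_normal :: "(real^2) set \<Rightarrow> (real^2) set \<Rightarrow> real^2" where
  "outward_normal K e = (THE \<nu>. norm \<nu> = 1 \<and> (\<forall>x\<in>e. \<forall>y\<in>e. \<nu> \<bullet> (y - x) = 0) \<and>
                                 (\<forall>x\<in>e. \<forall>y\<in>K. \<nu> \<bullet> (y - x) \<le> 0))"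

text \<open>\<open>K\<^sub>+\<close> and \<open>K\<^sub>-\<close>. On a boundary edge \<open>K\<^sub>+\<close> is the only adjacent triangle. On an interior edge
  the choice is arbitrary, and the unit normal is taken to point from \<open>K\<^sub>+\<close> to \<open>K\<^sub>-\<close>; the edge norms
  in the estimator depend neither on the choice of \<open>K\<^sub>+\<close> nor on the sign of the normal.\<close>

definition K_plus :: "(real^2) set set \<Rightarrow> (real^2) set \<Rightarrow> (real^2) set" where
  "K_plus \<T> e = (SOME K. K \<in> \<T> \<and> e edge_of K)"

definition K_minus :: "(real^2) set set \<Rightarrow> (real^2) set \<Rightarrow> (real^2) set" where
  "K_minus \<T> e = (SOME K. K \<in> \<T> \<and> e edge_of K \<and> K \<noteq> K_plus \<T> e)"

definition edge_normal :: "(real^2) set set \<Rightarrow> (real^2) set \<Rightarrow> real^2" where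
  "edge_normal \<T> e = outward_normal (K_plus \<T> e) e"

definition edge_tangent :: "(real^2) set set \<Rightarrow> (real^2) set \<Rightarrow> real^2" where
  "edge_tangent \<T> e = vector [- (edge_normal \<T> e $ 2), edge_normal \<T> e $ 1]"

section \<open>The Hu--Zhang element\<close>

definition polys :: "nat \<Rightarrow> (real^2 \<Rightarrow> 'b::real_vector) set" where
  "polys k = {p. \<exists>c. \<forall>x. p x = (\<Sum>(i, j) | i + j \<le> k. ((x $ 1) ^ i * (x $ 2) ^ j) *\<^sub>R c i j)}"

definition polys_Sym :: "nat \<Rightarrow> (real^2 \<Rightarrow> real^2^2) set" where
  "polys_Sym k = {p \<in> polys k. range p \<subseteq> Sym}"

definition bubbles :: "nat \<Rightarrow> (real^2) set \<Rightarrow> (real^2 \<Rightarrow> real^2^2) set" where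
  "bubbles k K = {p \<in> polys_Sym k. \<forall>e. e edge_of K \<longrightarrow> (\<forall>x\<in>e. p x *v outward_normal K e = 0)}"

definition bubble_space ::
    "nat \<Rightarrow> (real^2) set \<Rightarrow> (real^2) set set \<Rightarrow> (real^2 \<Rightarrow> real^2^2) set" where
  "bubble_space k \<Omega> \<T> =
     {\<tau> \<in> Hdiv_Sym \<Omega>. \<forall>K\<in>\<T>. \<exists>p\<in>bubbles k K. AE x in lebesgue_on K. \<tau> x = p x}"

definition H1_space ::
    "nat \<Rightarrow> (real^2) set \<Rightarrow> (real^2) set set \<Rightarrow> (real^2 \<Rightarrow> real^2^2) set" where
  "H1_space k \<Omega> \<T> =
     {\<tau> \<in> H1_Sym \<Omega>. \<forall>K\<in>\<T>. \<exists>p\<in>polys_Sym k. AE x in lebesgue_on K. \<tau> x = p x}"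

definition Sigma_h ::
    "nat \<Rightarrow> (real^2) set \<Rightarrow> (real^2) set set \<Rightarrow> (real^2 \<Rightarrow> real^2^2) set" where
  "Sigma_h k \<Omega> \<T> = {\<lambda>x. \<tau> x + \<beta> x | \<tau> \<beta>. \<tau> \<in> H1_space k \<Omega> \<T> \<and> \<beta> \<in> bubble_space k \<Omega> \<T>}"

definition V_h ::
    "nat \<Rightarrow> (real^2) set \<Rightarrow> (real^2) set set \<Rightarrow> (real^2 \<Rightarrow> real^2) set" where
  "V_h k \<Omega> \<T> = {v \<in> L2 \<Omega>. \<forall>K\<in>\<T>. \<exists>p\<in>polys (k - 1). AE x in lebesgue_on K. v x = p x}"

section \<open>The mixed problems\<close>

text \<open>Used both for the continuous pair of spaces and for the discrete one.\<close>

definition mixed_solution ::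
    "(real^2) set \<Rightarrow> (real^2^2 \<Rightarrow> real^2^2) \<Rightarrow> (real^2 \<Rightarrow> real^2) \<Rightarrow>
     (real^2 \<Rightarrow> real^2^2) set \<Rightarrow> (real^2 \<Rightarrow> real^2) set \<Rightarrow>
     (real^2 \<Rightarrow> real^2^2) \<Rightarrow> (real^2 \<Rightarrow> real^2) \<Rightarrow> bool" where
  "mixed_solution \<Omega> A f W Q \<sigma> u \<longleftrightarrow> \<sigma> \<in> W \<and> u \<in> Q \<and>
     (\<forall>\<tau>\<in>W. L2_inner \<Omega> (\<lambda>x. A (\<sigma> x)) \<tau> + L2_inner \<Omega> (wdiv \<Omega> \<tau>) u = 0) \<and>
     (\<forall>v\<in>Q. L2_inner \<Omega> (wdiv \<Omega> \<sigma>) v = L2_inner \<Omega> f v)"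

section \<open>The estimator\<close>

definition curl_tensor :: "(real^2 \<Rightarrow> real^2^2) \<Rightarrow> real^2 \<Rightarrow> real^2" where
  "curl_tensor \<tau> x = vector [pd 1 (\<lambda>y. \<tau> y $ 1 $ 2) x - pd 2 (\<lambda>y. \<tau> y $ 1 $ 1) x,
                             pd 1 (\<lambda>y. \<tau> y $ 2 $ 2) x - pd 2 (\<lambda>y. \<tau> y $ 2 $ 1) x]"

definition curl_vec :: "(real^2 \<Rightarrow> real^2) \<Rightarrow> real^2 \<Rightarrow> real" where
  "curl_vec w x = pd 1 (\<lambda>y. w y $ 2) x - pd 2 (\<lambda>y. w y $ 1) x"

text \<open>For \<open>\<tau>\<close> piecewise polynomial, the polynomial on the whole plane which agrees with \<open>\<tau>\<close> almost
  everywhere in \<open>K\<close>. It provides the elementwise derivatives and the traces on the edges of \<open>K\<close>.\<close>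

definition piece :: "(real^2 \<Rightarrow> real^2^2) \<Rightarrow> (real^2) set \<Rightarrow> real^2 \<Rightarrow> real^2^2" where
  "piece \<tau> K = (SOME p. (\<exists>m. p \<in> polys m) \<and> (AE x in lebesgue_on K. \<tau> x = p x))"

definition edge_norm_sq :: "(real^2) set \<Rightarrow> (real^2 \<Rightarrow> real) \<Rightarrow> real" where
  "edge_norm_sq e g = (let (a, b) = (SOME (a, b). e = closed_segment a b) in
     dist a b * integral {0..1} (\<lambda>s. (g (linepath a b s))\<^sup>2))"

definition J1 :: "(real^2) set \<Rightarrow> (real^2) set set \<Rightarrow> (real^2^2 \<Rightarrow> real^2^2) \<Rightarrow>
    (real^2 \<Rightarrow> real^2^2) \<Rightarrow> (real^2) set \<Rightarrow> real^2 \<Rightarrow> real" where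
  "J1 \<Omega> \<T> A \<sigma>h e x =
     (let t = edge_tangent \<T> e;
          M = (\<lambda>K x. A (piece \<sigma>h K x))
      in if e \<in> boundary_edges \<Omega> \<T>
         then (M (K_plus \<T> e) x *v t) \<bullet> t
         else (M (K_plus \<T> e) x *v t) \<bullet> t - (M (K_minus \<T> e) x *v t) \<bullet> t)"

definition J2 :: "(real^2) set \<Rightarrow> (real^2) set set \<Rightarrow> (real^2^2 \<Rightarrow> real^2^2) \<Rightarrow>
    (real^2 \<Rightarrow> real^2^2) \<Rightarrow> (real^2) set \<Rightarrow> real^2 \<Rightarrow> real" where
  "J2 \<Omega> \<T> A \<sigma>h e x =
     (let \<nu> = edge_normal \<T> e; t = edge_tangent \<T> e;
          M = (\<lambda>K x. A (piece \<sigma>h K x))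
      in if e \<in> boundary_edges \<Omega> \<T>
         then curl_tensor (M (K_plus \<T> e)) x \<bullet> t -
              frechet_derivative (\<lambda>y. (M (K_plus \<T> e) y *v t) \<bullet> \<nu>) (at x) t
         else curl_tensor (M (K_plus \<T> e)) x \<bullet> t - curl_tensor (M (K_minus \<T> e)) x \<bullet> t)"

definition estimator :: "(real^2) set \<Rightarrow> (real^2) set set \<Rightarrow> (real^2^2 \<Rightarrow> real^2^2) \<Rightarrow>
    (real^2 \<Rightarrow> real^2^2) \<Rightarrow> real" where
  "estimator \<Omega> \<T> A \<sigma>h = sqrt (
     (\<Sum>K\<in>\<T>. diameter K ^ 4 *
        (LINT x|lebesgue_on K. (curl_vec (curl_tensor (\<lambda>y. A (piece \<sigma>h K y))) x)\<^sup>2)) +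
     (\<Sum>e\<in>interior_edges \<Omega> \<T> \<union> boundary_edges \<Omega> \<T>.
        diameter e * edge_norm_sq e (J1 \<Omega> \<T> A \<sigma>h e) +
        diameter e ^ 3 * edge_norm_sq e (J2 \<Omega> \<T> A \<sigma>h e)))"

end

theory Submission
  imports Defs
begin

text \<open>For a compactly supported scalar potential \<open>\<psi>\<close> its Airy tensor \<open>\<tau>\<close> is symmetric and
  divergence free, so \<open>(A \<sigma>, \<tau>) = 0\<close>, and \<open>(A \<sigma>\<^sub>h, \<tau>) = - (A (\<sigma> - \<sigma>\<^sub>h), \<tau>)\<close> is controlled by
  \<open>\<parallel>\<sigma> - \<sigma>\<^sub>h\<parallel>\<^sub>A\<close> on the support of \<open>\<tau>\<close>. Integration by parts turns \<open>(A \<sigma>\<^sub>h, \<tau>)\<close> into the pairing of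
  \<open>\<psi>\<close> with \<open>curl curl (A \<sigma>\<^sub>h)\<close>, and of the traces of \<open>\<psi>\<close> and its normal derivative with the edge
  residuals. In the coordinates attached to an edge (tangent, normal, scaled by the edge length) shape
  regularity puts a fixed rectangle next to the middle half of the edge inside each adjacent triangle, and
  products \<open>B(s) C(r)\<close> of one-dimensional bumps dual to the monomials up to degree \<open>k\<close> read off the
  coefficients of every residual one by one. Only finitely many reference bumps occur, so the
  constant depends only on \<open>k\<close>, the shape regularity and the bounds on \<open>A\<close>.

  On interior edges the pairing yields the jump of \<open>curl (A \<sigma>\<^sub>h) \<cdot> t\<close> up to the tangential derivative of
  the jump of \<open>(A \<sigma>\<^sub>h) t \<cdot> \<nu>\<close>. Since the normal component of \<open>\<sigma>\<^sub>h\<close> is continuous, the jump of \<open>\<sigma>\<^sub>h\<close> is a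
  multiple of \<open>t \<otimes> t\<close>, so that this extra term is a multiple of the jump of \<open>(A \<sigma>\<^sub>h) t \<cdot> t\<close>; the factor is
  bounded by the ellipticity constants of \<open>A\<close>, and vanishes in the isotropic case.\<close>

section \<open>Frames\<close>

text \<open>Two obstacles shape the proof. First, the constant must not see \<open>lam\<close>: in
  the isotropic case A I = I / (2 \<mu> + 2 \<open>lam\<close>), so no lower bound on A holds
  uniformly. The residual bounds therefore rest on the upper bound of A alone, through
  Cauchy-Schwarz in the A-inner product, and the comparison of the jump of (A \<sigma>h) t . \<nu>
  with that of (A \<sigma>h) t . t is isolated in a ratio \<rho>, found separately for each class of
  tensors. Second, the spaces are given by weak derivatives. The test tensors are polynomial Airy
  tensors cut off to rectangles, hence only piecewise smooth; their weak divergence is computed by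
  parts on rectangles, and the representative \<open>wdiv\<close> is then identified by the
  fundamental lemma. Equality of the traces of the H1 part of \<sigma>h comes from smooth bumps that
  concentrate on the edge. Dual bumps stand in for the usual bubble functions multiplied by the
  residual: bounds on single coefficients replace norm equivalences on polynomial spaces, and edge
  bumps orthogonal to the monomials up to degree k decouple the edge residuals from the curl-curl
  residual.\<close>

definition perp :: "real^2 \<Rightarrow> real^2" where
  "perp v = vector [- (v $ 2), v $ 1]"

lemma perp_nth [simp]: "perp v $ 1 = - (v $ 2)" "perp v $ 2 = v $ 1"
  by (simp_all add: perp_def)

lemma inner_vec2: "(x::real^2) \<bullet> y = x $ 1 * y $ 1 + x $ 2 * y $ 2"
  by (simp add: inner_vec_def sum_2)

lemma vec2_eq_iff: "(x::real^2) = y \<longleftrightarrow> x $ 1 = y $ 1 \<and> x $ 2 = y $ 2"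
  by (simp add: vec_eq_iff forall_2)

lemma Basis_vec2: "(Basis :: (real^2) set) = {axis 1 1, axis 2 1}"
  by (auto simp: Basis_vec_def UNIV_2)

lemma continuous_on_vec2 [continuous_intros]:
  fixes f g :: "'a::topological_space \<Rightarrow> real"
  assumes "continuous_on S f" "continuous_on S g"
  shows "continuous_on S (\<lambda>x. vector [f x, g x] :: real^2)"
proof -
  have "(\<lambda>x. vector [f x, g x] :: real^2) = (\<lambda>x. f x *\<^sub>R axis 1 1 + g x *\<^sub>R axis 2 1)"
    by (auto simp: vec2_eq_iff axis_def)
  then show ?thesis by (simp only:) (intro continuous_intros assms)
qed

text \<open>Bridge between the types \<open>real^2\<close>, where the problem lives, and
  \<open>real * real\<close>, where iterated integration is available. A measure with the right
  values on boxes is \<open>lborel\<close>.\<close>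

lemma distr_lborel_vector:
  "distr (lborel :: (real \<times> real) measure) borel (\<lambda>p. vector [fst p, snd p] :: real^2) = lborel"
proof (rule lborel_eqI [symmetric])
  have meas: "(\<lambda>p::real\<times>real. vector [fst p, snd p] :: real^2) \<in> borel_measurable lborel"
    by (auto intro!: borel_measurable_continuous_onI continuous_intros)
  show "emeasure (distr (lborel :: (real \<times> real) measure) borel (\<lambda>p. vector [fst p, snd p])) (box l u) =
      ennreal (\<Prod>b\<in>Basis. (u - l) \<bullet> b)" 
    if le: "\<And>b. b \<in> Basis \<Longrightarrow> l \<bullet> b \<le> u \<bullet> b" for l u :: "real^2"
  proof -
    have le': "l $ 1 \<le> u $ 1" "l $ 2 \<le> u $ 2"
      using le[of "axis 1 1"] le[of "axis 2 1"] by (auto simp: Basis_vec2 inner_axis)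
    have "(\<lambda>p::real\<times>real. vector [fst p, snd p] :: real^2) -` box l u = box (l $ 1, l $ 2) (u $ 1, u $ 2)"
      by (auto simp: mem_box Basis_vec2 Basis_prod_def inner_axis)
    then have "emeasure (distr (lborel :: (real \<times> real) measure) borel (\<lambda>p. vector [fst p, snd p] :: real^2)) (box l u)
       = emeasure lborel (box (l $ 1, l $ 2) (u $ 1, u $ 2))"
      using meas by (subst emeasure_distr) auto
    also have "\<dots> = ennreal (\<Prod>b\<in>Basis. ((u $ 1, u $ 2) - (l $ 1, l $ 2)) \<bullet> b)"
      using le' by (subst emeasure_lborel_box) (auto simp: Basis_prod_def)
    also have "(\<Prod>b\<in>Basis. ((u $ 1, u $ 2) - (l $ 1, l $ 2)) \<bullet> b) = (u $ 1 - l $ 1) * (u $ 2 - l $ 2)"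
      by (simp add: Basis_prod_def prod.insert)
    also have "\<dots> = (\<Prod>b\<in>Basis. (u - l) \<bullet> b)"
      by (simp add: Basis_vec2 inner_axis axis_eq_axis)
    finally show ?thesis .
  qed
qed simp

text \<open>Change of variables as an identity of measures. Again boxes suffice, and there it says
  that the preimage of a box, scaled by the determinant, has the volume of the box.\<close>

lemma lborel_scaled_linear_image:
  fixes g :: "real^2 \<Rightarrow> real^2"
  assumes "linear g" "bij g"
  shows "(lborel :: (real^2) measure) = density (distr lborel borel g) (\<lambda>_. ennreal \<bar>det (matrix g)\<bar>)"
proof (rule lborel_eqI)
  have meas: "g \<in> borel_measurable lborel"
    by (auto intro!: borel_measurable_continuous_onI linear_continuous_on simp: linear_conv_bounded_linear[symmetric] assms)
  fix l u :: "real^2" assume le: "\<And>b. b \<in> Basis \<Longrightarrow> l \<bullet> b \<le> u \<bullet> b"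
  have img: "g ` (g -` box l u) = box l u" using assms by (simp add: bij_is_surj surj_image_vimage_eq)
  have inv: "g -` box l u = inv g ` box l u" using assms by (simp add: bij_vimage_eq_inv_image)
  have lin: "linear (inv g)"
    using inj_linear_imp_inv_linear[OF assms(1) bij_is_inj[OF assms(2)]] .
  have lm: "g -` box l u \<in> lmeasurable"
    unfolding inv using measurable_linear_image[OF lin lmeasurable_box] .
  have open_v: "open (g -` box l u)"
    using assms by (intro open_vimage) (auto intro: linear_continuous_on simp: linear_conv_bounded_linear[symmetric])
  have "emeasure lborel (g -` box l u) = ennreal (measure lebesgue (g -` box l u))"
    using lm open_v emeasure_eq_measure2[OF lm] by simp
  then have "ennreal \<bar>det (matrix g)\<bar> * emeasure lborel (g -` box l u) = ennreal (\<bar>det (matrix g)\<bar> * measure lebesgue (g -` box l u))"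
    by (simp add: ennreal_mult)
  also have "\<bar>det (matrix g)\<bar> * measure lebesgue (g -` box l u) = measure lebesgue (box l u)"
    using measure_linear_image[OF assms(1) lm] img by simp
  also have "\<dots> = (\<Prod>b\<in>Basis. (u - l) \<bullet> b)"
    using le by (auto simp: measure_lborel_box_eq)
  finally show "emeasure (density (distr lborel borel g) (\<lambda>_. ennreal \<bar>det (matrix g)\<bar>)) (box l u) = (\<Prod>b\<in>Basis. (u - l) \<bullet> b)"
    using meas by (subst emeasure_density_const, simp, subst emeasure_distr) auto
qed simp

text \<open>The point with tangential coordinate s and normal coordinate r, both in units of the
  length h and with origin a. With this scaling the middle half of an edge is always [1/4, 3/4], and
  all reference bumps are independent of h. \<open>cs\<close> and \<open>cr\<close> read the
  coordinates back.\<close>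

definition fr :: "real^2 \<Rightarrow> real^2 \<Rightarrow> real \<Rightarrow> real \<Rightarrow> real \<Rightarrow> real^2" where
  "fr a \<nu> h s r = a + (h * s) *\<^sub>R perp \<nu> + (h * r) *\<^sub>R \<nu>"

definition cs :: "real^2 \<Rightarrow> real^2 \<Rightarrow> real \<Rightarrow> real^2 \<Rightarrow> real" where
  "cs a \<nu> h x = ((x - a) \<bullet> perp \<nu>) / h"

definition cr :: "real^2 \<Rightarrow> real^2 \<Rightarrow> real \<Rightarrow> real^2 \<Rightarrow> real" where
  "cr a \<nu> h x = ((x - a) \<bullet> \<nu>) / h"

locale frame =
  fixes a \<nu> :: "real^2" and h :: real
  assumes norm_nu: "norm \<nu> = 1" and h_pos: "0 < h"
begin

abbreviation "F \<equiv> fr a \<nu> h"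
abbreviation "S \<equiv> cs a \<nu> h"
abbreviation "R \<equiv> cr a \<nu> h"
abbreviation "tau \<equiv> perp \<nu>"

lemma nu_sq: "\<nu> $ 1 * \<nu> $ 1 + \<nu> $ 2 * \<nu> $ 2 = 1"
  using norm_nu by (simp add: norm_eq_1 inner_vec2)

lemma inner_frame [simp]: "\<nu> \<bullet> \<nu> = 1" "tau \<bullet> tau = 1" "tau \<bullet> \<nu> = 0" "\<nu> \<bullet> tau = 0"
  using nu_sq by (auto simp: inner_vec2 algebra_simps)

lemma frame_decomp: "(x \<bullet> tau) *\<^sub>R tau + (x \<bullet> \<nu>) *\<^sub>R \<nu> = x"
proof -
  have "x $ 1 * (\<nu> $ 1 * \<nu> $ 1 + \<nu> $ 2 * \<nu> $ 2) = x $ 1" "x $ 2 * (\<nu> $ 1 * \<nu> $ 1 + \<nu> $ 2 * \<nu> $ 2) = x $ 2"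
    by (simp_all add: nu_sq)
  then show ?thesis by (simp add: vec2_eq_iff inner_vec2 algebra_simps)
qed

lemma S_F [simp]: "S (F s r) = s" and R_F [simp]: "R (F s r) = r"
  using h_pos by (simp_all add: cs_def cr_def fr_def inner_add_left)

lemma F_S_R [simp]: "F (S x) (R x) = x"
  using h_pos frame_decomp[of "x - a"] by (simp add: cs_def cr_def fr_def add.assoc)

lemma continuous_on_S [continuous_intros]: "continuous_on A f \<Longrightarrow> continuous_on A (\<lambda>x. S (f x))"
  and continuous_on_R [continuous_intros]: "continuous_on A f \<Longrightarrow> continuous_on A (\<lambda>x. R (f x))"
  using h_pos by (auto simp: cs_def cr_def intro!: continuous_intros)

lemma continuous_on_F [continuous_intros]:
  "continuous_on A f \<Longrightarrow> continuous_on A g \<Longrightarrow> continuous_on A (\<lambda>x. F (f x) (g x))"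
  by (auto simp: fr_def intro!: continuous_intros)

lemma lborel_frame:
  "lborel = density (distr lborel borel (\<lambda>p. F (fst p) (snd p))) (\<lambda>_. ennreal (h\<^sup>2))"
proof -
  define g :: "real^2 \<Rightarrow> real^2" where "g = (\<lambda>y. (h * y $ 1) *\<^sub>R tau + (h * y $ 2) *\<^sub>R \<nu>)"
  have lin: "linear g"
    by (rule linearI) (simp_all add: g_def vec2_eq_iff algebra_simps)
  have inv1: "g (vector [(x \<bullet> tau) / h, (x \<bullet> \<nu>) / h]) = x" for x
    using h_pos by (simp add: g_def frame_decomp)
  have inv2: "vector [(g x \<bullet> tau) / h, (g x \<bullet> \<nu>) / h] = x" for x
    using h_pos by (simp add: g_def inner_add_left vec2_eq_iff)
  have bij: "bij g"
    by (rule o_bij[of "\<lambda>x. vector [(x \<bullet> tau) / h, (x \<bullet> \<nu>) / h]"]) (auto simp: inv1 inv2 fun_eq_iff)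
  \<comment> \<open>The frame (\<open>perp\<close> \<nu>, \<nu>) is negatively oriented, hence the
    sign; only the absolute value enters the density.\<close>
  have "det (matrix g) = - h\<^sup>2"
    using nu_sq by (simp add: det_2 matrix_def g_def axis_def power2_eq_square) algebra
  then have 1: "lborel = density (distr lborel borel g) (\<lambda>_. ennreal (h\<^sup>2))"
    using lborel_scaled_linear_image[OF lin bij] by simp
  have mg: "g \<in> borel_measurable borel"
    using lin by (auto intro!: borel_measurable_continuous_onI linear_continuous_on simp: linear_conv_bounded_linear[symmetric])
  have mv: "(\<lambda>p::real\<times>real. vector [fst p, snd p] :: real^2) \<in> borel_measurable borel"
    by (auto intro!: borel_measurable_continuous_onI continuous_intros)
  have ma: "(+) a \<in> borel_measurable borel"
    by simp
  have "(lborel :: (real^2) measure) = distr lborel borel ((+) a)"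
    by (simp add: lborel_distr_plus)
  also have "\<dots> = distr (density (distr lborel borel g) (\<lambda>_. ennreal (h\<^sup>2))) borel ((+) a)"
    using 1 by simp
  also have "\<dots> = density (distr (distr lborel borel g) borel ((+) a)) (\<lambda>_. ennreal (h\<^sup>2))"
    by (subst density_distr) auto
  also have "distr (distr lborel borel g) borel ((+) a) = distr lborel borel ((+) a \<circ> g)"
    using mg by (subst distr_distr) auto
  also have "\<dots> = distr (distr lborel borel (\<lambda>p. vector [fst p, snd p])) borel ((+) a \<circ> g)"
    by (simp add: distr_lborel_vector)
  also have "\<dots> = distr lborel borel ((+) a \<circ> g \<circ> (\<lambda>p. vector [fst p, snd p]))"
    using mg mv ma by (subst distr_distr) auto
  also have "(+) a \<circ> g \<circ> (\<lambda>p. vector [fst p, snd p]) = (\<lambda>p. F (fst p) (snd p))"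
    by (auto simp: fun_eq_iff g_def fr_def)
  finally show ?thesis .
qed

section \<open>Integration over rectangles aligned with an edge\<close>

definition rect :: "real \<Rightarrow> real \<Rightarrow> real \<Rightarrow> real \<Rightarrow> (real^2) set" where
  "rect s0 s1 l u = {x. s0 \<le> S x \<and> S x \<le> s1 \<and> l \<le> R x \<and> R x \<le> u}"

lemma rect_eq_image: "rect s0 s1 l u = (\<lambda>p. F (fst p) (snd p)) ` cbox (s0, l) (s1, u)"
proof -
  have "x \<in> (\<lambda>p. F (fst p) (snd p)) ` cbox (s0, l) (s1, u)" if "x \<in> rect s0 s1 l u" for x
    using that by (intro image_eqI[of _ _ "(S x, R x)"]) (auto simp: rect_def)
  then show ?thesis by (auto simp: rect_def)
qed

lemma compact_rect [simp]: "compact (rect s0 s1 l u)"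
  unfolding rect_eq_image by (intro compact_continuous_image continuous_intros) auto

lemma rect_sets [measurable, simp]: "rect s0 s1 l u \<in> sets borel" "rect s0 s1 l u \<in> sets lebesgue"
  using compact_imp_closed[OF compact_rect] by (auto simp: borel_closed lmeasurable_compact fmeasurableD)

text \<open>Every area integral of a test tensor is evaluated by this rule. The function f may be
  arbitrary off the rectangle: the integrand cut off by the indicator factors through (S, R), and
  this factorisation also gives its measurability.\<close>

lemma rect_integral:
  fixes f :: "real^2 \<Rightarrow> 'b::euclidean_space"
  assumes cont: "continuous_on (cbox (s0, l) (s1, u)) (\<lambda>p. f (F (fst p) (snd p)))"
  shows "set_integrable lebesgue (rect s0 s1 l u) f"
    and "(LINT x:rect s0 s1 l u|lebesgue. f x) =
      h\<^sup>2 *\<^sub>R integral (cbox (s0, l) (s1, u)) (\<lambda>p. f (F (fst p) (snd p)))"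
proof -
  let ?I = "cbox (s0, l) (s1, u)" and ?\<Phi> = "\<lambda>p. F (fst p) (snd p)"
  let ?g = "\<lambda>p. indicator ?I p *\<^sub>R f (?\<Phi> p)" and ?f = "\<lambda>x. indicator (rect s0 s1 l u) x *\<^sub>R f x"
  have fg: "?f (?\<Phi> p) = ?g p" for p
    by (cases p) (auto simp: rect_def indicator_def)
  have gf: "?f = ?g \<circ> (\<lambda>x. (S x, R x))"
    by (auto simp: fun_eq_iff rect_def indicator_def)
  have mg: "?g \<in> borel_measurable borel"
    by (rule borel_measurable_continuous_on_indicator) (use cont in auto)
  have mf: "?f \<in> borel_measurable borel"
    unfolding gf by (intro measurable_comp[OF _ mg] borel_measurable_continuous_onI continuous_intros)
  have m\<Phi>: "?\<Phi> \<in> borel_measurable borel"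
    by (intro borel_measurable_continuous_onI continuous_intros)
  have ig: "integrable lborel ?g"
    by (rule borel_integrable_compact) (use cont in auto)
  then have "integrable (distr lborel borel ?\<Phi>) ?f"
    using mf m\<Phi> by (subst integrable_distr_eq) (auto simp: fg)
  then have "integrable (density (distr lborel borel ?\<Phi>) (\<lambda>_. ennreal (h\<^sup>2))) ?f"
    using mf by (subst integrable_density) (auto simp flip: scaleR_scaleR)
  then have "integrable lborel ?f"
    using lborel_frame by simp
  then show "set_integrable lebesgue (rect s0 s1 l u) f"
    using mf by (simp add: set_integrable_def integrable_completion)
  have "(LINT x:rect s0 s1 l u|lebesgue. f x) = (\<integral>x. ?f x \<partial>lborel)"
    using mf by (simp add: set_lebesgue_integral_def integral_completion)
  also have "\<dots> = (\<integral>x. ?f x \<partial>density (distr lborel borel ?\<Phi>) (\<lambda>_. ennreal (h\<^sup>2)))"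
    using lborel_frame by simp
  also have "\<dots> = h\<^sup>2 *\<^sub>R (\<integral>x. ?f x \<partial>distr lborel borel ?\<Phi>)"
    using mf by (subst integral_density) (auto simp flip: scaleR_scaleR)
  also have "\<dots> = h\<^sup>2 *\<^sub>R (\<integral>p. ?g p \<partial>lborel)"
    using mf m\<Phi> by (subst integral_distr) (auto simp: fg)
  also have "(\<integral>p. ?g p \<partial>lborel) = integral ?I (\<lambda>p. f (?\<Phi> p))"
    using set_borel_integral_eq_integral(2)[of ?I "\<lambda>p. f (?\<Phi> p)"] ig
    by (simp add: set_integrable_def set_lebesgue_integral_def)
  finally show "(LINT x:rect s0 s1 l u|lebesgue. f x) =
      h\<^sup>2 *\<^sub>R integral ?I (\<lambda>p. f (?\<Phi> p))" .
qed

end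

text \<open>The fundamental theorem of calculus in one variable, followed by integration in the
  other one, with the order chosen for each summand. All integrations by parts below are
  instances.\<close>

lemma integral_divergence_rectangle:
  fixes X Y Xs Yr :: "real \<Rightarrow> real \<Rightarrow> 'b::euclidean_space"
  assumes le: "s0 \<le> s1" "l \<le> u"
    and X: "\<And>s r. s \<in> {s0..s1} \<Longrightarrow> r \<in> {l..u} \<Longrightarrow> ((\<lambda>s. X s r) has_vector_derivative Xs s r) (at s within {s0..s1})"
    and Y: "\<And>s r. s \<in> {s0..s1} \<Longrightarrow> r \<in> {l..u} \<Longrightarrow> ((\<lambda>r. Y s r) has_vector_derivative Yr s r) (at r within {l..u})"
    and cX: "continuous_on (cbox (s0, l) (s1, u)) (\<lambda>p. Xs (fst p) (snd p))"
    and cY: "continuous_on (cbox (s0, l) (s1, u)) (\<lambda>p. Yr (fst p) (snd p))"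
  shows "integral (cbox (s0, l) (s1, u)) (\<lambda>p. Xs (fst p) (snd p) + Yr (fst p) (snd p)) =
     integral {l..u} (\<lambda>r. X s1 r - X s0 r) + integral {s0..s1} (\<lambda>s. Y s u - Y s l)"
proof -
  have "integral (cbox (s0, l) (s1, u)) (\<lambda>p. Xs (fst p) (snd p) + Yr (fst p) (snd p)) =
     integral (cbox (s0, l) (s1, u)) (\<lambda>p. Xs (fst p) (snd p)) + integral (cbox (s0, l) (s1, u)) (\<lambda>p. Yr (fst p) (snd p))"
    by (rule Henstock_Kurzweil_Integration.integral_add) (auto intro: integrable_continuous cX cY)
  moreover have "integral (cbox (s0, l) (s1, u)) (\<lambda>p. Yr (fst p) (snd p)) = integral {s0..s1} (\<lambda>s. Y s u - Y s l)"
  proof -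
    have "integral (cbox (s0, l) (s1, u)) (\<lambda>p. Yr (fst p) (snd p)) =
       integral (cbox s0 s1) (\<lambda>s. integral (cbox l u) (\<lambda>r. Yr s r))"
      using integral_prod_continuous[OF cY] by simp
    also have "\<dots> = integral (cbox s0 s1) (\<lambda>s. Y s u - Y s l)"
      by (rule integral_cong) (auto intro!: integral_unique fundamental_theorem_of_calculus Y le)
    finally show ?thesis by simp
  qed
  moreover have "integral (cbox (s0, l) (s1, u)) (\<lambda>p. Xs (fst p) (snd p)) = integral {l..u} (\<lambda>r. X s1 r - X s0 r)"
  proof -
    have "integral (cbox (s0, l) (s1, u)) (\<lambda>p. Xs (fst p) (snd p)) =
       integral (cbox s0 s1) (\<lambda>s. integral (cbox l u) (\<lambda>r. Xs s r))"
      using integral_prod_continuous[OF cX] by simp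
    also have "\<dots> = integral (cbox l u) (\<lambda>r. integral (cbox s0 s1) (\<lambda>s. Xs s r))"
      using cX by (intro integral_swap_continuous) (simp add: case_prod_unfold)
    also have "\<dots> = integral (cbox l u) (\<lambda>r. X s1 r - X s0 r)"
      by (rule integral_cong) (auto intro!: integral_unique fundamental_theorem_of_calculus X le)
    finally show ?thesis by simp
  qed
  ultimately show ?thesis by simp
qed

section \<open>Dual bump polynomials\<close>

text \<open>Block elimination, one index at a time: restricting to vectors that vanish at the new
  index b keeps the form positive definite on the old indices, and the Schur complement at b is
  positive.\<close>

lemma positive_definite_solvable:
  fixes G :: "'a \<Rightarrow> 'a \<Rightarrow> real"
  assumes "finite I" and "\<And>i j. G i j = G j i"
    and "\<And>x. \<exists>i\<in>I. x i \<noteq> 0 \<Longrightarrow> 0 < (\<Sum>i\<in>I. x i * (\<Sum>j\<in>I. G i j * x j))"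
  shows "\<exists>z. \<forall>i\<in>I. (\<Sum>j\<in>I. G i j * z j) = l i"
  using assms(1,3)
proof (induction I arbitrary: l)
  case empty
  then show ?case by simp
next
  case (insert b I)
  have ext: "(\<Sum>j\<in>insert b I. g j * (z(b := t)) j) = g b * t + (\<Sum>j\<in>I. g j * z j)" for g z :: "'a \<Rightarrow> real" and t
    using insert.hyps by (auto intro!: sum.cong)
  have pd: "0 < (\<Sum>i\<in>I. x i * (\<Sum>j\<in>I. G i j * x j))" if "\<exists>i\<in>I. x i \<noteq> 0" for x
  proof -
    have "0 < (\<Sum>i\<in>insert b I. (x(b := 0)) i * (\<Sum>j\<in>insert b I. G i j * (x(b := 0)) j))"
      using that insert.hyps by (intro insert.prems) auto
    also have "\<dots> = (\<Sum>i\<in>I. x i * (\<Sum>j\<in>I. G i j * x j))"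
      unfolding ext using insert.hyps by (auto intro!: sum.cong)
    finally show ?thesis .
  qed
  obtain z where z: "\<forall>i\<in>I. (\<Sum>j\<in>I. G i j * z j) = l i" using insert.IH[OF pd] by blast
  \<comment> \<open>The vector (y, 1) is mapped by G to zero on I. Its value c b at the new index is
    the Schur complement, which equals the quadratic form at (y, 1). Adding a multiple of (y, 1) to
    (z, 0) thus repairs row b without disturbing the others.\<close>
  obtain y where y: "\<forall>i\<in>I. (\<Sum>j\<in>I. G i j * y j) = - G i b" using insert.IH[OF pd, of "\<lambda>i. - G i b"] by blast
  define c where "c = (\<lambda>i. (\<Sum>j\<in>insert b I. G i j * (y(b := 1)) j))"
  have c0: "c i = 0" if "i \<in> I" for i
    unfolding c_def ext using y that by simp
  have "0 < (\<Sum>i\<in>insert b I. (y(b := 1)) i * c i)"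
    unfolding c_def by (rule insert.prems) auto
  also have "\<dots> = c b + (\<Sum>i\<in>I. y i * c i)"
    using insert.hyps by (auto intro!: sum.cong)
  also have "(\<Sum>i\<in>I. y i * c i) = 0"
    using c0 by simp
  finally have cb: "0 < c b" by simp
  define t where "t = (l b - (\<Sum>j\<in>I. G b j * z j)) / c b"
  have eq: "(\<Sum>j\<in>insert b I. G i j * (z(b := 0)) j + t * (G i j * (y(b := 1)) j)) = 
      (\<Sum>j\<in>I. G i j * z j) + t * c i" for i
    unfolding sum.distrib ext[of "G i" z 0] sum_distrib_left[symmetric] c_def by simp
  have "(\<Sum>j\<in>insert b I. G i j * ((z(b := 0)) j + t * (y(b := 1)) j)) = l i" if "i \<in> insert b I" for i
  proof -
    have "(\<Sum>j\<in>insert b I. G i j * ((z(b := 0)) j + t * (y(b := 1)) j)) = (\<Sum>j\<in>I. G i j * z j) + t * c i"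
      unfolding eq[symmetric] by (simp add: algebra_simps)
    also have "\<dots> = l i"
    proof (cases "i = b")
      case True
      then show ?thesis using cb by (simp add: t_def)
    next
      case False
      then show ?thesis using that c0[of i] z by simp
    qed
    finally show ?thesis .
  qed
  then show ?case by (intro exI[of _ "\<lambda>j. (z(b := 0)) j + t * (y(b := 1)) j"]) blast
qed

text \<open>A zero of order at least three. The Airy tensor of B(s) C(r) contains derivatives of
  each factor up to order two, so it vanishes wherever B or C has such a zero.\<close>

definition vanish3 :: "real poly \<Rightarrow> real \<Rightarrow> bool" where
  "vanish3 p x \<longleftrightarrow> poly p x = 0 \<and> poly (pderiv p) x = 0 \<and> poly (pderiv (pderiv p)) x = 0"

lemma vanish3_cube_mult: "poly w x = 0 \<Longrightarrow> vanish3 (w ^ 3 * q) x"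
  by (simp add: vanish3_def pderiv_mult pderiv_power power3_eq_cube algebra_simps pderiv_add)

lemma vanish3_smult: "vanish3 p x \<Longrightarrow> vanish3 (smult a p) x"
  by (simp add: vanish3_def pderiv_smult)

lemma vanish3_sum: "(\<And>i. i \<in> I \<Longrightarrow> vanish3 (p i) x) \<Longrightarrow> vanish3 (\<Sum>i\<in>I. p i) x"
  by (induction I rule: infinite_finite_induct) (auto simp: vanish3_def pderiv_add)

lemma continuous_on_poly_comp [continuous_intros]: 
  fixes p :: "real poly"
  shows "continuous_on A f \<Longrightarrow> continuous_on A (\<lambda>x. poly p (f x))"
  by (rule continuous_on_compose2[of UNIV "poly p"]) (auto intro: continuous_intros continuous_at_imp_continuous_on)

lemma integrable_poly_intro [simp]: 
  fixes f :: "real \<Rightarrow> real"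
  shows "continuous_on {l..u} f \<Longrightarrow> f integrable_on {l..u}"
  by (rule integrable_continuous_real)

text \<open>The bumps are w ^ 3 times a polynomial of degree at most k, where w is positive inside
  and has simple zeros at the end points. Their moments are given by the Gram matrix of the
  monomials for the weight w ^ 3, which is positive definite, so every vector of moments up to order
  k can be attained.\<close>

lemma dual_bump_polys:
  fixes l u :: real
  assumes "l < u"
  shows "\<exists>B::nat \<Rightarrow> real poly. \<forall>i\<le>k. vanish3 (B i) l \<and> vanish3 (B i) u \<and>
      (\<forall>a\<le>k. integral {l..u} (\<lambda>s. s ^ a * poly (B i) s) = (if a = i then 1 else 0))"
proof -
  define w where "w = [:-l, 1:] * [:u, -1:]"
  define G where "G = (\<lambda>a b. integral {l..u} (\<lambda>s. s ^ a * (poly w s ^ 3 * s ^ b)))"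
  have w: "poly w s = (s - l) * (u - s)" for s
    by (simp add: w_def algebra_simps)
  have wpos: "0 < poly w s" if "l < s" "s < u" for s
    using that by (simp add: w)
  have sym: "G a b = G b a" for a b
    by (simp add: G_def mult_ac)
  have inner: "integral {l..u} (\<lambda>s. s ^ a * poly (w ^ 3 * (\<Sum>b\<le>k. monom (z b) b)) s) = (\<Sum>b\<le>k. G a b * z b)" for z a
  proof -
    have "(\<lambda>s. s ^ a * poly (w ^ 3 * (\<Sum>b\<le>k. monom (z b) b)) s) = (\<lambda>s. \<Sum>b\<le>k. s ^ a * (poly w s ^ 3 * s ^ b) * z b)"
      by (simp add: fun_eq_iff poly_sum poly_monom sum_distrib_left mult_ac)
    then have "integral {l..u} (\<lambda>s. s ^ a * poly (w ^ 3 * (\<Sum>b\<le>k. monom (z b) b)) s) = 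
       (\<Sum>b\<le>k. integral {l..u} (\<lambda>s. s ^ a * (poly w s ^ 3 * s ^ b) * z b))"
      by (simp add: integral_sum continuous_intros)
    then show ?thesis by (simp add: G_def)
  qed
  have pd: "0 < (\<Sum>a\<le>k. x a * (\<Sum>b\<le>k. G a b * x b))" if ex: "\<exists>i\<in>{..k}. x i \<noteq> 0" for x
  proof -
    define q where "q = (\<Sum>b\<le>k. monom (x b) b)"
    have qs: "poly q s = (\<Sum>b\<le>k. x b * s ^ b)" for s
      by (simp add: q_def poly_sum poly_monom)
    have "(\<Sum>a\<le>k. x a * (\<Sum>b\<le>k. G a b * x b)) = (\<Sum>a\<le>k. integral {l..u} (\<lambda>s. x a * (s ^ a * poly (w ^ 3 * q) s)))"
      unfolding inner[symmetric] q_def[symmetric] by simp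
    also have "\<dots> = integral {l..u} (\<lambda>s. poly q s * poly (w ^ 3 * q) s)"
      by (subst integral_sum[symmetric]) (auto simp: continuous_intros qs sum_distrib_right mult.assoc)
    also have "\<dots> = integral {l..u} (\<lambda>s. poly w s ^ 3 * (poly q s)\<^sup>2)"
      by (simp add: power2_eq_square mult_ac)
    finally have eq: "(\<Sum>a\<le>k. x a * (\<Sum>b\<le>k. G a b * x b)) = integral {l..u} (\<lambda>s. poly w s ^ 3 * (poly q s)\<^sup>2)" .
    have nn: "0 \<le> poly w s ^ 3 * (poly q s)\<^sup>2" if "s \<in> {l..u}" for s
      using that by (simp add: w)
    have cont: "continuous_on {l..u} (\<lambda>s. poly w s ^ 3 * (poly q s)\<^sup>2)"
      by (intro continuous_intros)
    have "0 \<le> integral {l..u} (\<lambda>s. poly w s ^ 3 * (poly q s)\<^sup>2)"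
      using nn by (intro Henstock_Kurzweil_Integration.integral_nonneg integrable_poly_intro cont) auto
    moreover have "integral {l..u} (\<lambda>s. poly w s ^ 3 * (poly q s)\<^sup>2) \<noteq> 0"
    proof
      assume 0: "integral {l..u} (\<lambda>s. poly w s ^ 3 * (poly q s)\<^sup>2) = 0"
      have z: "poly q s = 0" if s: "l < s" "s < u" for s
      proof -
        have "poly w s ^ 3 * (poly q s)\<^sup>2 = 0"
          using 0 nn cont assms s integral_eq_0_iff[OF cont assms] by auto
        then show ?thesis using wpos[OF s] by auto
      qed
      \<comment> \<open>A zero of the quadratic form forces q to vanish on the whole open interval,
        and a polynomial with infinitely many roots has zero coefficients.\<close>
      have "\<not> finite {l<..<u}" using assms by simp
      then have "\<not> finite {s. (\<Sum>b\<le>k. x b * s ^ b) = 0}"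
        by (rule contrapos_nn) (use z qs in \<open>auto elim!: rev_finite_subset\<close>)
      then show False using ex polyfun_finite_roots[of x k] by auto
    qed
    ultimately show ?thesis unfolding eq by linarith
  qed
  have "\<exists>z. \<forall>a\<in>{..k}. (\<Sum>b\<le>k. G a b * z b) = (if a = i then 1 else 0)" for i
    by (rule positive_definite_solvable) (use sym pd in auto)
  then obtain z where z: "\<And>i a. a \<le> k \<Longrightarrow> (\<Sum>b\<le>k. G a b * z i b) = (if a = i then 1 else 0)"
    by (metis atMost_iff)
  have "poly w l = 0" "poly w u = 0" by (simp_all add: w)
  then show ?thesis
    by (intro exI[of _ "\<lambda>i. w ^ 3 * (\<Sum>b\<le>k. monom (z i b) b)"]) (auto simp only: inner z intro!: vanish3_cube_mult)
qed

text \<open>Value and slope at e select the edge datum to be tested, the triple zero at e' closes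
  the support, and the vanishing moments remove the contribution of the curl-curl residual. The
  points e and e' may come in either order, since both sides of an edge are needed.\<close>

lemma edge_bump_poly:
  fixes e e' \<alpha> \<beta> :: real
  assumes "e \<noteq> e'"
  shows "\<exists>C. poly C e = \<alpha> \<and> poly (pderiv C) e = \<beta> \<and> vanish3 C e' \<and>
     (\<forall>j\<le>k. integral {min e e'..max e e'} (\<lambda>r. r ^ j * poly C r) = 0)"
proof -
  let ?I = "{min e e'..max e e'}"
  have "min e e' < max e e'" using assms by (auto simp: min_def max_def)
  from dual_bump_polys[OF this, of k] obtain B where "\<forall>i\<le>k. vanish3 (B i) (min e e') \<and> vanish3 (B i) (max e e') \<and>
      (\<forall>a\<le>k. integral ?I (\<lambda>s. s ^ a * poly (B i) s) = (if a = i then 1 else 0))" ..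
  then have B: "\<And>i. i \<le> k \<Longrightarrow> vanish3 (B i) (min e e')" "\<And>i. i \<le> k \<Longrightarrow> vanish3 (B i) (max e e')"
     "\<And>a i. i \<le> k \<Longrightarrow> a \<le> k \<Longrightarrow> integral ?I (\<lambda>s. s ^ a * poly (B i) s) = (if a = i then 1 else 0)"
    by blast+
  have B': "vanish3 (B i) e" "vanish3 (B i) e'" if "i \<le> k" for i
    using B(1,2)[OF that] by (auto simp: min_def max_def split: if_splits)
  \<comment> \<open>With w = 1 at e, the factor w ^ 3 has slope 3 / (e - e') there. So w ^ 3 times a
    linear function of value \<alpha> and slope \<gamma> has value \<alpha> and slope
    \<beta>.\<close>
  define \<gamma> where "\<gamma> = \<beta> - 3 * \<alpha> / (e - e')"
  define L where "L = [:\<alpha> - \<gamma> * e, \<gamma>:]"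
  define w where "w = [:- e' / (e - e'), 1 / (e - e'):]"
  define C0 where "C0 = w ^ 3 * L"
  have w: "poly w e = 1" "poly (pderiv w) e = 1 / (e - e')" "poly w e' = 0"
  proof -
    have "poly w x = (x - e') / (e - e')" for x
      by (simp add: w_def diff_divide_distrib)
    then show "poly w e = 1" "poly w e' = 0" using assms by auto
    show "poly (pderiv w) e = 1 / (e - e')" by (simp add: w_def pderiv_pCons)
  qed
  have L: "poly L e = \<alpha>" "poly (pderiv L) e = \<gamma>"
    by (auto simp: L_def pderiv_pCons algebra_simps)
  have C0: "poly C0 e = \<alpha>" "poly (pderiv C0) e = \<beta>" "vanish3 C0 e'"
    using w L by (auto simp: C0_def vanish3_cube_mult pderiv_mult pderiv_power \<gamma>_def)
  define m where "m = (\<lambda>j. integral ?I (\<lambda>r. r ^ j * poly C0 r))"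
  \<comment> \<open>Subtracting the moments by means of the dual bumps leaves the data at e and e'
    alone, because those bumps have triple zeros at both end points.\<close>
  define C where "C = C0 - (\<Sum>j\<le>k. smult (m j) (B j))"
  have D: "vanish3 (\<Sum>j\<le>k. smult (m j) (B j)) e" "vanish3 (\<Sum>j\<le>k. smult (m j) (B j)) e'"
    using B' by (auto intro!: vanish3_sum vanish3_smult)
  have C: "poly C e = \<alpha>" "poly (pderiv C) e = \<beta>" "vanish3 C e'"
    using C0 D by (auto simp: C_def pderiv_diff vanish3_def)
  moreover have "integral ?I (\<lambda>r. r ^ j * poly C r) = 0" if "j \<le> k" for j
  proof -
    have "integral ?I (\<lambda>r. r ^ j * poly C r) = integral ?I (\<lambda>r. r ^ j * poly C0 r - (\<Sum>i\<le>k. m i * (r ^ j * poly (B i) r)))"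
      by (simp add: C_def poly_sum right_diff_distrib sum_distrib_left mult_ac)
    also have "\<dots> = m j - (\<Sum>i\<le>k. m i * integral ?I (\<lambda>r. r ^ j * poly (B i) r))"
      by (subst Henstock_Kurzweil_Integration.integral_diff) (auto simp: m_def integral_sum continuous_intros intro!: integrable_poly_intro continuous_intros)
    also have "(\<Sum>i\<le>k. m i * integral ?I (\<lambda>r. r ^ j * poly (B i) r)) = (\<Sum>i\<le>k. if i = j then m i else 0)"
      using that by (intro sum.cong) (auto simp: B(3))
    also have "\<dots> = m j" using that by simp
    finally show ?thesis by simp
  qed
  ultimately show ?thesis by blast
qed

section \<open>Polynomials in frame coordinates\<close>

text \<open>Degree at most k in each variable instead of total degree: a product of two
  one-dimensional dual bumps then isolates exactly one coefficient, and the class is stable under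
  both partial derivatives.\<close>

definition tpoly :: "nat \<Rightarrow> (nat \<Rightarrow> nat \<Rightarrow> real) \<Rightarrow> real \<Rightarrow> real \<Rightarrow> real" where
  "tpoly k c s r = (\<Sum>i\<le>k. \<Sum>j\<le>k. c i j * s ^ i * r ^ j)"

text \<open>\<open>ds\<close> and \<open>dr\<close> are the coefficient arrays of the derivatives in
  s and r. The index range stays {..k}, so the coefficient that would come from degree k + 1 is set
  to 0.\<close>

definition ds :: "nat \<Rightarrow> (nat \<Rightarrow> nat \<Rightarrow> real) \<Rightarrow> nat \<Rightarrow> nat \<Rightarrow> real" where
  "ds k c i j = (if i < k then real (Suc i) * c (Suc i) j else 0)"

definition dr :: "nat \<Rightarrow> (nat \<Rightarrow> nat \<Rightarrow> real) \<Rightarrow> nat \<Rightarrow> nat \<Rightarrow> real" where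
  "dr k c i j = (if j < k then real (Suc j) * c i (Suc j) else 0)"

lemma tpoly_add: "tpoly k (\<lambda>i j. c i j + d i j) s r = tpoly k c s r + tpoly k d s r"
  and tpoly_diff: "tpoly k (\<lambda>i j. c i j - d i j) s r = tpoly k c s r - tpoly k d s r"
  and tpoly_cmult: "tpoly k (\<lambda>i j. x * c i j) s r = x * tpoly k c s r"
  by (simp_all add: tpoly_def sum.distrib sum_subtractf sum_distrib_left algebra_simps)

lemma ds_add: "ds k (\<lambda>i j. c i j + d i j) = (\<lambda>i j. ds k c i j + ds k d i j)"
  and ds_diff: "ds k (\<lambda>i j. c i j - d i j) = (\<lambda>i j. ds k c i j - ds k d i j)"
  and ds_cmult: "ds k (\<lambda>i j. x * c i j) = (\<lambda>i j. x * ds k c i j)"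
  and dr_add: "dr k (\<lambda>i j. c i j + d i j) = (\<lambda>i j. dr k c i j + dr k d i j)"
  and dr_diff: "dr k (\<lambda>i j. c i j - d i j) = (\<lambda>i j. dr k c i j - dr k d i j)"
  and dr_cmult: "dr k (\<lambda>i j. x * c i j) = (\<lambda>i j. x * dr k c i j)"
  and dr_ds: "dr k (ds k c) = ds k (dr k c)"
  by (auto simp: fun_eq_iff ds_def dr_def algebra_simps)

lemma tpoly_0: "tpoly k c s 0 = (\<Sum>i\<le>k. c i 0 * s ^ i)"
proof -
  have "(\<Sum>j\<le>k. c i j * s ^ i * 0 ^ j) = c i 0 * s ^ i" for i
    by (subst sum.remove[of _ 0]) (auto intro!: sum.neutral)
  then show ?thesis by (simp add: tpoly_def)
qed

lemma sum_power_derivative: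
  "(\<Sum>i\<le>k. c i * (real i * s ^ (i - 1))) = (\<Sum>i\<le>k. (if i < k then real (Suc i) * c (Suc i) else 0) * s ^ i)"
proof (cases k)
  case (Suc n)
  have "(\<Sum>i\<le>Suc n. c i * (real i * s ^ (i - 1))) = (\<Sum>i\<le>n. c (Suc i) * (real (Suc i) * s ^ i))"
    by (subst sum.atMost_Suc_shift) simp
  also have "\<dots> = (\<Sum>i\<le>Suc n. (if i < Suc n then real (Suc i) * c (Suc i) else 0) * s ^ i)"
    by (simp add: mult_ac)
  finally show ?thesis using Suc by simp
qed simp

lemma tpoly_ds: "(\<Sum>i\<le>k. \<Sum>j\<le>k. c i j * (real i * s ^ (i - 1)) * r ^ j) = tpoly k (ds k c) s r"
proof -
  have "(\<Sum>i\<le>k. \<Sum>j\<le>k. c i j * (real i * s ^ (i - 1)) * r ^ j) = (\<Sum>j\<le>k. (\<Sum>i\<le>k. c i j * (real i * s ^ (i - 1))) * r ^ j)"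
    by (subst sum.swap) (simp add: sum_distrib_right)
  also have "\<dots> = (\<Sum>j\<le>k. (\<Sum>i\<le>k. ds k c i j * s ^ i) * r ^ j)"
    unfolding sum_power_derivative ds_def ..
  also have "\<dots> = tpoly k (ds k c) s r"
    unfolding tpoly_def by (subst sum.swap) (simp add: sum_distrib_right)
  finally show ?thesis .
qed

lemma tpoly_dr: "(\<Sum>i\<le>k. \<Sum>j\<le>k. c i j * s ^ i * (real j * r ^ (j - 1))) = tpoly k (dr k c) s r"
proof -
  have "(\<Sum>i\<le>k. \<Sum>j\<le>k. c i j * s ^ i * (real j * r ^ (j - 1))) = (\<Sum>i\<le>k. s ^ i * (\<Sum>j\<le>k. c i j * (real j * r ^ (j - 1))))"
    by (simp add: sum_distrib_left mult_ac)
  also have "\<dots> = (\<Sum>i\<le>k. s ^ i * (\<Sum>j\<le>k. dr k c i j * r ^ j))"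
    unfolding sum_power_derivative dr_def ..
  also have "\<dots> = tpoly k (dr k c) s r"
    unfolding tpoly_def by (simp add: sum_distrib_left mult_ac)
  finally show ?thesis .
qed

lemma has_derivative_tpoly [derivative_intros]:
  assumes "(f has_derivative f') (at x within A)" "(g has_derivative g') (at x within A)"
  shows "((\<lambda>x. tpoly k c (f x) (g x)) has_derivative
     (\<lambda>v. tpoly k (ds k c) (f x) (g x) * f' v + tpoly k (dr k c) (f x) (g x) * g' v)) (at x within A)"
proof -
  have "((\<lambda>x. tpoly k c (f x) (g x)) has_derivative
     (\<lambda>v. \<Sum>i\<le>k. \<Sum>j\<le>k. c i j * f x ^ i * (real j * g' v * g x ^ (j - 1)) + c i j * (real i * f' v * f x ^ (i - 1)) * g x ^ j)) (at x within A)"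
    unfolding tpoly_def by (auto intro!: derivative_eq_intros assms simp: algebra_simps)
  also have "(\<lambda>v. \<Sum>i\<le>k. \<Sum>j\<le>k. c i j * f x ^ i * (real j * g' v * g x ^ (j - 1)) + c i j * (real i * f' v * f x ^ (i - 1)) * g x ^ j) =
      (\<lambda>v. tpoly k (ds k c) (f x) (g x) * f' v + tpoly k (dr k c) (f x) (g x) * g' v)"
    unfolding tpoly_ds[symmetric] tpoly_dr[symmetric] sum.distrib sum_distrib_right
    by (simp add: fun_eq_iff mult_ac add.commute)
  finally show ?thesis .
qed

lemma tpoly_has_vector_derivative_s:
  "((\<lambda>s. tpoly k c s r) has_vector_derivative tpoly k (ds k c) s r) (at s within A)"
  unfolding has_vector_derivative_def
  by (rule has_derivative_eq_rhs[OF has_derivative_tpoly[OF has_derivative_ident has_derivative_const]]) auto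

lemma tpoly_has_vector_derivative_r:
  "((\<lambda>r. tpoly k c s r) has_vector_derivative tpoly k (dr k c) s r) (at r within A)"
  unfolding has_vector_derivative_def
  by (rule has_derivative_eq_rhs[OF has_derivative_tpoly[OF has_derivative_const has_derivative_ident]]) auto

lemma continuous_on_tpoly [continuous_intros]:
  "continuous_on A f \<Longrightarrow> continuous_on A g \<Longrightarrow> continuous_on A (\<lambda>x. tpoly k c (f x) (g x))"
  unfolding tpoly_def by (intro continuous_intros)

text \<open>Passes from coefficients to the supremum on a triangle, whose frame coordinates are
  bounded by the shape regularity constant; D at least 1 dominates every power that occurs by D ^ k
  in each variable.\<close>

lemma abs_tpoly_le:
  assumes "\<And>i j. i \<le> k \<Longrightarrow> j \<le> k \<Longrightarrow> \<bar>c i j\<bar> \<le> M" and "\<bar>s\<bar> \<le> D" "\<bar>r\<bar> \<le> D" "1 \<le> D"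
  shows "\<bar>tpoly k c s r\<bar> \<le> (real (Suc k))\<^sup>2 * M * D ^ (2 * k)"
proof -
  have M: "0 \<le> M" using assms(1)[of 0 0] by simp
  have "\<bar>c i j * s ^ i * r ^ j\<bar> \<le> M * D ^ (2 * k)" if "i \<le> k" "j \<le> k" for i j
  proof -
    have "\<bar>s ^ i\<bar> \<le> D ^ k" "\<bar>r ^ j\<bar> \<le> D ^ k"
      using assms(2-4) that unfolding power_abs
      by (meson abs_ge_zero order_trans power_increasing power_mono)+
    then have "\<bar>c i j\<bar> * \<bar>s ^ i\<bar> * \<bar>r ^ j\<bar> \<le> M * D ^ k * D ^ k"
      using assms(1)[OF that] assms(4) M by (intro mult_mono) auto
    then show ?thesis by (simp add: abs_mult mult_2 power_add mult.assoc)
  qed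
  then have "\<bar>tpoly k c s r\<bar> \<le> (\<Sum>i\<le>k. \<Sum>j\<le>k. M * D ^ (2 * k))"
    unfolding tpoly_def by (intro order_trans[OF sum_abs] sum_mono) (auto intro!: order_trans[OF sum_abs] sum_mono)
  then show ?thesis by (simp add: power2_eq_square algebra_simps)
qed

lemma integral_product_poly:
  fixes f g :: "real \<Rightarrow> real"
  assumes "continuous_on {s0..s1} f" "continuous_on {l..u} g"
  shows "integral (cbox (s0, l) (s1, u)) (\<lambda>p. f (fst p) * g (snd p)) = integral {s0..s1} f * integral {l..u} g"
proof -
  have "continuous_on (cbox (s0, l) (s1, u)) (\<lambda>p. f (fst p) * g (snd p))"
    by (intro continuous_intros continuous_on_compose2[OF assms(1)] continuous_on_compose2[OF assms(2)]) auto
  from integral_prod_continuous[OF this] show ?thesis by simp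
qed

lemma integral_tpoly_product:
  "integral (cbox (s0, l) (s1, u)) (\<lambda>p. tpoly k c (fst p) (snd p) * (poly B (fst p) * poly C (snd p))) =
   (\<Sum>i\<le>k. \<Sum>j\<le>k. c i j * (integral {s0..s1} (\<lambda>s. s ^ i * poly B s) * integral {l..u} (\<lambda>r. r ^ j * poly C r)))"
proof -
  let ?I = "cbox (s0, l) (s1, u)"
  have int: "(\<lambda>p. (fst p ^ i * poly B (fst p)) * (snd p ^ j * poly C (snd p))) integrable_on ?I" for i j
    by (intro integrable_continuous continuous_intros)
  have "integral ?I (\<lambda>p. tpoly k c (fst p) (snd p) * (poly B (fst p) * poly C (snd p))) =
     integral ?I (\<lambda>p. \<Sum>i\<le>k. \<Sum>j\<le>k. c i j * ((fst p ^ i * poly B (fst p)) * (snd p ^ j * poly C (snd p))))"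
    by (simp add: tpoly_def sum_distrib_right) (simp add: mult_ac)
  also have "\<dots> = (\<Sum>i\<le>k. \<Sum>j\<le>k. c i j * integral ?I (\<lambda>p. (fst p ^ i * poly B (fst p)) * (snd p ^ j * poly C (snd p))))"
    using int by (simp add: integral_sum integrable_sum integrable_on_mult_right)
  also have "\<dots> = (\<Sum>i\<le>k. \<Sum>j\<le>k. c i j * (integral {s0..s1} (\<lambda>s. s ^ i * poly B s) * integral {l..u} (\<lambda>r. r ^ j * poly C r)))"
    by (intro sum.cong refl arg_cong2[of _ _ _ _ "(*)"] integral_product_poly continuous_intros)
  finally show ?thesis .
qed

lemma tpoly_monomial:
  assumes "i \<le> k" "j \<le> k"
  shows "tpoly k (\<lambda>a b. if a = i \<and> b = j then 1 else 0) s r = s ^ i * r ^ j"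
proof -
  have "tpoly k (\<lambda>a b. if a = i \<and> b = j then 1 else 0) s r = (\<Sum>a\<le>k. if a = i then (\<Sum>b\<le>k. if b = j then s ^ i * r ^ j else 0) else 0)"
    unfolding tpoly_def by (intro sum.cong refl) (simp add: if_distrib[of "\<lambda>x. x * _"] cong: if_cong sum.cong)
  then show ?thesis using assms by simp
qed

section \<open>Smooth bump functions\<close>

text \<open>With w = (t - a) (b - t) this is q / w ^ n times exp (- c / w), extended by zero. The
  numerator and the exponent make the family closed under differentiation. The parameter c is used
  twice below: letting it tend to 0 with q = 1, n = 0 gives the indicator of the open interval, and
  tying it to the length of the interval fixes the value at the midpoint.\<close>

definition bump :: "real \<Rightarrow> real \<Rightarrow> real \<Rightarrow> real poly \<Rightarrow> nat \<Rightarrow> real \<Rightarrow> real" where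
  "bump a b c q n t = (if a < t \<and> t < b
     then poly q t / ((t - a) * (b - t)) ^ n * exp (- c / ((t - a) * (b - t))) else 0)"

text \<open>Numerator of the derivative over the common denominator w ^ (n + 2): the exponential
  contributes c w' / w ^ 2, the quotient rule the other two terms.\<close>

definition bump_deriv_poly :: "real \<Rightarrow> real \<Rightarrow> real \<Rightarrow> real poly \<Rightarrow> nat \<Rightarrow> real poly" where
  "bump_deriv_poly a b c q n = (let w = [:-a, 1:] * [:b, -1:] in
     pderiv q * w ^ 2 - of_nat n * q * pderiv w * w + [:c:] * q * pderiv w)"

text \<open>The exponential beats every power of w, from (x / m) ^ m \<le> exp x at x = c / w. A
  quadratic bound is what makes the derivative vanish at the end points.\<close>

lemma bump_quadratic_bound:
  assumes "a < b" "0 < c"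
  shows "\<exists>M. \<forall>t. \<bar>bump a b c q n t\<bar> \<le> M * ((t - a) * (b - t))\<^sup>2"
proof -
  have "bounded (poly q ` {a..b})"
    by (intro compact_imp_bounded compact_continuous_image continuous_intros) auto
  then obtain Q where "\<forall>x\<in>poly q ` {a..b}. norm x \<le> Q"
    unfolding bounded_iff by blast
  then have Q: "\<And>t. t \<in> {a..b} \<Longrightarrow> \<bar>poly q t\<bar> \<le> Q"
    by auto
  \<comment> \<open>Of these powers of w, n cancel the denominator and two remain.\<close>
  let ?m = "n + 2"
  define M where "M = Q * (real ?m / c) ^ ?m"
  have "\<bar>bump a b c q n t\<bar> \<le> M * ((t - a) * (b - t))\<^sup>2" for t
  proof (cases "a < t \<and> t < b")
    case True
    define w where "w = (t - a) * (b - t)"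
    have w: "0 < w" using True by (simp add: w_def)
    have Q0: "0 \<le> Q" using Q[of a] assms by (auto intro: order_trans[OF abs_ge_zero])
    have "((c / w) / real ?m) ^ ?m \<le> (1 + (c / w) / real ?m) ^ ?m"
      using assms w by (intro power_mono) auto
    also have "\<dots> \<le> exp (c / w)"
      using assms w order_trans[of "- real ?m" 0 "c / w"] by (intro exp_ge_one_plus_x_over_n_power_n) auto
    finally have X: "((c / w) / real ?m) ^ ?m \<le> exp (c / w)" .
    have "0 < ((c / w) / real ?m) ^ ?m"
      using assms w by (intro zero_less_power divide_pos_pos) auto
    then have "inverse (exp (c / w)) \<le> inverse (((c / w) / real ?m) ^ ?m)"
      using X by (intro le_imp_inverse_le) auto
    then have "exp (- c / w) \<le> 1 / ((c / w) / real ?m) ^ ?m"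
      by (simp add: exp_minus inverse_eq_divide)
    also have "\<dots> = (1 / ((c / w) / real ?m)) ^ ?m"
      by (simp only: power_one_over)
    also have "1 / ((c / w) / real ?m) = real ?m / c * w"
      by simp
    also have "(real ?m / c * w) ^ ?m = (real ?m / c) ^ ?m * w ^ ?m"
      by (simp only: power_mult_distrib)
    finally have e: "exp (- c / w) \<le> (real ?m / c) ^ ?m * w ^ ?m" .
    have "\<bar>bump a b c q n t\<bar> = \<bar>poly q t\<bar> * (exp (- c / w) / w ^ n)"
      using True w by (simp add: bump_def w_def[symmetric] abs_mult)
    also have "\<dots> \<le> Q * (((real ?m / c) ^ ?m * w ^ ?m) / w ^ n)"
      using Q[of t] True e w Q0 by (intro mult_mono divide_right_mono) auto
    also have "\<dots> = M * w\<^sup>2"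
      using w by (simp add: M_def power_add power2_eq_square)
    finally show ?thesis by (simp add: w_def)
  next
    case False
    have "0 \<le> Q" using Q[of a] assms by (auto intro: order_trans[OF abs_ge_zero])
    then show ?thesis using False assms by (auto simp: bump_def M_def)
  qed
  then show ?thesis by blast
qed

lemma bump_derivative_identity:
  fixes w :: real
  assumes "w \<noteq> 0"
  shows "(p' * w ^ n - p * (real n * w ^ (n - 1) * d)) / (w ^ n * w ^ n) * E + p / w ^ n * (E * (c * d / (w * w))) =
     (p' * w\<^sup>2 - real n * p * d * w + c * p * d) / w ^ (n + 2) * E"
proof (cases n)
  case 0
  then show ?thesis using assms by (simp add: field_simps power2_eq_square)
next
  case (Suc m)
  have "w ^ n = w * w ^ m" "w ^ (n - 1) = w ^ m" "w ^ (n + 2) = w * w * w * w ^ m" "w ^ m \<noteq> 0"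
    using Suc assms by simp_all
  then show ?thesis
    using assms by (simp only: power2_eq_square) (simp add: field_simps)
qed

text \<open>In the open interval this is the quotient rule. Elsewhere the bump vanishes at t and is
  bounded by a multiple of (y - t) ^ 2 near t, so the difference quotient tends to 0; this treats
  end points and exterior points together.\<close>

lemma bump_has_derivative:
  assumes "a < b" "0 < c"
  shows "(bump a b c q n has_real_derivative bump a b c (bump_deriv_poly a b c q n) (n + 2) t) (at t)"
proof (cases "a < t \<and> t < b")
  case True
  let ?w = "\<lambda>t. (t - a) * (b - t)"
  have w: "0 < ?w t" using True by simp
  have D: "((\<lambda>t. poly q t / ?w t ^ n * exp (- c / ?w t)) has_real_derivative
     bump a b c (bump_deriv_poly a b c q n) (n + 2) t) (at t)"
  proof -
    define w where "w = ?w t"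
    have w0: "w \<noteq> 0" using True by (auto simp: w_def)
    have gen: "((\<lambda>t. poly q t / W t ^ n * exp (- c / W t)) has_real_derivative
       (poly (pderiv q) t * W t ^ n - poly q t * (real n * W t ^ (n - 1) * d)) / (W t ^ n * W t ^ n) * exp (- c / W t) +
       poly q t / W t ^ n * (exp (- c / W t) * (c * d / (W t * W t)))) (at t)"
      if W: "(W has_real_derivative d) (at t)" "W t \<noteq> 0" for W d
    proof -
      have 1: "((\<lambda>t. poly q t / W t ^ n) has_real_derivative
         (poly (pderiv q) t * W t ^ n - poly q t * (real n * W t ^ (n - 1) * d)) / (W t ^ n * W t ^ n)) (at t)"
        by (rule DERIV_divide[OF poly_DERIV DERIV_cong[OF DERIV_power[OF W(1)]]]) (use W in \<open>auto simp: mult_ac\<close>)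
      have 2: "((\<lambda>t. exp (- c / W t)) has_real_derivative exp (- c / W t) * (c * d / (W t * W t))) (at t)"
        by (rule DERIV_fun_exp[OF DERIV_cong[OF DERIV_divide[OF DERIV_const W]]]) simp
      show ?thesis by (rule DERIV_cong[OF DERIV_mult[OF 1 2]]) (simp add: mult_ac)
    qed
    have "((\<lambda>t. poly q t / ?w t ^ n * exp (- c / ?w t)) has_real_derivative
       (poly (pderiv q) t * w ^ n - poly q t * (real n * w ^ (n - 1) * (b - t - (t - a)))) / (w ^ n * w ^ n) * exp (- c / w) +
       poly q t / w ^ n * (exp (- c / w) * (c * (b - t - (t - a)) / (w * w)))) (at t)"
      unfolding w_def using w by (intro gen) (auto intro!: derivative_eq_intros)
    also have "(poly (pderiv q) t * w ^ n - poly q t * (real n * w ^ (n - 1) * (b - t - (t - a)))) / (w ^ n * w ^ n) * exp (- c / w) +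
       poly q t / w ^ n * (exp (- c / w) * (c * (b - t - (t - a)) / (w * w))) = 
       (poly (pderiv q) t * w\<^sup>2 - real n * poly q t * (b - t - (t - a)) * w + c * poly q t * (b - t - (t - a))) / w ^ (n + 2) * exp (- c / w)"
      by (rule bump_derivative_identity[OF w0])
    also have "poly (pderiv q) t * w\<^sup>2 - real n * poly q t * (b - t - (t - a)) * w + c * poly q t * (b - t - (t - a)) = 
        poly (bump_deriv_poly a b c q n) t"
    proof -
      have "poly ([:-a, 1:] * [:b, -1:]) t = w" "poly (pderiv ([:-a, 1:] * [:b, -1:])) t = b - t - (t - a)"
        by (auto simp: w_def pderiv_mult pderiv_pCons algebra_simps)
      then show ?thesis
        by (simp only: bump_deriv_poly_def Let_def poly_add poly_diff poly_mult poly_power of_nat_poly) simp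
    qed
    finally show ?thesis using True by (simp add: bump_def w_def)
  qed
  have "eventually (\<lambda>t. t \<in> {a<..<b}) (nhds t)"
    using True by (intro eventually_nhds_in_open) auto
  then have ev: "eventually (\<lambda>t. bump a b c q n t = poly q t / ?w t ^ n * exp (- c / ?w t)) (nhds t)"
    by eventually_elim (simp add: bump_def)
  show ?thesis using D DERIV_cong_ev[OF refl ev refl] by simp
next
  case False
  obtain M where M: "\<And>t. \<bar>bump a b c q n t\<bar> \<le> M * ((t - a) * (b - t))\<^sup>2"
    using bump_quadratic_bound[OF assms, of q n] by blast
  have M0: "0 \<le> M"
    using order_trans[OF abs_ge_zero M[of "(a+b)/2"]] assms by (simp add: zero_le_mult_iff)
  \<comment> \<open>Since t is not in the open interval, one of the factors y - a and b - y is at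
    most the distance from y to t, and the other is at most b - a.\<close>
  have B: "\<bar>bump a b c q n y\<bar> \<le> M * (b - a)\<^sup>2 * \<bar>y - t\<bar>\<^sup>2" for y
  proof (cases "a < y \<and> y < b")
    case True
    have "\<bar>y - a\<bar> * \<bar>b - y\<bar> \<le> (b - a) * \<bar>y - t\<bar>"
    proof (cases "t \<le> a")
      case True
      then show ?thesis using \<open>a < y \<and> y < b\<close> by (subst mult.commute, intro mult_mono) auto
    next
      case False
      then show ?thesis using \<open>a < y \<and> y < b\<close> \<open>\<not> (a < t \<and> t < b)\<close> by (intro mult_mono) auto
    qed
    then have "(\<bar>y - a\<bar> * \<bar>b - y\<bar>)\<^sup>2 \<le> ((b - a) * \<bar>y - t\<bar>)\<^sup>2"
      by (intro power_mono) auto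
    then have "M * ((y - a) * (b - y))\<^sup>2 \<le> M * ((b - a) * \<bar>y - t\<bar>)\<^sup>2"
      using M0 by (intro mult_left_mono) (auto simp: power_mult_distrib)
    then show ?thesis using M[of y] by (simp add: power_mult_distrib mult.assoc)
  next
    case False
    then show ?thesis using M0 by (auto simp: bump_def)
  qed
  have "((\<lambda>y. norm (bump a b c q n y - bump a b c q n t - 0) / norm (y - t)) \<longlongrightarrow> 0) (at t)"
  proof (rule tendsto_sandwich[of "\<lambda>_. 0" _ _ "\<lambda>y. M * (b - a)\<^sup>2 * \<bar>y - t\<bar>"])
    have "norm (bump a b c q n y - bump a b c q n t - 0) / norm (y - t) \<le> M * (b - a)\<^sup>2 * \<bar>y - t\<bar>" if "y \<noteq> t" for y
    proof -
      have "bump a b c q n t = 0" using False by (auto simp: bump_def)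
      then show ?thesis using B[of y] that by (simp add: divide_le_eq power2_eq_square mult.assoc del: power2_abs)
    qed
    then show "\<forall>\<^sub>F y in at t. norm (bump a b c q n y - bump a b c q n t - 0) / norm (y - t) \<le> M * (b - a)\<^sup>2 * \<bar>y - t\<bar>"
      by (auto simp: eventually_at_filter)
    show "((\<lambda>y. M * (b - a)\<^sup>2 * \<bar>y - t\<bar>) \<longlongrightarrow> 0) (at t)"
      by (auto intro!: tendsto_eq_intros)
  qed auto
  moreover have "bump a b c (bump_deriv_poly a b c q n) (n + 2) t = 0"
    using False by (auto simp: bump_def)
  ultimately show ?thesis
    unfolding has_field_derivative_def has_derivative_iff_norm by (auto intro: bounded_linear_mult_right)
qed

lemma continuous_on_bump: "a < b \<Longrightarrow> 0 < c \<Longrightarrow> continuous_on A (bump a b c q n)"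
  by (meson DERIV_isCont bump_has_derivative continuous_at_imp_continuous_on)

lemma bump_comp_has_derivative:
  assumes "a < b" "0 < c" and f: "(f has_derivative f') (at x)"
  shows "((\<lambda>x. bump a b c q n (f x)) has_derivative (\<lambda>v. f' v * bump a b c (bump_deriv_poly a b c q n) (n + 2) (f x))) (at x)"
  using DERIV_compose_FDERIV[OF bump_has_derivative[OF assms(1,2)] f] .

context
  fixes f g :: "real^2 \<Rightarrow> real" and f' g' and a b c a' b' c' :: real
  assumes f: "\<And>x. (f has_derivative f') (at x)" and g: "\<And>x. (g has_derivative g') (at x)"
    and ab: "a < b" "0 < c" "a' < b'" "0 < c'"
begin

text \<open>The derivatives f' and g' do not depend on the point, so f and g are affine. Hence a
  directional derivative of a product of bumps is a combination of such products with constant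
  coefficients, and the span is stable under all iterated partial derivatives, as
  \<open>smooth\<close> demands.\<close>

inductive bump_span :: "(real^2 \<Rightarrow> real) \<Rightarrow> bool" where
  base: "bump_span (\<lambda>x. bump a b c q n (f x) * bump a' b' c' q' n' (g x))"
| add: "bump_span \<phi> \<Longrightarrow> bump_span \<psi> \<Longrightarrow> bump_span (\<lambda>x. \<phi> x + \<psi> x)"
| scale: "bump_span \<phi> \<Longrightarrow> bump_span (\<lambda>x. y * \<phi> x)"

lemma bump_product_has_derivative:
  "((\<lambda>x. bump a b c q n (f x) * bump a' b' c' q' n' (g x)) has_derivative
     (\<lambda>v. f' v * (bump a b c (bump_deriv_poly a b c q n) (n + 2) (f x) * bump a' b' c' q' n' (g x)) +
       g' v * (bump a b c q n (f x) * bump a' b' c' (bump_deriv_poly a' b' c' q' n') (n' + 2) (g x)))) (at x)"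
  by (rule has_derivative_eq_rhs[OF has_derivative_mult[OF bump_comp_has_derivative[OF ab(1,2) f] bump_comp_has_derivative[OF ab(3,4) g]]])
     (simp add: fun_eq_iff algebra_simps)

lemma bump_span_derivative:
  assumes "bump_span \<phi>"
  shows "\<exists>\<phi>'. (\<forall>x. (\<phi> has_derivative \<phi>' x) (at x)) \<and> (\<forall>v. bump_span (\<lambda>x. \<phi>' x v))"
  using assms
proof induction
  case (base q n q' n')
  show ?case
    by (intro exI conjI allI, rule bump_product_has_derivative) (intro bump_span.intros)
next
  case (add \<phi> \<psi>)
  then obtain \<phi>' \<psi>' where "\<forall>x. (\<phi> has_derivative \<phi>' x) (at x)" "\<forall>v. bump_span (\<lambda>x. \<phi>' x v)"
    "\<forall>x. (\<psi> has_derivative \<psi>' x) (at x)" "\<forall>v. bump_span (\<lambda>x. \<psi>' x v)" by blast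
  then show ?case
    by (intro exI[of _ "\<lambda>x v. \<phi>' x v + \<psi>' x v"]) (auto intro!: has_derivative_add bump_span.intros)
next
  case (scale \<phi> y)
  then obtain \<phi>' where "\<forall>x. (\<phi> has_derivative \<phi>' x) (at x)" "\<forall>v. bump_span (\<lambda>x. \<phi>' x v)" by blast
  then show ?case
    by (intro exI[of _ "\<lambda>x v. y * \<phi>' x v"]) (auto intro!: has_derivative_mult_right bump_span.intros)
qed

lemma smooth_bump_product: "smooth (\<lambda>x. bump a b c q n (f x) * bump a' b' c' q' n' (g x))"
proof -
  have "bump_span (foldr pd is \<phi>)" if "bump_span \<phi>" for "is" \<phi>
  proof (induction "is")
    case (Cons i "is")
    obtain \<phi>' where d: "\<And>x. (foldr pd is \<phi> has_derivative \<phi>' x) (at x)" and s: "\<And>v. bump_span (\<lambda>x. \<phi>' x v)"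
      using bump_span_derivative[OF Cons.IH] by blast
    have "pd i (foldr pd is \<phi>) = (\<lambda>x. \<phi>' x (axis i 1))"
      by (simp add: pd_def fun_eq_iff frechet_derivative_at[OF d, symmetric])
    then show ?case using s by simp
  qed (simp add: that)
  then show ?thesis
    unfolding smooth_def using bump_span_derivative base differentiable_def by blast
qed

end

lemma bump_0: "a < t \<Longrightarrow> t < b \<Longrightarrow> bump a b c 1 0 t = exp (- c / ((t - a) * (b - t)))"
  by (simp add: bump_def)

lemma bump_bounds: "a < b \<Longrightarrow> 0 < c \<Longrightarrow> 0 \<le> bump a b c 1 0 t \<and> bump a b c 1 0 t \<le> 1"
  by (auto simp: bump_def)

section \<open>Products of bumps in frame coordinates as test functions\<close>

context frame
begin

lemma has_derivative_S: "(S has_derivative (\<lambda>v. (v \<bullet> tau) / h)) (at x)"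
  and has_derivative_R: "(R has_derivative (\<lambda>v. (v \<bullet> \<nu>) / h)) (at x)"
  unfolding cs_def [abs_def] cr_def [abs_def] using h_pos by (auto intro!: derivative_eq_intros)

lemma bump_test_function:
  assumes "a1 < b1" "0 < c1" "a2 < b2" "0 < c2" and sub: "rect a1 b1 a2 b2 \<subseteq> \<Omega>"
  shows "(\<lambda>x. bump a1 b1 c1 1 0 (S x) * bump a2 b2 c2 1 0 (R x)) \<in> test_functions \<Omega>" (is "?\<phi> \<in> _")
proof -
  have "{x. ?\<phi> x \<noteq> 0} \<subseteq> rect a1 b1 a2 b2"
    by (auto simp: bump_def rect_def split: if_splits)
  then have "closure {x. ?\<phi> x \<noteq> 0} \<subseteq> rect a1 b1 a2 b2"
    by (intro closure_minimal compact_imp_closed compact_rect)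
  moreover from this have "compact (closure {x. ?\<phi> x \<noteq> 0})"
    using compact_Int_closed[OF compact_rect[of a1 b1 a2 b2] closed_closure[of "{x. ?\<phi> x \<noteq> 0}"]]
    by (simp add: inf_absorb2)
  ultimately show ?thesis
    using smooth_bump_product[OF has_derivative_S has_derivative_R assms(1-4)] sub
    by (auto simp: test_functions_def)
qed

end

section \<open>The fundamental lemma of the calculus of variations\<close>

lemma borel_measurable_lebesgue_continuous:
  fixes \<phi> :: "'a::euclidean_space \<Rightarrow> 'b::euclidean_space"
  shows "continuous_on UNIV \<phi> \<Longrightarrow> \<phi> \<in> borel_measurable lebesgue"
  by (intro measurable_completion) (simp add: borel_measurable_continuous_onI)

lemma integrable_lebesgue_on_iff:
  fixes f :: "'a::euclidean_space \<Rightarrow> 'b::euclidean_space"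
  assumes "\<Omega> \<in> sets lebesgue"
  shows "integrable (lebesgue_on \<Omega>) f \<longleftrightarrow> integrable lebesgue (\<lambda>x. indicator \<Omega> x *\<^sub>R f x)"
  using assms by (intro integrable_restrict_space) auto

lemma integral_lebesgue_on_eq:
  fixes f :: "'a::euclidean_space \<Rightarrow> 'b::euclidean_space"
  assumes "\<Omega> \<in> sets lebesgue"
  shows "(LINT x|lebesgue_on \<Omega>. f x) = (LINT x|lebesgue. indicator \<Omega> x *\<^sub>R f x)"
  using assms by (intro integral_restrict_space) auto

lemma smooth_continuous_pd:
  assumes "smooth \<phi>"
  shows "continuous_on UNIV \<phi>" "continuous_on UNIV (pd j \<phi>)" "\<phi> differentiable (at x)"
proof -
  have "foldr pd is \<phi> differentiable (at x)" for "is" x using assms by (simp add: smooth_def)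
  from this[of "[]"] this[of "[j]"] 
  show "continuous_on UNIV \<phi>" "continuous_on UNIV (pd j \<phi>)" "\<phi> differentiable (at x)"
    by (auto simp: continuous_at_imp_continuous_on differentiable_imp_continuous_within)
qed

lemma bounded_continuous_compact_support:
  fixes \<phi> :: "real^2 \<Rightarrow> real"
  assumes "continuous_on UNIV \<phi>" "compact C" "\<And>x. x \<notin> C \<Longrightarrow> \<phi> x = 0"
  shows "\<exists>M. \<forall>x. \<bar>\<phi> x\<bar> \<le> M"
proof -
  have "bounded (\<phi> ` C)"
    by (intro compact_imp_bounded compact_continuous_image continuous_on_subset[OF assms(1)] assms) auto
  then obtain M where "\<forall>x\<in>C. \<bar>\<phi> x\<bar> \<le> M" unfolding bounded_iff by auto
  then have "\<bar>\<phi> x\<bar> \<le> max M 0" for x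
    using assms(3)[of x] by (cases "x \<in> C") auto
  then show ?thesis by blast
qed

lemma test_function_bounds:
  assumes "\<phi> \<in> test_functions \<Omega>"
  shows "\<exists>M. \<forall>x. \<bar>\<phi> x\<bar> \<le> M" "\<exists>M. \<forall>x. \<bar>pd j \<phi> x\<bar> \<le> M"
proof -
  let ?C = "closure {x. \<phi> x \<noteq> 0}"
  have \<phi>: "smooth \<phi>" "compact ?C" using assms by (auto simp: test_functions_def)
  have z: "\<phi> x = 0" if "x \<notin> ?C" for x using that closure_subset[of "{x. \<phi> x \<noteq> 0}"] by auto
  show "\<exists>M. \<forall>x. \<bar>\<phi> x\<bar> \<le> M"
    by (rule bounded_continuous_compact_support[OF smooth_continuous_pd(1)[OF \<phi>(1)] \<phi>(2) z])
  have z': "pd j \<phi> x = 0" if "x \<notin> ?C" for x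
  proof -
    have "(\<phi> has_derivative (\<lambda>_. 0)) (at x)"
    proof (rule has_derivative_transform_within_open[OF has_derivative_const open_Compl[OF closed_closure]])
      show "x \<in> - ?C" using that by simp
      show "0 = \<phi> y" if "y \<in> - ?C" for y using z[of y] that by simp
    qed
    then have "frechet_derivative \<phi> (at x) = (\<lambda>_. 0)"
      by (rule frechet_derivative_at[symmetric])
    then show ?thesis by (simp add: pd_def)
  qed
  show "\<exists>M. \<forall>x. \<bar>pd j \<phi> x\<bar> \<le> M"
    by (rule bounded_continuous_compact_support[OF smooth_continuous_pd(2)[OF \<phi>(1)] \<phi>(2) z'])
qed

lemma integrable_bounded_continuous_scaleR:
  fixes f :: "real^2 \<Rightarrow> 'b::euclidean_space"
  assumes "\<Omega> \<in> sets lebesgue" "integrable (lebesgue_on \<Omega>) f" "continuous_on UNIV \<phi>" "\<exists>M. \<forall>x. \<bar>\<phi> x\<bar> \<le> M"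
  shows "integrable (lebesgue_on \<Omega>) (\<lambda>x. \<phi> x *\<^sub>R f x)"
proof -
  obtain M where M: "\<And>x. \<bar>\<phi> x\<bar> \<le> M" using assms(4) by blast
  have "\<phi> \<in> borel_measurable (lebesgue_on \<Omega>)"
    using borel_measurable_lebesgue_continuous[OF assms(3)] by (rule measurable_restrict_space1)
  then have meas: "(\<lambda>x. \<phi> x *\<^sub>R f x) \<in> borel_measurable (lebesgue_on \<Omega>)"
    by (intro borel_measurable_scaleR borel_measurable_integrable[OF assms(2)])
  have "norm (\<phi> x *\<^sub>R f x) \<le> norm (M *\<^sub>R f x)" for x
    using mult_right_mono[OF order_trans[OF M abs_ge_self] norm_ge_zero] by simp
  then show ?thesis
    by (intro Bochner_Integration.integrable_bound[OF integrable_scaleR_right[OF assms(2)] meas, of M] AE_I2)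
qed

lemma bump_tendsto_1:
  assumes "a < t" "t < b"
  shows "(\<lambda>n. bump a b (1 / real (Suc n)) 1 0 t) \<longlonglongrightarrow> 1"
proof -
  have "(\<lambda>n. 1 / real (Suc n)) \<longlonglongrightarrow> 0"
    using LIMSEQ_inverse_real_of_nat by (simp add: inverse_eq_divide)
  then have "(\<lambda>n. exp (- (1 / real (Suc n)) / ((t - a) * (b - t)))) \<longlonglongrightarrow> exp (- 0 / ((t - a) * (b - t)))"
    using assms by (intro tendsto_intros) auto
  then show ?thesis using assms by (simp add: bump_0)
qed

text \<open>For c tending to 0 the product bumps converge boundedly to the indicator of an open
  square, so by dominated convergence g integrates to zero over all small squares in \<Omega>.
  Lebesgue's differentiation theorem recovers g almost everywhere. The lemma is needed because
  \<open>wdiv\<close> is an arbitrary representative picked by \<open>SOME\<close>.\<close>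

lemma AE_zero_of_test_functions:
  fixes g :: "real^2 \<Rightarrow> 'b::euclidean_space"
  assumes "open \<Omega>" and int: "integrable (lebesgue_on \<Omega>) g"
    and zero: "\<And>\<phi>. \<phi> \<in> test_functions \<Omega> \<Longrightarrow> (LINT x|lebesgue_on \<Omega>. \<phi> x *\<^sub>R g x) = 0"
  shows "AE x in lebesgue_on \<Omega>. g x = 0"
proof -
  have meas: "\<Omega> \<in> sets lebesgue" using assms(1) by auto
  define f where "f = (\<lambda>x. indicator \<Omega> x *\<^sub>R g x)"
  have f: "integrable lebesgue f"
    using int meas by (simp add: f_def integrable_lebesgue_on_iff)
  have fi: "f absolutely_integrable_on UNIV"
    using f by (simp add: set_integrable_def)
  have cube: "integral (cbox x (x + \<eta> *\<^sub>R One)) f = 0" if sub: "cbox x (x + \<eta> *\<^sub>R One) \<subseteq> \<Omega>" and \<eta>: "0 < \<eta>" for x :: "real^2" and \<eta>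
  proof -
    interpret frame x "axis 2 1" 1
      by unfold_locales auto
    \<comment> \<open>For the normal e_2 the tangent is - e_1, so the square to the right of x is
      the rectangle [- \<eta>, 0] x [0, \<eta>] in frame coordinates.\<close>
    have S: "S y = - (y $ 1 - x $ 1)" and R: "R y = y $ 2 - x $ 2" for y
      by (simp_all add: cs_def cr_def inner_vec2 axis_def)
    have One: "(One::real^2) $ 1 = 1" "(One::real^2) $ 2 = 1"
      by (simp_all add: Basis_vec2 axis_eq_axis) (simp_all add: axis_def)
    have x\<eta>: "(x + \<eta> *\<^sub>R One) $ 1 = x $ 1 + \<eta>" "(x + \<eta> *\<^sub>R One) $ 2 = x $ 2 + \<eta>"
      by (simp_all only: vector_add_component vector_scaleR_component One) simp_all
    have rect: "rect (- \<eta>) 0 0 \<eta> = cbox x (x + \<eta> *\<^sub>R One)"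
      unfolding set_eq_iff mem_box_cart forall_2 x\<eta> by (auto simp: rect_def S R)
    have box: "y \<in> box x (x + \<eta> *\<^sub>R One) \<longleftrightarrow> - \<eta> < S y \<and> S y < 0 \<and> 0 < R y \<and> R y < \<eta>" for y
      unfolding mem_box_cart forall_2 x\<eta> by (auto simp: S R)
    define \<phi> where "\<phi> = (\<lambda>n y. bump (- \<eta>) 0 (1 / real (Suc n)) 1 0 (S y) * bump 0 \<eta> (1 / real (Suc n)) 1 0 (R y))"
    have test: "\<phi> n \<in> test_functions \<Omega>" for n
      unfolding \<phi>_def by (rule bump_test_function) (use \<eta> sub rect in auto)
    have lim: "(\<lambda>n. \<phi> n y) \<longlonglongrightarrow> indicator (box x (x + \<eta> *\<^sub>R One)) y" for y
    proof (cases "y \<in> box x (x + \<eta> *\<^sub>R One)")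
      case True
      then have "(\<lambda>n. \<phi> n y) \<longlonglongrightarrow> 1 * 1"
        unfolding \<phi>_def box by (intro tendsto_mult bump_tendsto_1) auto
      then show ?thesis using True by simp
    next
      case False
      then have "\<phi> n y = 0" for n by (auto simp: \<phi>_def box bump_def)
      then show ?thesis using False by simp
    qed
    have bd: "\<bar>\<phi> n y\<bar> \<le> 1" for n y
    proof -
      have "0 \<le> bump (- \<eta>) 0 (1 / real (Suc n)) 1 0 (S y) \<and> bump (- \<eta>) 0 (1 / real (Suc n)) 1 0 (S y) \<le> 1"
        "0 \<le> bump 0 \<eta> (1 / real (Suc n)) 1 0 (R y) \<and> bump 0 \<eta> (1 / real (Suc n)) 1 0 (R y) \<le> 1"
        using \<eta> by (auto intro!: bump_bounds simp del: of_nat_Suc)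
      then show ?thesis unfolding \<phi>_def by (auto simp: abs_mult intro!: mult_le_one)
    qed
    have cont: "continuous_on UNIV (\<phi> n)" for n
      using test smooth_continuous_pd(1) by (auto simp: test_functions_def)
    have "(\<lambda>n. LINT y|lebesgue. \<phi> n y *\<^sub>R f y) \<longlonglongrightarrow> (LINT y|lebesgue. indicator (box x (x + \<eta> *\<^sub>R One)) y *\<^sub>R f y)"
    proof (rule integral_dominated_convergence[where w = "\<lambda>y. norm (f y)"])
      show "(\<lambda>y. \<phi> n y *\<^sub>R f y) \<in> borel_measurable lebesgue" for n
        using f borel_measurable_lebesgue_continuous[OF cont] by (intro borel_measurable_scaleR) auto
      show "AE y in lebesgue. norm (\<phi> n y *\<^sub>R f y) \<le> norm (f y)" for n
        using bd by (auto intro!: AE_I2 mult_left_le_one_le)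
      show "AE y in lebesgue. (\<lambda>n. \<phi> n y *\<^sub>R f y) \<longlonglongrightarrow> indicator (box x (x + \<eta> *\<^sub>R One)) y *\<^sub>R f y"
        using lim by (auto intro!: AE_I2 tendsto_scaleR)
      show "(\<lambda>y. indicat_real (box x (x + \<eta> *\<^sub>R One)) y *\<^sub>R f y) \<in> borel_measurable lebesgue"
        using f by (intro borel_measurable_scaleR borel_measurable_indicator) auto
    qed (use f in auto)
    moreover have "(LINT y|lebesgue. \<phi> n y *\<^sub>R f y) = 0" for n
      using zero[OF test[of n]] meas by (simp add: integral_lebesgue_on_eq f_def mult.commute)
    ultimately have "(LINT y:box x (x + \<eta> *\<^sub>R One)|lebesgue. f y) = 0"
      by (simp add: LIMSEQ_const_iff set_lebesgue_integral_def)
    moreover have "set_integrable lebesgue (box x (x + \<eta> *\<^sub>R One)) f"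
      by (rule set_integrable_subset[OF fi]) auto
    ultimately show ?thesis
      using set_lebesgue_integral_eq_integral(2) integral_open_interval by metis
  qed
  have "f integrable_on cbox a b" for a b
    using fi integrable_on_subcbox[of f UNIV a b] by (auto simp: absolutely_integrable_on_def)
  then obtain N where N: "negligible N" and 
    conv: "\<And>x e. \<lbrakk>x \<notin> N; 0 < e\<rbrakk> \<Longrightarrow> \<exists>d>0. \<forall>h. 0 < h \<and> h < d \<longrightarrow>
       norm (integral (cbox x (x + h *\<^sub>R One)) f /\<^sub>R h ^ DIM(real^2) - f x) < e"
    using integrable_ccontinuous_explicit[of f] by blast
  have gz: "g x = 0" if x: "x \<in> \<Omega>" "x \<notin> N" for x
  proof -
    obtain e where e: "0 < e" "ball x e \<subseteq> \<Omega>" using x(1) assms(1) openE by blast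
    have sub: "cbox x (x + \<eta> *\<^sub>R One) \<subseteq> \<Omega>" if "0 < \<eta>" "\<eta> < e / 4" for \<eta>
    proof
      fix y assume y: "y \<in> cbox x (x + \<eta> *\<^sub>R One)"
      have One: "(One::real^2) $ 1 = 1" "(One::real^2) $ 2 = 1"
        by (simp_all add: Basis_vec2 axis_eq_axis) (simp_all add: axis_def)
      have x\<eta>: "(x + \<eta> *\<^sub>R One) $ 1 = x $ 1 + \<eta>" "(x + \<eta> *\<^sub>R One) $ 2 = x $ 2 + \<eta>"
        by (simp_all only: vector_add_component vector_scaleR_component One) simp_all
      have "\<bar>(y - x) $ i\<bar> \<le> \<eta>" for i
        using y exhaust_2[of i] unfolding mem_box_cart forall_2 x\<eta> by auto
      then have "norm (y - x) \<le> \<eta> + \<eta>"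
        using norm_le_l1_cart[of "y - x"] by (smt (verit) sum_2)
      then show "y \<in> \<Omega>" using e that by (auto simp: dist_norm norm_minus_commute)
    qed
    have "norm (f x) < t" if t: "0 < t" for t
    proof -
      obtain d where d: "0 < d" "\<And>h. 0 < h \<Longrightarrow> h < d \<Longrightarrow> norm (integral (cbox x (x + h *\<^sub>R One)) f /\<^sub>R h ^ DIM(real^2) - f x) < t"
        using conv[OF x(2) t] by blast
      define h where "h = min (d/2) (e/8)"
      have h: "0 < h" "h < d" "h < e / 4" using d e by (auto simp: h_def)
      show ?thesis using d(2)[OF h(1,2)] cube[OF sub[OF h(1,3)] h(1)] by simp
    qed
    from this[of "norm (f x)"] have "norm (f x) = 0" by fastforce
    then show ?thesis using x by (simp add: f_def)
  qed
  have "AE x in lebesgue. x \<notin> N"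
    using N by (intro AE_not_in) (simp add: negligible_iff_null_sets)
  then show ?thesis
    using gz meas by (subst AE_restrict_space_iff) auto
qed

section \<open>Weak derivatives do not see jumps\<close>

context frame
begin

lemma AE_R_neq: "AE x in lebesgue. R x \<noteq> r"
proof -
  have "{x. R x = r} = {x. \<nu> \<bullet> x = h * r + a \<bullet> \<nu>}"
    using h_pos by (auto simp: cr_def field_simps inner_diff_left inner_commute[of \<nu>])
  moreover have "\<nu> \<noteq> 0" using norm_nu by auto
  ultimately have "{x. R x = r} \<in> null_sets lebesgue"
    using negligible_hyperplane[of \<nu> "h * r + a \<bullet> \<nu>"] by (simp add: negligible_iff_null_sets)
  then show ?thesis by (auto dest: AE_not_in)
qed

text \<open>Replaces a trace theorem. Test the weak normal derivative with B(S) C_n(R), where C_n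
  shrinks onto the line R = 0 but keeps its value there. Integration by parts on both sides leaves
  the jump against B, with a constant independent of n, and this equals the integral of the test
  function against a fixed integrable G. The latter tends to 0, so the jump is orthogonal to every
  bump B.\<close>

lemma weak_pd_no_jump:
  fixes f :: "real^2 \<Rightarrow> real"
  assumes lt: "s0 < s1" "0 < d" and op: "open \<Omega>"
    and sub: "{x. s0 < S x \<and> S x < s1 \<and> - d < R x \<and> R x < d} \<subseteq> \<Omega>"
    and f: "integrable (lebesgue_on \<Omega>) f"
    and g: "\<And>j. integrable (lebesgue_on \<Omega>) (g j)" "\<And>j. has_weak_pd \<Omega> j f (g j)"
    and cm: "AE x in lebesgue. x \<in> rect s0 s1 (- d) 0 \<longrightarrow> f x = tpoly k cm (S x) (R x)"
    and cp: "AE x in lebesgue. x \<in> rect s0 s1 0 d \<longrightarrow> f x = tpoly k cp (S x) (R x)"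
    and s: "s0 < s" "s < s1"
  shows "tpoly k cm s 0 = tpoly k cp s 0"
proof -
  have meas: "\<Omega> \<in> sets lebesgue" using op by auto
  let ?I = "\<lambda>a b c. integral {s0..s1} (\<lambda>s. bump a b 1 1 0 s * tpoly k c s 0)"
  have key: "?I a b cm = ?I a b cp" if ab: "s0 < a" "a < b" "b < s1" for a b
  proof -
    \<comment> \<open>The shift by 2 keeps the half width strictly below d for every n, so that the
      support lies in the open strip contained in \<Omega>.\<close>
    define \<epsilon> where "\<epsilon> = (\<lambda>n. d / real (n + 2))"
    have \<epsilon>: "0 < \<epsilon> n" "\<epsilon> n < d" for n using lt mult_strict_left_mono[of 1 "real (n + 2)" d] by (auto simp: \<epsilon>_def divide_less_eq)
    define B where "B = bump a b 1 1 0"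
    define B' where "B' = bump a b 1 (bump_deriv_poly a b 1 1 0) 2"
    \<comment> \<open>The parameter c equal to the square of the half width makes
      \<open>C n 0\<close> = exp (- 1) for every n.\<close>
    define C where "C = (\<lambda>n. bump (- \<epsilon> n) (\<epsilon> n) ((\<epsilon> n)\<^sup>2) 1 0)"
    define C' where "C' = (\<lambda>n. bump (- \<epsilon> n) (\<epsilon> n) ((\<epsilon> n)\<^sup>2) (bump_deriv_poly (- \<epsilon> n) (\<epsilon> n) ((\<epsilon> n)\<^sup>2) 1 0) 2)"
    define \<phi> where "\<phi> = (\<lambda>n x. B (S x) * C n (R x))"
    have \<epsilon>': "- \<epsilon> n < \<epsilon> n" "0 < (\<epsilon> n)\<^sup>2" for n using \<epsilon>[of n] by auto
    have test: "\<phi> n \<in> test_functions \<Omega>" for n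
      unfolding \<phi>_def B_def C_def
      by (rule bump_test_function) (use ab \<epsilon>[of n] \<epsilon>'[of n] sub in \<open>auto simp: rect_def\<close>)
    have C0: "C n 0 = exp (- 1)" for n
      using \<epsilon>[of n] by (simp add: C_def bump_def power2_eq_square)
    have Cd: "C n r = 0" "C' n r = 0" if "\<bar>r\<bar> \<ge> d" for n r using \<epsilon>[of n] that by (auto simp: C_def C'_def bump_def)
    have Bz: "B s = 0" if "s \<le> s0 \<or> s1 \<le> s" for s using that ab by (auto simp: B_def bump_def)
    have CD: "(C n has_real_derivative C' n r) (at r)" for n r
      unfolding C_def C'_def using bump_has_derivative[OF \<epsilon>'(1)[of n] \<epsilon>'(2)[of n], where q = 1 and n = 0 and t = r] by (simp add: numeral_2_eq_2)
    have BD: "(B has_real_derivative B' s) (at s)" for s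
      unfolding B_def B'_def using bump_has_derivative[of a b 1, where q = 1 and n = 0 and t = s] ab by (simp add: numeral_2_eq_2)
    have contB: "continuous_on A B" and contC: "continuous_on A (C n)" and contC': "continuous_on A (C' n)" for A n
      unfolding B_def C_def C'_def using ab \<epsilon>'[of n] by (auto intro: continuous_on_bump)
    have D\<phi>: "(\<phi> n has_derivative (\<lambda>v. (v \<bullet> tau) / h * (B' (S x) * C n (R x)) + (v \<bullet> \<nu>) / h * (B (S x) * C' n (R x)))) (at x)" for n x
      unfolding \<phi>_def
      by (rule has_derivative_eq_rhs[OF has_derivative_mult[OF DERIV_compose_FDERIV[OF BD has_derivative_S] DERIV_compose_FDERIV[OF CD has_derivative_R]]])
         (simp add: fun_eq_iff algebra_simps)
    have pd: "pd j (\<phi> n) x = tau $ j / h * (B' (S x) * C n (R x)) + \<nu> $ j / h * (B (S x) * C' n (R x))" for j n x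
      unfolding pd_def frechet_derivative_at[OF D\<phi>, symmetric] by (simp add: inner_axis')
    have dnu: "\<nu> $ 1 * pd 1 (\<phi> n) x + \<nu> $ 2 * pd 2 (\<phi> n) x = B (S x) * C' n (R x) / h" for n x
    proof -
      have "\<nu> $ 1 * pd 1 (\<phi> n) x + \<nu> $ 2 * pd 2 (\<phi> n) x = (\<nu> \<bullet> tau) / h * (B' (S x) * C n (R x)) + (\<nu> \<bullet> \<nu>) / h * (B (S x) * C' n (R x))"
        unfolding pd inner_vec2 by (simp add: algebra_simps add_divide_distrib)
      then show ?thesis by simp
    qed
    \<comment> \<open>Piecewise normal derivative minus weak normal derivative; the division by h
      turns the derivative in r into the derivative along \<nu>.\<close>
    define G where "G = (\<lambda>x. (indicator (rect s0 s1 (- d) 0) x * tpoly k (dr k cm) (S x) (R x) +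
        indicator (rect s0 s1 0 d) x * tpoly k (dr k cp) (S x) (R x)) / h - indicator \<Omega> x * (\<nu> $ 1 * g 1 x + \<nu> $ 2 * g 2 x))"
    have int_rect: "integrable lebesgue (\<lambda>x. indicator (rect s0 s1 l u) x * q (S x) (R x))"
      and val_rect: "(LINT x|lebesgue. indicator (rect s0 s1 l u) x * q (S x) (R x)) = h\<^sup>2 * integral (cbox (s0, l) (s1, u)) (\<lambda>p. q (fst p) (snd p))"
      if "continuous_on (cbox (s0, l) (s1, u)) (\<lambda>p. q (fst p) (snd p))" for l u and q :: "real \<Rightarrow> real \<Rightarrow> real"
      using rect_integral[of s0 l s1 u "\<lambda>x. q (S x) (R x)"] that
      by (auto simp: set_integrable_def set_lebesgue_integral_def)
    have contq: "continuous_on A (\<lambda>p. tpoly k c (fst p) (snd p))" for A c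
      by (intro continuous_intros)
    have contBC: "continuous_on A (\<lambda>p. B (fst p) * C n (snd p))" "continuous_on A (\<lambda>p. B (fst p) * C' n (snd p))" for A :: "(real \<times> real) set" and n
      by (intro continuous_intros continuous_on_compose2[OF contB[of UNIV]] continuous_on_compose2[OF contC[of UNIV]] continuous_on_compose2[OF contC'[of UNIV]]; simp)+
    have G: "integrable lebesgue G"
      unfolding G_def
      using g(1)[of 1] g(1)[of 2] integrable_mult_right[of "\<nu> $ 1" _ "\<lambda>x. indicator \<Omega> x * g 1 x"] 
        integrable_mult_right[of "\<nu> $ 2" _ "\<lambda>x. indicator \<Omega> x * g 2 x"] meas
      by (intro Bochner_Integration.integrable_diff Bochner_Integration.integrable_divide Bochner_Integration.integrable_add int_rect contq)
         (simp add: integrable_lebesgue_on_iff distrib_left mult.left_commute)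
    have part: "(LINT x|lebesgue. indicator (rect s0 s1 l u) x * (B (S x) * C' n (R x) * tpoly k c (S x) (R x))) =
        h\<^sup>2 * (C n u * integral {s0..s1} (\<lambda>s. B s * tpoly k c s u) - C n l * integral {s0..s1} (\<lambda>s. B s * tpoly k c s l)) - 
        (LINT x|lebesgue. indicator (rect s0 s1 l u) x * (B (S x) * C n (R x) * tpoly k (dr k c) (S x) (R x)))"
      if "l \<le> u" for l u c n
    proof -
      let ?J = "cbox (s0, l) (s1, u)"
      have "integral ?J (\<lambda>p. 0 + (B (fst p) * C' n (snd p) * tpoly k c (fst p) (snd p) + B (fst p) * C n (snd p) * tpoly k (dr k c) (fst p) (snd p))) =
        integral {l..u} (\<lambda>r. 0 - 0) + integral {s0..s1} (\<lambda>s. B s * C n u * tpoly k c s u - B s * C n l * tpoly k c s l)"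
      proof (rule integral_divergence_rectangle[where X="\<lambda>_ _. 0" and Xs = "\<lambda>_ _. 0" and Y = "\<lambda>s r. B s * C n r * tpoly k c s r"
            and Yr = "\<lambda>s r. B s * C' n r * tpoly k c s r + B s * C n r * tpoly k (dr k c) s r"])
        show "((\<lambda>r. B s * C n r * tpoly k c s r) has_vector_derivative
           B s * C' n r * tpoly k c s r + B s * C n r * tpoly k (dr k c) s r) (at r within {l..u})" for s r
        proof -
          have "((\<lambda>r. tpoly k c s r) has_real_derivative tpoly k (dr k c) s r) (at r within {l..u})"
            unfolding has_real_derivative_iff_has_vector_derivative by (rule tpoly_has_vector_derivative_r)
          from DERIV_mult[OF DERIV_cmult[OF has_field_derivative_at_within[OF CD[of n r]], of "B s"] this]
          show ?thesis
            unfolding has_real_derivative_iff_has_vector_derivative[symmetric] by (rule DERIV_cong) simp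
        qed
      qed (use lt that in \<open>auto intro!: continuous_on_add contBC contq continuous_on_mult[OF contBC(1)] continuous_on_mult[OF contBC(2)]\<close>)
      moreover have "integral ?J (\<lambda>p. (B (fst p) * C' n (snd p) * tpoly k c (fst p) (snd p) + B (fst p) * C n (snd p) * tpoly k (dr k c) (fst p) (snd p))) =
         integral ?J (\<lambda>p. B (fst p) * C' n (snd p) * tpoly k c (fst p) (snd p)) + integral ?J (\<lambda>p. B (fst p) * C n (snd p) * tpoly k (dr k c) (fst p) (snd p))"
        by (intro Henstock_Kurzweil_Integration.integral_add integrable_continuous continuous_on_mult[OF contBC(1)] continuous_on_mult[OF contBC(2)] contq)
      moreover have "integral {s0..s1} (\<lambda>s. B s * C n u * tpoly k c s u - B s * C n l * tpoly k c s l) =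
          C n u * integral {s0..s1} (\<lambda>s. B s * tpoly k c s u) - C n l * integral {s0..s1} (\<lambda>s. B s * tpoly k c s l)"
        using contB by (subst Henstock_Kurzweil_Integration.integral_diff)
          (auto intro!: integrable_continuous_real continuous_intros simp: mult_ac simp flip: integral_mult_right)
      ultimately have e: "integral ?J (\<lambda>p. B (fst p) * C' n (snd p) * tpoly k c (fst p) (snd p)) + integral ?J (\<lambda>p. B (fst p) * C n (snd p) * tpoly k (dr k c) (fst p) (snd p)) =
          C n u * integral {s0..s1} (\<lambda>s. B s * tpoly k c s u) - C n l * integral {s0..s1} (\<lambda>s. B s * tpoly k c s l)"
        by simp
      have v: "(LINT x|lebesgue. indicator (rect s0 s1 l u) x * (B (S x) * C' n (R x) * tpoly k c (S x) (R x))) =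
           h\<^sup>2 * integral ?J (\<lambda>p. B (fst p) * C' n (snd p) * tpoly k c (fst p) (snd p))"
        "(LINT x|lebesgue. indicator (rect s0 s1 l u) x * (B (S x) * C n (R x) * tpoly k (dr k c) (S x) (R x))) =
           h\<^sup>2 * integral ?J (\<lambda>p. B (fst p) * C n (snd p) * tpoly k (dr k c) (fst p) (snd p))"
        by (rule val_rect[where q = "\<lambda>s r. B s * C' n r * tpoly k c s r"] val_rect[where q = "\<lambda>s r. B s * C n r * tpoly k (dr k c) s r"],
            intro continuous_on_mult[OF contBC(1)] continuous_on_mult[OF contBC(2)] contq)+
      show ?thesis unfolding v e[symmetric] by (simp only: distrib_left)
    qed
    have eq: "h * exp (- 1) * (?I a b cm - ?I a b cp) = (LINT x|lebesgue. \<phi> n x * G x)" for n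
    proof -
      have l: "- d \<le> 0" "0 \<le> d" and z: "C n d = 0" "C n (- d) = 0" using lt by (auto simp: Cd)
      have sm: "smooth (\<phi> n)" using test[of n] by (simp add: test_functions_def)
      have ip: "integrable (lebesgue_on \<Omega>) (\<lambda>x. pd j (\<phi> n) x * f x)" "integrable (lebesgue_on \<Omega>) (\<lambda>x. \<phi> n x * g j x)" for j
        using integrable_bounded_continuous_scaleR[OF meas f smooth_continuous_pd(2)[OF sm] test_function_bounds(2)[OF test[of n]], of j]
           integrable_bounded_continuous_scaleR[OF meas g(1) smooth_continuous_pd(1)[OF sm] test_function_bounds(1)[OF test[of n]], of j]
        by simp_all
      have "(LINT x|lebesgue_on \<Omega>. \<phi> n x * (\<nu> $ 1 * g 1 x + \<nu> $ 2 * g 2 x)) = 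
          (LINT x|lebesgue_on \<Omega>. \<nu> $ 1 * (\<phi> n x * g 1 x) + \<nu> $ 2 * (\<phi> n x * g 2 x))"
        by (simp add: algebra_simps)
      also have "\<dots> = \<nu> $ 1 * (LINT x|lebesgue_on \<Omega>. \<phi> n x * g 1 x) + \<nu> $ 2 * (LINT x|lebesgue_on \<Omega>. \<phi> n x * g 2 x)"
        using ip by simp
      also have "\<dots> = - (\<nu> $ 1 * (LINT x|lebesgue_on \<Omega>. pd 1 (\<phi> n) x * f x) + \<nu> $ 2 * (LINT x|lebesgue_on \<Omega>. pd 2 (\<phi> n) x * f x))"
        using g(2)[of 1] g(2)[of 2] test[of n] by (simp add: has_weak_pd_def)
      also have "\<nu> $ 1 * (LINT x|lebesgue_on \<Omega>. pd 1 (\<phi> n) x * f x) + \<nu> $ 2 * (LINT x|lebesgue_on \<Omega>. pd 2 (\<phi> n) x * f x) =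
         (LINT x|lebesgue_on \<Omega>. \<nu> $ 1 * (pd 1 (\<phi> n) x * f x) + \<nu> $ 2 * (pd 2 (\<phi> n) x * f x))"
        using ip by simp
      also have "\<dots> = (LINT x|lebesgue_on \<Omega>. (B (S x) * C' n (R x) / h) * f x)"
        unfolding dnu[symmetric] by (simp add: algebra_simps)
      also have "\<dots> = (LINT x|lebesgue. indicator \<Omega> x * ((B (S x) * C' n (R x) / h) * f x))"
        using meas by (simp add: integral_lebesgue_on_eq)
      also have "\<dots> = (LINT x|lebesgue. (indicator (rect s0 s1 (- d) 0) x * (B (S x) * C' n (R x) * tpoly k cm (S x) (R x)) +
          indicator (rect s0 s1 0 d) x * (B (S x) * C' n (R x) * tpoly k cp (S x) (R x))) / h)"
      proof (rule integral_cong_AE)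
        show "AE x in lebesgue. indicat_real \<Omega> x * ((B (S x) * C' n (R x) / h) * f x) =
          (indicator (rect s0 s1 (- d) 0) x * (B (S x) * C' n (R x) * tpoly k cm (S x) (R x)) +
          indicator (rect s0 s1 0 d) x * (B (S x) * C' n (R x) * tpoly k cp (S x) (R x))) / h"
          using AE_R_neq[of 0] cm cp
        proof eventually_elim
          case (elim x)
          show ?case
          proof (cases "s0 < S x \<and> S x < s1 \<and> - d < R x \<and> R x < d")
            case True
            then have "x \<in> \<Omega>" using sub by auto
            then show ?thesis using True elim by (cases "R x < 0") (auto simp: rect_def)
          next
            case False
            then consider "S x \<le> s0 \<or> s1 \<le> S x" | "d \<le> \<bar>R x\<bar>" by linarith
            then have "B (S x) * C' n (R x) = 0"
              by cases (simp_all add: Bz Cd)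
            then show ?thesis by auto
          qed
        qed
        have "integrable lebesgue (\<lambda>x. indicator \<Omega> x * (pd j (\<phi> n) x * f x))" for j
          using ip(1)[of j] meas by (simp add: integrable_lebesgue_on_iff)
        then have "integrable lebesgue (\<lambda>x. \<nu> $ 1 * (indicator \<Omega> x * (pd 1 (\<phi> n) x * f x)) + \<nu> $ 2 * (indicator \<Omega> x * (pd 2 (\<phi> n) x * f x)))"
          by (intro Bochner_Integration.integrable_add Bochner_Integration.integrable_mult_right)
        also have "(\<lambda>x. \<nu> $ 1 * (indicator \<Omega> x * (pd 1 (\<phi> n) x * f x)) + \<nu> $ 2 * (indicator \<Omega> x * (pd 2 (\<phi> n) x * f x))) =
          (\<lambda>x. indicator \<Omega> x * ((B (S x) * C' n (R x) / h) * f x))"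
          unfolding dnu[symmetric] by (simp add: fun_eq_iff algebra_simps)
        finally show "(\<lambda>x. indicator \<Omega> x * ((B (S x) * C' n (R x) / h) * f x)) \<in> borel_measurable lebesgue"
          by (rule borel_measurable_integrable)
        show "(\<lambda>x. (indicator (rect s0 s1 (- d) 0) x * (B (S x) * C' n (R x) * tpoly k cm (S x) (R x)) +
          indicator (rect s0 s1 0 d) x * (B (S x) * C' n (R x) * tpoly k cp (S x) (R x))) / h) \<in> borel_measurable lebesgue"
          by (intro borel_measurable_integrable Bochner_Integration.integrable_divide Bochner_Integration.integrable_add
            int_rect[where q = "\<lambda>s r. B s * C' n r * tpoly k _ s r"] continuous_on_mult[OF contBC(1)] continuous_on_mult[OF contBC(2)] contq)
      qed
      also have "\<dots> = ((LINT x|lebesgue. indicator (rect s0 s1 (- d) 0) x * (B (S x) * C' n (R x) * tpoly k cm (S x) (R x))) +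
          (LINT x|lebesgue. indicator (rect s0 s1 0 d) x * (B (S x) * C' n (R x) * tpoly k cp (S x) (R x)))) / h"
        by (subst Bochner_Integration.integral_divide_zero, subst Bochner_Integration.integral_add)
           (auto intro!: int_rect[where q = "\<lambda>s r. B s * C' n r * tpoly k _ s r"] continuous_on_mult[OF contBC(1)] continuous_on_mult[OF contBC(2)] contq)
      also have "\<dots> = (h\<^sup>2 * exp (- 1) * (?I a b cm - ?I a b cp) - 
          ((LINT x|lebesgue. indicator (rect s0 s1 (- d) 0) x * (B (S x) * C n (R x) * tpoly k (dr k cm) (S x) (R x))) +
          (LINT x|lebesgue. indicator (rect s0 s1 0 d) x * (B (S x) * C n (R x) * tpoly k (dr k cp) (S x) (R x))))) / h"
        unfolding part[OF l(1)] part[OF l(2)] C0 z B_def[symmetric] by (rule arg_cong[where f = "\<lambda>x. x / h"]) algebra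
      finally have e1: "(LINT x|lebesgue_on \<Omega>. \<phi> n x * (\<nu> $ 1 * g 1 x + \<nu> $ 2 * g 2 x)) = 
        - ((h\<^sup>2 * exp (- 1) * (?I a b cm - ?I a b cp) - 
          ((LINT x|lebesgue. indicator (rect s0 s1 (- d) 0) x * (B (S x) * C n (R x) * tpoly k (dr k cm) (S x) (R x))) +
          (LINT x|lebesgue. indicator (rect s0 s1 0 d) x * (B (S x) * C n (R x) * tpoly k (dr k cp) (S x) (R x))))) / h)" .
      have ii: "integrable lebesgue (\<lambda>x. indicator \<Omega> x * (\<phi> n x * g j x))" for j
        using ip(2)[of j] meas by (simp add: integrable_lebesgue_on_iff)
      have ig: "integrable lebesgue (\<lambda>x. indicator \<Omega> x * (\<phi> n x * (\<nu> $ 1 * g 1 x + \<nu> $ 2 * g 2 x)))"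
      proof -
        have "integrable lebesgue (\<lambda>x. \<nu> $ 1 * (indicator \<Omega> x * (\<phi> n x * g 1 x)) + \<nu> $ 2 * (indicator \<Omega> x * (\<phi> n x * g 2 x)))"
          by (intro Bochner_Integration.integrable_add Bochner_Integration.integrable_mult_right ii)
        then show ?thesis by (simp add: algebra_simps)
      qed
      have i: "integrable lebesgue (\<lambda>x. indicator (rect s0 s1 (- d) 0) x * (B (S x) * C n (R x) * tpoly k (dr k cm) (S x) (R x)))"
        "integrable lebesgue (\<lambda>x. indicator (rect s0 s1 0 d) x * (B (S x) * C n (R x) * tpoly k (dr k cp) (S x) (R x)))"
        by (rule int_rect[where q = "\<lambda>s r. B s * C n r * tpoly k _ s r"], intro continuous_on_mult[OF contBC(1)] contq)+
      have "(LINT x|lebesgue. \<phi> n x * G x) = (LINT x|lebesgue. (indicator (rect s0 s1 (- d) 0) x * (B (S x) * C n (R x) * tpoly k (dr k cm) (S x) (R x)) +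
          indicator (rect s0 s1 0 d) x * (B (S x) * C n (R x) * tpoly k (dr k cp) (S x) (R x))) / h - 
          indicator \<Omega> x * (\<phi> n x * (\<nu> $ 1 * g 1 x + \<nu> $ 2 * g 2 x)))"
        by (intro Bochner_Integration.integral_cong refl) (simp add: G_def \<phi>_def algebra_simps add_divide_distrib)
      also have "\<dots> = ((LINT x|lebesgue. indicator (rect s0 s1 (- d) 0) x * (B (S x) * C n (R x) * tpoly k (dr k cm) (S x) (R x))) +
          (LINT x|lebesgue. indicator (rect s0 s1 0 d) x * (B (S x) * C n (R x) * tpoly k (dr k cp) (S x) (R x)))) / h - 
          (LINT x|lebesgue. indicator \<Omega> x * (\<phi> n x * (\<nu> $ 1 * g 1 x + \<nu> $ 2 * g 2 x)))"
        by (simp only: Bochner_Integration.integral_diff[OF Bochner_Integration.integrable_divide[OF Bochner_Integration.integrable_add[OF i]] ig]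
            Bochner_Integration.integral_divide_zero Bochner_Integration.integral_add[OF i])
      also have "(LINT x|lebesgue. indicator \<Omega> x * (\<phi> n x * (\<nu> $ 1 * g 1 x + \<nu> $ 2 * g 2 x))) = (LINT x|lebesgue_on \<Omega>. \<phi> n x * (\<nu> $ 1 * g 1 x + \<nu> $ 2 * g 2 x))"
        using meas by (simp add: integral_lebesgue_on_eq)
      finally show ?thesis
        unfolding e1 using h_pos by (simp add: diff_divide_distrib power2_eq_square)
    qed
    have "(\<lambda>n. LINT x|lebesgue. \<phi> n x * G x) \<longlonglongrightarrow> integral\<^sup>L lebesgue (\<lambda>_::real^2. 0)"
    proof (rule integral_dominated_convergence[where w = "\<lambda>x. norm (G x)"])
      show "(\<lambda>x. \<phi> n x * G x) \<in> borel_measurable lebesgue" for n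
        using G borel_measurable_lebesgue_continuous[OF smooth_continuous_pd(1)] test[of n] 
        by (intro borel_measurable_times) (auto simp: test_functions_def)
      have "\<bar>\<phi> n x\<bar> \<le> 1" for n x
        using bump_bounds[of a b 1 "S x"] bump_bounds[OF \<epsilon>'(1)[of n] \<epsilon>'(2)[of n], of "R x"] ab
        unfolding \<phi>_def B_def C_def by (auto simp: abs_mult intro!: mult_le_one)
      then show "AE x in lebesgue. norm (\<phi> n x * G x) \<le> norm (G x)" for n
        by (auto intro!: AE_I2 mult_left_le_one_le simp: abs_mult)
      show "AE x in lebesgue. (\<lambda>n. \<phi> n x * G x) \<longlonglongrightarrow> 0"
        using AE_R_neq[of 0]
      proof eventually_elim
        case (elim x)
        have "\<epsilon> \<longlonglongrightarrow> 0"
          unfolding \<epsilon>_def using LIMSEQ_ignore_initial_segment[OF lim_const_over_n[of d], of 2] by simp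
        then have "eventually (\<lambda>n. \<epsilon> n < \<bar>R x\<bar>) sequentially"
          using elim by (intro order_tendstoD(2)) auto
        then have "eventually (\<lambda>n. \<phi> n x * G x = 0) sequentially"
          by eventually_elim (auto simp: \<phi>_def C_def bump_def)
        then show ?case by (rule tendsto_eventually)
      qed
    qed (use G in auto)
    then have "h * exp (- 1) * (?I a b cm - ?I a b cp) = 0"
      unfolding eq[symmetric] by (simp add: LIMSEQ_const_iff)
    then show ?thesis using h_pos by simp
  qed
  define D where "D = (\<lambda>s. tpoly k cm s 0 - tpoly k cp s 0)"
  have contD: "continuous_on A D" for A unfolding D_def by (intro continuous_intros)
  have "D s = 0"
  proof (rule ccontr)
    assume D: "D s \<noteq> 0"
    have "isCont (\<lambda>t. D t * D s) s" using contD[of UNIV] by (intro continuous_intros) (simp add: continuous_on_eq_continuous_at)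
    then have "eventually (\<lambda>t. 0 < D t * D s) (at s)"
      unfolding isCont_def using D by (intro order_tendstoD(1)[where y = "D s * D s"]) (auto simp flip: power2_eq_square)
    then obtain \<eta> where \<eta>: "0 < \<eta>" "\<And>t. t \<noteq> s \<Longrightarrow> dist t s < \<eta> \<Longrightarrow> 0 < D t * D s"
      unfolding eventually_at by auto
    have \<eta>': "0 < D t * D s" if "dist t s < \<eta>" for t
      using \<eta>(2)[of t] that D by (cases "t = s") (auto simp flip: power2_eq_square)
    \<comment> \<open>The interval (a, b) stays within distance \<eta> of s, where the jump has the
      sign of its value at s, and strictly inside (s0, s1) thanks to the midpoints. The integrand is
      then nonnegative and positive at s.\<close>
    define a where "a = max (s - \<eta>) ((s0 + s) / 2)"
    define b where "b = min (s + \<eta>) ((s1 + s) / 2)"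
    have ab: "s0 < a" "a < s" "s < b" "b < s1" "a \<ge> s - \<eta>" "b \<le> s + \<eta>"
      using s \<eta>(1) by (auto simp: a_def b_def less_max_iff_disj min_less_iff_disj)
    let ?f = "\<lambda>t. bump a b 1 1 0 t * (D t * D s)"
    have cont: "continuous_on {s0..s1} ?f"
      using ab by (intro continuous_intros continuous_on_bump contD) auto
    have nn: "0 \<le> ?f t" for t
    proof (cases "a < t \<and> t < b")
      case True
      then have "dist t s < \<eta>" using ab by (auto simp: dist_real_def)
      then show ?thesis
        using mult_nonneg_nonneg[OF conjunct1[OF bump_bounds[of a b 1 t]] less_imp_le[OF \<eta>'[of t]]] ab by simp
    qed (auto simp: bump_def)
    have ib: "(\<lambda>t. bump a b 1 1 0 t * tpoly k c t 0) integrable_on {s0..s1}" for c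
      using ab by (intro integrable_continuous_real continuous_intros continuous_on_bump) auto
    have "integral {s0..s1} ?f = D s * (?I a b cm - ?I a b cp)"
      by (subst Henstock_Kurzweil_Integration.integral_diff[symmetric, OF ib ib], subst integral_mult_right[symmetric])
         (simp add: D_def algebra_simps)
    also have "\<dots> = 0" using key[of a b] ab by simp
    finally have "?f s = 0" using integral_eq_0_iff[OF cont] s nn by auto
    moreover have "0 < ?f s" using ab \<eta>'[of s] \<eta>(1) by (auto simp: bump_0)
    ultimately show False by (simp only: less_irrefl)
  qed
  then show ?thesis by (simp add: D_def)
qed

end

section \<open>Divergence-free test tensors\<close>

definition outer :: "real^2 \<Rightarrow> real^2 \<Rightarrow> real^2^2" where
  "outer x y = (\<chi> i j. x $ i * y $ j)"

lemma inner_mat2: "(M::real^2^2) \<bullet> N = M $ 1 $ 1 * N $ 1 $ 1 + M $ 1 $ 2 * N $ 1 $ 2 + M $ 2 $ 1 * N $ 2 $ 1 + M $ 2 $ 2 * N $ 2 $ 2"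
  by (simp add: inner_vec_def sum_2)

lemma inner_outer: "M \<bullet> outer x y = (M *v y) \<bullet> x"
  by (simp add: inner_mat2 inner_vec2 outer_def matrix_vector_mult_def sum_2 algebra_simps)

lemma outer_mult_vec: "outer x y *v z = (y \<bullet> z) *\<^sub>R x"
  by (simp add: vec2_eq_iff inner_vec2 outer_def matrix_vector_mult_def sum_2 algebra_simps)

lemma outer_inner_outer: "outer x y \<bullet> outer z w = (x \<bullet> z) * (y \<bullet> w)"
  by (simp add: inner_outer outer_mult_vec inner_commute)

lemma mat2_eq_iff: "(M::real^2^2) = N \<longleftrightarrow> M $ 1 $ 1 = N $ 1 $ 1 \<and> M $ 1 $ 2 = N $ 1 $ 2 \<and> M $ 2 $ 1 = N $ 2 $ 1 \<and> M $ 2 $ 2 = N $ 2 $ 2"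
  by (simp add: vec_eq_iff forall_2)

lemma Sym_iff: "M \<in> Sym \<longleftrightarrow> M $ 1 $ 2 = M $ 2 $ 1"
  by (auto simp: Sym_def mat2_eq_iff transpose_def)

lemma Sym_closed:
  "0 \<in> Sym" "M \<in> Sym \<Longrightarrow> N \<in> Sym \<Longrightarrow> M + N \<in> Sym" "M \<in> Sym \<Longrightarrow> N \<in> Sym \<Longrightarrow> M - N \<in> Sym" "M \<in> Sym \<Longrightarrow> c *\<^sub>R M \<in> Sym"
  by (auto simp: Sym_iff)

lemma has_vector_derivative_scaleR_diff:
  fixes v w :: "'a::real_normed_vector"
  assumes f: "(f has_real_derivative f') (at s within A)" and g: "(g has_real_derivative g') (at s within A)"
    and k: "(k has_real_derivative k') (at s within A)"
  shows "((\<lambda>s. f s *\<^sub>R (g s *\<^sub>R v - k s *\<^sub>R w)) has_vector_derivative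
     f' *\<^sub>R (g s *\<^sub>R v - k s *\<^sub>R w) + f s *\<^sub>R (g' *\<^sub>R v - k' *\<^sub>R w)) (at s within A)"
proof -
  have "((\<lambda>s. g s *\<^sub>R v - k s *\<^sub>R w) has_vector_derivative g' *\<^sub>R v - k' *\<^sub>R w) (at s within A)"
    using has_vector_derivative_diff[OF has_vector_derivative_scaleR[OF g has_vector_derivative_const] has_vector_derivative_scaleR[OF k has_vector_derivative_const]]
    by simp
  from has_vector_derivative_scaleR[OF f this] show ?thesis by (simp add: add.commute)
qed

section \<open>The Airy tensor of a product potential and its weak divergence\<close>

context frame
begin

text \<open>The rotated Hessian of B(s) C(r) with respect to the scaled coordinates: the second
  r-derivative in the tt slot, minus the mixed derivative in the tn slots, the second s-derivative
  in the nn slot. Its rows are divergence free because partial derivatives commute. The factor 1 / h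
  ^ 2 of the true Hessian is dropped, which only rescales the test tensor.\<close>

definition airy :: "real poly \<Rightarrow> real poly \<Rightarrow> real \<Rightarrow> real \<Rightarrow> real^2^2" where
  "airy B C s r = (poly B s * poly (pderiv (pderiv C)) r) *\<^sub>R outer tau tau
     - (poly (pderiv B) s * poly (pderiv C) r) *\<^sub>R (outer tau \<nu> + outer \<nu> tau)
     + (poly (pderiv (pderiv B)) s * poly C r) *\<^sub>R outer \<nu> \<nu>"

definition test_tensor :: "real \<Rightarrow> real \<Rightarrow> real \<Rightarrow> real \<Rightarrow> real poly \<Rightarrow> real poly \<Rightarrow> real^2 \<Rightarrow> real^2^2" where
  "test_tensor s0 s1 l u B C x = indicator (rect s0 s1 l u) x *\<^sub>R airy B C (S x) (R x)"

lemma airy_Sym: "airy B C s r \<in> Sym"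
  by (simp add: airy_def Sym_iff outer_def)

lemma test_tensor_Sym: "test_tensor s0 s1 l u B C x \<in> Sym"
  by (simp add: test_tensor_def Sym_closed airy_Sym)

lemma inner_airy:
  assumes "M \<in> Sym"
  shows "M \<bullet> airy B C s r = ((M *v tau) \<bullet> tau) * (poly B s * poly (pderiv (pderiv C)) r)
     - 2 * ((M *v tau) \<bullet> \<nu>) * (poly (pderiv B) s * poly (pderiv C) r)
     + ((M *v \<nu>) \<bullet> \<nu>) * (poly (pderiv (pderiv B)) s * poly C r)"
proof -
  have "(M *v \<nu>) \<bullet> tau = (M *v tau) \<bullet> \<nu>"
    using assms by (simp add: Sym_iff inner_vec2 matrix_vector_mult_def sum_2 algebra_simps)
  then show ?thesis
    by (simp add: airy_def inner_diff_right inner_add_right inner_outer algebra_simps)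
qed

lemma norm_airy_sq:
  "(norm (airy B C s r))\<^sup>2 = (poly B s * poly (pderiv (pderiv C)) r)\<^sup>2
     + 2 * (poly (pderiv B) s * poly (pderiv C) r)\<^sup>2 + (poly (pderiv (pderiv B)) s * poly C r)\<^sup>2"
  unfolding power2_norm_eq_inner airy_def
  by (simp add: inner_diff_right inner_add_right inner_diff_left inner_add_left outer_inner_outer power2_eq_square)

lemma continuous_on_airy: 
  "continuous_on A f \<Longrightarrow> continuous_on A g \<Longrightarrow> continuous_on A (\<lambda>x. airy B C (f x) (g x))"
  unfolding airy_def by (intro continuous_intros)

lemma airy_mult_grad:
  "airy B C s r *v w = ((tau \<bullet> w) * (poly B s * poly (pderiv (pderiv C)) r) - (\<nu> \<bullet> w) * (poly (pderiv B) s * poly (pderiv C) r)) *\<^sub>R tau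
    + ((\<nu> \<bullet> w) * (poly (pderiv (pderiv B)) s * poly C r) - (tau \<bullet> w) * (poly (pderiv B) s * poly (pderiv C) r)) *\<^sub>R \<nu>"
  by (simp add: airy_def matrix_vector_mult_add_rdistrib matrix_vector_mult_diff_rdistrib scaleR_matrix_vector_assoc[symmetric]
      outer_mult_vec algebra_simps)

lemma test_tensor_integrable:
  "integrable lebesgue (\<lambda>x. test_tensor s0 s1 l u B C x)"
  "integrable lebesgue (\<lambda>x. (norm (test_tensor s0 s1 l u B C x))\<^sup>2)"
  "(LINT x|lebesgue. (norm (test_tensor s0 s1 l u B C x))\<^sup>2) = h\<^sup>2 * integral (cbox (s0, l) (s1, u))
     (\<lambda>p. (poly B (fst p) * poly (pderiv (pderiv C)) (snd p))\<^sup>2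
     + 2 * (poly (pderiv B) (fst p) * poly (pderiv C) (snd p))\<^sup>2 + (poly (pderiv (pderiv B)) (fst p) * poly C (snd p))\<^sup>2)"
proof -
  have c: "continuous_on (cbox (s0, l) (s1, u)) (\<lambda>p. airy B C (S (F (fst p) (snd p))) (R (F (fst p) (snd p))))"
    by (simp, intro continuous_on_airy continuous_intros)
  show "integrable lebesgue (\<lambda>x. test_tensor s0 s1 l u B C x)"
    using rect_integral(1)[of s0 l s1 u "\<lambda>x. airy B C (S x) (R x)", OF c] by (simp add: set_integrable_def test_tensor_def)
  have c2: "continuous_on (cbox (s0, l) (s1, u)) (\<lambda>p. (norm (airy B C (S (F (fst p) (snd p))) (R (F (fst p) (snd p)))))\<^sup>2)"
    by (intro continuous_intros c)
  have eq: "(norm (test_tensor s0 s1 l u B C x))\<^sup>2 = indicator (rect s0 s1 l u) x *\<^sub>R (norm (airy B C (S x) (R x)))\<^sup>2" for x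
    by (simp add: test_tensor_def indicator_def)
  show "integrable lebesgue (\<lambda>x. (norm (test_tensor s0 s1 l u B C x))\<^sup>2)"
    using rect_integral(1)[of s0 l s1 u "\<lambda>x. (norm (airy B C (S x) (R x)))\<^sup>2", OF c2] unfolding eq by (simp add: set_integrable_def)
  show "(LINT x|lebesgue. (norm (test_tensor s0 s1 l u B C x))\<^sup>2) = h\<^sup>2 * integral (cbox (s0, l) (s1, u))
     (\<lambda>p. (poly B (fst p) * poly (pderiv (pderiv C)) (snd p))\<^sup>2
     + 2 * (poly (pderiv B) (fst p) * poly (pderiv C) (snd p))\<^sup>2 + (poly (pderiv (pderiv B)) (fst p) * poly C (snd p))\<^sup>2)"
    using rect_integral(2)[of s0 l s1 u "\<lambda>x. (norm (airy B C (S x) (R x)))\<^sup>2", OF c2] 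
    unfolding eq by (simp add: set_lebesgue_integral_def norm_airy_sq)
qed

lemma has_derivative_grad:
  assumes "\<phi> differentiable (at x)"
  shows "(\<phi> has_derivative (\<lambda>v. v \<bullet> grad \<phi> x)) (at x)"
proof -
  have D: "(\<phi> has_derivative frechet_derivative \<phi> (at x)) (at x)"
    using assms frechet_derivative_works by blast
  have lin: "linear (frechet_derivative \<phi> (at x))"
    using D has_derivative_linear by blast
  have "frechet_derivative \<phi> (at x) v = v \<bullet> grad \<phi> x" for v
  proof -
    have "v = v $ 1 *\<^sub>R axis 1 1 + v $ 2 *\<^sub>R axis 2 1" by (simp add: vec2_eq_iff axis_def)
    then have "frechet_derivative \<phi> (at x) v = frechet_derivative \<phi> (at x) (v $ 1 *\<^sub>R axis 1 1 + v $ 2 *\<^sub>R axis 2 1)"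
      by simp
    also have "\<dots> = v $ 1 * pd 1 \<phi> x + v $ 2 * pd 2 \<phi> x"
      using lin by (simp add: linear_add linear_scale pd_def)
    finally show ?thesis by (simp add: inner_vec2 grad_def)
  qed
  then have "frechet_derivative \<phi> (at x) = (\<lambda>v. v \<bullet> grad \<phi> x)" by blast
  then show ?thesis using D by simp
qed

lemma continuous_on_grad:
  assumes "smooth \<phi>" shows "continuous_on A (grad \<phi>)"
proof -
  have "grad \<phi> = (\<lambda>x. vector [pd 1 \<phi> x, pd 2 \<phi> x])"
    by (simp add: fun_eq_iff grad_def vec2_eq_iff)
  then show ?thesis 
    using continuous_on_subset[OF smooth_continuous_pd(2)[OF assms]] by (simp only:) (intro continuous_intros; simp)
qed

text \<open>The test function times the traction \<open>airy B C s r *v \<nu>\<close> through the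
  line of height r.\<close>

definition edge_flux :: "real poly \<Rightarrow> real poly \<Rightarrow> (real^2 \<Rightarrow> real) \<Rightarrow> real \<Rightarrow> real \<Rightarrow> real^2" where
  "edge_flux B C \<phi> s r = \<phi> (F s r) *\<^sub>R ((poly (pderiv (pderiv B)) s * poly C r) *\<^sub>R \<nu> - (poly (pderiv B) s * poly (pderiv C) r) *\<^sub>R tau)"

text \<open>As the Airy tensor is divergence free, its product with a gradient is itself a
  divergence, and only boundary terms survive. The sides s = s0 and s = s1 drop out by the zeros of
  B, leaving the fluxes through the top and the bottom.\<close>

lemma test_tensor_grad:
  assumes \<phi>: "smooth \<phi>" and le: "s0 \<le> s1" "l \<le> u" and B: "vanish3 B s0" "vanish3 B s1"
  shows "integrable lebesgue (\<lambda>x. test_tensor s0 s1 l u B C x *v grad \<phi> x)"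
    and "(LINT x|lebesgue. test_tensor s0 s1 l u B C x *v grad \<phi> x) =
       h *\<^sub>R integral {s0..s1} (\<lambda>s. edge_flux B C \<phi> s u - edge_flux B C \<phi> s l)"
proof -
  let ?J = "cbox (s0, l) (s1, u)"
  let ?B = "poly B" and ?B1 = "poly (pderiv B)" and ?B2 = "poly (pderiv (pderiv B))"
  let ?C = "poly C" and ?C1 = "poly (pderiv C)" and ?C2 = "poly (pderiv (pderiv C))"
  define g where "g = (\<lambda>s r. grad \<phi> (F s r))"
  have g_eq: "grad \<phi> (F s r) = g s r" for s r by (simp add: g_def)
  have cg: "continuous_on A (\<lambda>p. g (fst p) (snd p))" for A
    unfolding g_def by (intro continuous_on_compose2[OF continuous_on_grad[OF \<phi>, of UNIV]] continuous_intros) auto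
  have cphi: "continuous_on A (\<lambda>p. \<phi> (F (fst p) (snd p)))" for A :: "(real \<times> real) set"
    by (intro continuous_on_compose2[OF smooth_continuous_pd(1)[OF \<phi>]] continuous_intros) auto
  have eq: "test_tensor s0 s1 l u B C x *v grad \<phi> x = indicator (rect s0 s1 l u) x *\<^sub>R (airy B C (S x) (R x) *v grad \<phi> x)" for x
    by (simp add: test_tensor_def indicator_def)
  have cont: "continuous_on ?J (\<lambda>p. airy B C (S (F (fst p) (snd p))) (R (F (fst p) (snd p))) *v grad \<phi> (F (fst p) (snd p)))"
    unfolding airy_mult_grad g_eq S_F R_F by (intro continuous_intros cg)
  show "integrable lebesgue (\<lambda>x. test_tensor s0 s1 l u B C x *v grad \<phi> x)"
    using rect_integral(1)[of s0 l s1 u "\<lambda>x. airy B C (S x) (R x) *v grad \<phi> x", OF cont] unfolding eq set_integrable_def .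
  \<comment> \<open>\<open>Xs\<close> and \<open>Yr\<close> are the derivatives of the two flux
    components. Their parts carrying the undifferentiated test function cancel in the sum, which is
    the vanishing of the divergence.\<close>
  define Xs where "Xs = (\<lambda>s r. (h * (tau \<bullet> g s r)) *\<^sub>R ((?B s * ?C2 r) *\<^sub>R tau - (?B1 s * ?C1 r) *\<^sub>R \<nu>) +
     \<phi> (F s r) *\<^sub>R ((?B1 s * ?C2 r) *\<^sub>R tau - (?B2 s * ?C1 r) *\<^sub>R \<nu>))"
  define Yr where "Yr = (\<lambda>s r. (h * (\<nu> \<bullet> g s r)) *\<^sub>R ((?B2 s * ?C r) *\<^sub>R \<nu> - (?B1 s * ?C1 r) *\<^sub>R tau) +
     \<phi> (F s r) *\<^sub>R ((?B2 s * ?C1 r) *\<^sub>R \<nu> - (?B1 s * ?C2 r) *\<^sub>R tau))"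
  have ds\<phi>: "((\<lambda>s. \<phi> (F s r)) has_real_derivative h * (tau \<bullet> g s r)) (at s within A)" for s r A
  proof -
    have "((\<lambda>s. F s r) has_derivative (\<lambda>v. (h * v) *\<^sub>R tau)) (at s within A)"
      unfolding fr_def by (auto intro!: derivative_eq_intros)
    from has_derivative_compose[OF this has_derivative_grad[OF smooth_continuous_pd(3)[OF \<phi>]]]
    show ?thesis unfolding has_field_derivative_def by (rule has_derivative_eq_rhs) (simp add: fun_eq_iff g_def)
  qed
  have dr\<phi>: "((\<lambda>r. \<phi> (F s r)) has_real_derivative h * (\<nu> \<bullet> g s r)) (at r within A)" for s r A
  proof -
    have "((\<lambda>r. F s r) has_derivative (\<lambda>v. (h * v) *\<^sub>R \<nu>)) (at r within A)"
      unfolding fr_def by (auto intro!: derivative_eq_intros)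
    from has_derivative_compose[OF this has_derivative_grad[OF smooth_continuous_pd(3)[OF \<phi>]]]
    show ?thesis unfolding has_field_derivative_def by (rule has_derivative_eq_rhs) (simp add: fun_eq_iff g_def)
  qed
  have XY: "h *\<^sub>R (airy B C s r *v g s r) = Xs s r + Yr s r" for s r
    unfolding airy_mult_grad Xs_def Yr_def by (simp add: algebra_simps)
  have I: "integral ?J (\<lambda>p. Xs (fst p) (snd p) + Yr (fst p) (snd p)) = 
     integral {l..u} (\<lambda>r. \<phi> (F s1 r) *\<^sub>R ((?B s1 * ?C2 r) *\<^sub>R tau - (?B1 s1 * ?C1 r) *\<^sub>R \<nu>) - \<phi> (F s0 r) *\<^sub>R ((?B s0 * ?C2 r) *\<^sub>R tau - (?B1 s0 * ?C1 r) *\<^sub>R \<nu>))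
     + integral {s0..s1} (\<lambda>s. edge_flux B C \<phi> s u - edge_flux B C \<phi> s l)"
  proof (rule integral_divergence_rectangle[OF le])
    show "((\<lambda>s. \<phi> (F s r) *\<^sub>R ((?B s * ?C2 r) *\<^sub>R tau - (?B1 s * ?C1 r) *\<^sub>R \<nu>)) has_vector_derivative Xs s r) (at s within {s0..s1})" for s r
      unfolding Xs_def
      by (rule has_vector_derivative_scaleR_diff[OF ds\<phi> DERIV_cmult_right DERIV_cmult_right]; rule has_field_derivative_at_within[OF poly_DERIV])
    show "((\<lambda>r. edge_flux B C \<phi> s r) has_vector_derivative Yr s r) (at r within {l..u})" for s r
      unfolding Yr_def edge_flux_def
      by (rule has_vector_derivative_scaleR_diff[OF dr\<phi> DERIV_cmult DERIV_cmult]; rule has_field_derivative_at_within[OF poly_DERIV])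
    show "continuous_on ?J (\<lambda>p. Xs (fst p) (snd p))" "continuous_on ?J (\<lambda>p. Yr (fst p) (snd p))"
      unfolding Xs_def Yr_def by (intro continuous_intros cg cphi)+
  qed
  have "(LINT x|lebesgue. test_tensor s0 s1 l u B C x *v grad \<phi> x) = h\<^sup>2 *\<^sub>R integral ?J (\<lambda>p. airy B C (fst p) (snd p) *v g (fst p) (snd p))"
    using rect_integral(2)[of s0 l s1 u "\<lambda>x. airy B C (S x) (R x) *v grad \<phi> x", OF cont] unfolding eq set_lebesgue_integral_def
    by (simp add: g_eq)
  also have "\<dots> = h *\<^sub>R integral ?J (\<lambda>p. h *\<^sub>R (airy B C (fst p) (snd p) *v g (fst p) (snd p)))"
    by (simp add: power2_eq_square)
  also have "\<dots> = h *\<^sub>R integral {s0..s1} (\<lambda>s. edge_flux B C \<phi> s u - edge_flux B C \<phi> s l)"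
    unfolding XY I using B by (simp add: vanish3_def)
  finally show "(LINT x|lebesgue. test_tensor s0 s1 l u B C x *v grad \<phi> x) =
       h *\<^sub>R integral {s0..s1} (\<lambda>s. edge_flux B C \<phi> s u - edge_flux B C \<phi> s l)" .
qed

lemma test_function_grad_outside:
  assumes "\<phi> \<in> test_functions \<Omega>" "x \<notin> \<Omega>"
  shows "grad \<phi> x = 0" "\<phi> x = 0"
proof -
  let ?C = "closure {x. \<phi> x \<noteq> 0}"
  have z: "\<phi> y = 0" if "y \<notin> ?C" for y using that closure_subset[of "{x. \<phi> x \<noteq> 0}"] by auto
  have x: "x \<notin> ?C" using assms by (auto simp: test_functions_def)
  then show "\<phi> x = 0" by (rule z)
  have "(\<phi> has_derivative (\<lambda>_. 0)) (at x)"
  proof (rule has_derivative_transform_within_open[OF has_derivative_const open_Compl[OF closed_closure]])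
    show "x \<in> - ?C" using x by simp
    show "0 = \<phi> y" if "y \<in> - ?C" for y using z[of y] that by simp
  qed
  then have "frechet_derivative \<phi> (at x) = (\<lambda>_. 0)"
    by (rule frechet_derivative_at[symmetric])
  then show "grad \<phi> x = 0" by (simp add: grad_def pd_def vec_eq_iff)
qed

text \<open>The flux through r = 0 vanishes for one of two reasons: the bump vanishes there together
  with its slope (element bumps), or the test function does because the segment lies outside
  \<Omega> (boundary bumps). In the second case the tensor has a nonzero normal trace on the
  boundary, which is admissible as \<open>Hdiv_Sym\<close> carries no boundary condition.\<close>

lemma weak_div_test_tensor:
  assumes op: "open \<Omega>" and le: "s0 \<le> s1" "0 \<le> d" and B: "vanish3 B s0" "vanish3 B s1" and C: "vanish3 C (- d)"
    and bd: "(poly C 0 = 0 \<and> poly (pderiv C) 0 = 0) \<or> (\<forall>s\<in>{s0..s1}. F s 0 \<notin> \<Omega>)"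
  shows "has_weak_div \<Omega> (test_tensor s0 s1 (- d) 0 B C) (\<lambda>_. 0)"
proof -
  have "(LINT x|lebesgue_on \<Omega>. test_tensor s0 s1 (- d) 0 B C x *v grad \<phi> x) = 0" if \<phi>: "\<phi> \<in> test_functions \<Omega>" for \<phi>
  proof -
    have sm: "smooth \<phi>" using \<phi> by (simp add: test_functions_def)
    have "edge_flux B C \<phi> s 0 = 0" "edge_flux B C \<phi> s (- d) = 0" if "s \<in> {s0..s1}" for s
      using bd C that test_function_grad_outside(2)[OF \<phi>] by (auto simp: edge_flux_def vanish3_def)
    then have "integral {s0..s1} (\<lambda>s. edge_flux B C \<phi> s 0 - edge_flux B C \<phi> s (- d)) = integral {s0..s1} (\<lambda>_. 0)"
      by (intro integral_cong) auto
    moreover have "indicator \<Omega> x *\<^sub>R (test_tensor s0 s1 (- d) 0 B C x *v grad \<phi> x) = test_tensor s0 s1 (- d) 0 B C x *v grad \<phi> x" for x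
      using test_function_grad_outside(1)[OF \<phi>, of x] by (cases "x \<in> \<Omega>") auto
    ultimately show ?thesis
      using test_tensor_grad(2)[OF sm, of s0 s1 "- d" 0 B C] le B op by (simp add: integral_lebesgue_on_eq)
  qed
  then show ?thesis by (simp add: has_weak_div_def)
qed

text \<open>The traction through r = 0 involves C and its first derivative only, so matching these
  two numbers suffices. The second derivative may jump, and with it the tt component, which weak
  divergence does not see.\<close>

lemma weak_div_test_tensor_pair:
  assumes op: "open \<Omega>" and le: "s0 \<le> s1" "0 \<le> d" and B: "vanish3 B s0" "vanish3 B s1" and C: "vanish3 C (- d)" "vanish3 C' d"
    and match: "poly C 0 = poly C' 0" "poly (pderiv C) 0 = poly (pderiv C') 0"
  shows "has_weak_div \<Omega> (\<lambda>x. test_tensor s0 s1 (- d) 0 B C x + test_tensor s0 s1 0 d B C' x) (\<lambda>_. 0)"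
proof -
  let ?t = "\<lambda>x. test_tensor s0 s1 (- d) 0 B C x + test_tensor s0 s1 0 d B C' x"
  have "(LINT x|lebesgue_on \<Omega>. ?t x *v grad \<phi> x) = 0" if \<phi>: "\<phi> \<in> test_functions \<Omega>" for \<phi>
  proof -
    have sm: "smooth \<phi>" using \<phi> by (simp add: test_functions_def)
    have cphi: "continuous_on A (\<lambda>s. \<phi> (F s r))" for A :: "real set" and r
      by (intro continuous_on_compose2[OF smooth_continuous_pd(1)[OF sm]] continuous_intros) auto
    have int: "(\<lambda>s. edge_flux B D \<phi> s r) integrable_on {s0..s1}" for D r
      unfolding edge_flux_def by (intro integrable_continuous_real continuous_intros cphi)
    have z: "edge_flux B C \<phi> s (- d) = 0" "edge_flux B C' \<phi> s d = 0" "edge_flux B C \<phi> s 0 = edge_flux B C' \<phi> s 0" for s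
      using C match by (auto simp: edge_flux_def vanish3_def)
    have "indicator \<Omega> x *\<^sub>R (?t x *v grad \<phi> x) = test_tensor s0 s1 (- d) 0 B C x *v grad \<phi> x + test_tensor s0 s1 0 d B C' x *v grad \<phi> x" for x
      using test_function_grad_outside(1)[OF \<phi>, of x] by (cases "x \<in> \<Omega>") (auto simp: matrix_vector_mult_add_rdistrib)
    then have "(LINT x|lebesgue_on \<Omega>. ?t x *v grad \<phi> x) = 
      (LINT x|lebesgue. test_tensor s0 s1 (- d) 0 B C x *v grad \<phi> x + test_tensor s0 s1 0 d B C' x *v grad \<phi> x)"
      using op by (simp add: integral_lebesgue_on_eq)
    also have "\<dots> = h *\<^sub>R integral {s0..s1} (\<lambda>s. edge_flux B C \<phi> s 0 - edge_flux B C \<phi> s (- d)) + h *\<^sub>R integral {s0..s1} (\<lambda>s. edge_flux B C' \<phi> s d - edge_flux B C' \<phi> s 0)"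
      using test_tensor_grad[OF sm, of s0 s1 "- d" 0 B C] test_tensor_grad[OF sm, of s0 s1 0 d B C'] le B by simp
    also have "\<dots> = 0"
      unfolding z by (simp add: int Henstock_Kurzweil_Integration.integral_neg)
    finally show ?thesis .
  qed
  then show ?thesis by (simp add: has_weak_div_def)
qed

end

section \<open>Residual identities\<close>

text \<open>The coefficients of \<open>\<partial>\<^sub>r\<^sub>r m\<^sub>t\<^sub>t - 2 \<partial>\<^sub>s\<^sub>r m\<^sub>t\<^sub>n + \<partial>\<^sub>s\<^sub>s m\<^sub>n\<^sub>n\<close> and of \<open>2 \<partial>\<^sub>s m\<^sub>t\<^sub>n - \<partial>\<^sub>r m\<^sub>t\<^sub>t\<close>, i.e. of the
  curl-curl residual and of minus the edge residual \<open>J\<^sub>e\<^sub>,\<^sub>2\<close>, in scaled frame coordinates.\<close>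

definition rho :: "nat \<Rightarrow> (nat \<Rightarrow> nat \<Rightarrow> real) \<Rightarrow> (nat \<Rightarrow> nat \<Rightarrow> real) \<Rightarrow> (nat \<Rightarrow> nat \<Rightarrow> real) \<Rightarrow> nat \<Rightarrow> nat \<Rightarrow> real" where
  "rho k c1 c2 c3 = (\<lambda>i j. dr k (dr k c1) i j - 2 * ds k (dr k c2) i j + ds k (ds k c3) i j)"

definition chi :: "nat \<Rightarrow> (nat \<Rightarrow> nat \<Rightarrow> real) \<Rightarrow> (nat \<Rightarrow> nat \<Rightarrow> real) \<Rightarrow> nat \<Rightarrow> nat \<Rightarrow> real" where
  "chi k c1 c2 = (\<lambda>i j. 2 * ds k c2 i j - dr k c1 i j)"

text \<open>The inner product of a symmetric matrix field with the Airy tensor, as in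
  \<open>inner_airy\<close>; c1, c2, c3 are the coefficients of its tt, tn and nn
  components.\<close>

definition residual :: "nat \<Rightarrow> (nat \<Rightarrow> nat \<Rightarrow> real) \<Rightarrow> (nat \<Rightarrow> nat \<Rightarrow> real) \<Rightarrow> (nat \<Rightarrow> nat \<Rightarrow> real) \<Rightarrow>
    real poly \<Rightarrow> real poly \<Rightarrow> real \<Rightarrow> real \<Rightarrow> real" where
  "residual k c1 c2 c3 B C s r = tpoly k c1 s r * (poly B s * poly (pderiv (pderiv C)) r)
     - 2 * tpoly k c2 s r * (poly (pderiv B) s * poly (pderiv C) r)
     + tpoly k c3 s r * (poly (pderiv (pderiv B)) s * poly C r)"

text \<open>All derivatives are moved from the bump to the matrix field in one application of the
  divergence theorem: the integrand is the interior residual times B C plus the divergence of an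
  explicit field, whose flux through the vertical sides vanishes by the zeros of B.\<close>

lemma integral_residual:
  assumes le: "s0 \<le> s1" "l \<le> u" and B: "vanish3 B s0" "vanish3 B s1"
  shows "integral (cbox (s0, l) (s1, u)) (\<lambda>p. residual k c1 c2 c3 B C (fst p) (snd p)) =
     integral (cbox (s0, l) (s1, u)) (\<lambda>p. tpoly k (rho k c1 c2 c3) (fst p) (snd p) * (poly B (fst p) * poly C (snd p))) +
     integral {s0..s1} (\<lambda>s. (tpoly k c1 s u * poly (pderiv C) u + tpoly k (chi k c1 c2) s u * poly C u) * poly B s
                          - (tpoly k c1 s l * poly (pderiv C) l + tpoly k (chi k c1 c2) s l * poly C l) * poly B s)"
proof -
  let ?J = "cbox (s0, l) (s1, u)"
  let ?B = "poly B" and ?B1 = "poly (pderiv B)" and ?B2 = "poly (pderiv (pderiv B))"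
  let ?C = "poly C" and ?C1 = "poly (pderiv C)" and ?C2 = "poly (pderiv (pderiv C))"
  let ?t = "tpoly k"
  \<comment> \<open>The mixed term is integrated by parts in s first and then in r. This is what
    puts 2 \<partial>s m_tn - \<partial>r m_tt, the array \<open>chi\<close>, in front of C in the
    horizontal trace \<open>Y\<close>.\<close>
  define X where "X = (\<lambda>s r. ?t c3 s r * (?B1 s * ?C r) - 2 * ?t c2 s r * (?B s * ?C1 r) - ?t (ds k c3) s r * (?B s * ?C r))"
  define Xs where "Xs = (\<lambda>s r. ?t (ds k c3) s r * (?B1 s * ?C r) + ?t c3 s r * (?B2 s * ?C r) - 2 * (?t (ds k c2) s r * (?B s * ?C1 r) + ?t c2 s r * (?B1 s * ?C1 r))
      - (?t (ds k (ds k c3)) s r * (?B s * ?C r) + ?t (ds k c3) s r * (?B1 s * ?C r)))"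
  define Y where "Y = (\<lambda>s r. (?t c1 s r * ?C1 r + ?t (chi k c1 c2) s r * ?C r) * ?B s)"
  define Yr where "Yr = (\<lambda>s r. (?t (dr k c1) s r * ?C1 r + ?t c1 s r * ?C2 r + (?t (dr k (chi k c1 c2)) s r * ?C r + ?t (chi k c1 c2) s r * ?C1 r)) * ?B s)"
  have ts: "((\<lambda>s. ?t c s r) has_real_derivative ?t (ds k c) s r) (at s within A)" and
    tr: "((\<lambda>r. ?t c s r) has_real_derivative ?t (dr k c) s r) (at r within A)" for c s r A
    unfolding has_real_derivative_iff_has_vector_derivative
    by (rule tpoly_has_vector_derivative_s tpoly_has_vector_derivative_r)+
  have ps: "((\<lambda>s. poly q s) has_real_derivative poly (pderiv q) s) (at s within A)" for q :: "real poly" and s A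
    by (rule has_field_derivative_at_within[OF poly_DERIV])
  have I: "integral ?J (\<lambda>p. Xs (fst p) (snd p) + Yr (fst p) (snd p)) = integral {l..u} (\<lambda>r. X s1 r - X s0 r) + integral {s0..s1} (\<lambda>s. Y s u - Y s l)"
  proof (rule integral_divergence_rectangle[OF le])
    show "((\<lambda>s. X s r) has_vector_derivative Xs s r) (at s within {s0..s1})" for s r
      unfolding X_def Xs_def has_real_derivative_iff_has_vector_derivative[symmetric]
      by (rule derivative_eq_intros ts ps refl)+ (simp add: algebra_simps)
    show "((\<lambda>r. Y s r) has_vector_derivative Yr s r) (at r within {l..u})" for s r
      unfolding Y_def Yr_def has_real_derivative_iff_has_vector_derivative[symmetric]
      by (rule derivative_eq_intros tr ps refl)+ (simp add: algebra_simps)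
    show "continuous_on ?J (\<lambda>p. Xs (fst p) (snd p))" "continuous_on ?J (\<lambda>p. Yr (fst p) (snd p))"
      unfolding Xs_def Yr_def by (intro continuous_intros)+
  qed
  have eq: "residual k c1 c2 c3 B C s r = ?t (rho k c1 c2 c3) s r * (?B s * ?C r) + (Xs s r + Yr s r)" for s r
  proof -
    have h1: "?t (rho k c1 c2 c3) s r = ?t (dr k (dr k c1)) s r - 2 * ?t (ds k (dr k c2)) s r + ?t (ds k (ds k c3)) s r"
      by (simp add: rho_def tpoly_add tpoly_diff tpoly_cmult)
    have h2: "?t (chi k c1 c2) s r = 2 * ?t (ds k c2) s r - ?t (dr k c1) s r"
      by (simp add: chi_def tpoly_diff tpoly_cmult)
    have h3: "?t (dr k (chi k c1 c2)) s r = 2 * ?t (ds k (dr k c2)) s r - ?t (dr k (dr k c1)) s r"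
      by (simp add: chi_def tpoly_diff tpoly_cmult dr_diff dr_cmult dr_ds)
    show ?thesis
      unfolding residual_def Xs_def Yr_def h1 h2 h3 by (simp add: algebra_simps)
  qed
  have "integral ?J (\<lambda>p. residual k c1 c2 c3 B C (fst p) (snd p)) = integral ?J (\<lambda>p. ?t (rho k c1 c2 c3) (fst p) (snd p) * (?B (fst p) * ?C (snd p))) +
     integral ?J (\<lambda>p. Xs (fst p) (snd p) + Yr (fst p) (snd p))"
    unfolding eq
  proof (rule Henstock_Kurzweil_Integration.integral_add)
    show "(\<lambda>p. ?t (rho k c1 c2 c3) (fst p) (snd p) * (?B (fst p) * ?C (snd p))) integrable_on ?J"
      by (intro integrable_continuous continuous_intros)
    show "(\<lambda>p. Xs (fst p) (snd p) + Yr (fst p) (snd p)) integrable_on ?J"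
      unfolding Xs_def Yr_def by (intro integrable_continuous continuous_intros)
  qed
  also have "integral ?J (\<lambda>p. Xs (fst p) (snd p) + Yr (fst p) (snd p)) = integral {s0..s1} (\<lambda>s. Y s u - Y s l)"
    unfolding I using B by (simp add: X_def vanish3_def)
  finally show ?thesis unfolding Y_def .
qed

lemma integral_trace_dual:
  assumes "\<And>a. a \<le> k \<Longrightarrow> integral {s0..s1} (\<lambda>s. s ^ a * poly B s) = (if a = i then 1 else 0)" "i \<le> k"
  shows "integral {s0..s1} (\<lambda>s. tpoly k c s 0 * poly B s) = c i 0"
proof -
  have "integral {s0..s1} (\<lambda>s. tpoly k c s 0 * poly B s) = integral {s0..s1} (\<lambda>s. \<Sum>a\<le>k. c a 0 * (s ^ a * poly B s))"
    by (simp add: tpoly_0 sum_distrib_right mult.assoc)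
  also have "\<dots> = (\<Sum>a\<le>k. c a 0 * integral {s0..s1} (\<lambda>s. s ^ a * poly B s))"
    by (subst integral_sum) (auto intro!: integrable_poly_intro continuous_intros)
  also have "\<dots> = (\<Sum>a\<le>k. if a = i then c a 0 else 0)"
    by (intro sum.cong) (auto simp: assms(1))
  finally show ?thesis using assms(2) by simp
qed

text \<open>The triple zeros of C at both ends remove the traces, and duality in both variables
  picks one coefficient of the curl-curl residual.\<close>

lemma residual_element:
  assumes "s0 \<le> s1" "l \<le> u" "vanish3 B s0" "vanish3 B s1" "vanish3 C l" "vanish3 C u" "i \<le> k" "j \<le> k"
    and B: "\<And>a. a \<le> k \<Longrightarrow> integral {s0..s1} (\<lambda>s. s ^ a * poly B s) = (if a = i then 1 else 0)"
    and C: "\<And>a. a \<le> k \<Longrightarrow> integral {l..u} (\<lambda>s. s ^ a * poly C s) = (if a = j then 1 else 0)"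
  shows "integral (cbox (s0, l) (s1, u)) (\<lambda>p. residual k c1 c2 c3 B C (fst p) (snd p)) = rho k c1 c2 c3 i j"
proof -
  have "(\<Sum>a\<le>k. \<Sum>b\<le>k. c a b * ((if a = i then 1 else 0) * (if b = j then 1 else 0))) = c i j" for c :: "nat \<Rightarrow> nat \<Rightarrow> real"
  proof -
    have "(\<Sum>b\<le>k. c a b * (y * (if b = j then 1 else 0))) = c a j * y" for a y
      by (subst sum.remove[of _ j]) (use assms in \<open>auto intro!: sum.neutral\<close>)
    moreover have "(\<Sum>a\<le>k. c a j * (if a = i then 1 else 0)) = c i j"
      by (subst sum.remove[of _ i]) (use assms in \<open>auto intro!: sum.neutral\<close>)
    ultimately show ?thesis by simp
  qed
  then have "integral (cbox (s0, l) (s1, u)) (\<lambda>p. tpoly k (rho k c1 c2 c3) (fst p) (snd p) * (poly B (fst p) * poly C (snd p))) = rho k c1 c2 c3 i j"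
    unfolding integral_tpoly_product by (subst sum.cong[OF refl sum.cong[OF refl]]) (simp_all only: B C atMost_iff)
  then show ?thesis
    using integral_residual[OF assms(1-4), of k c1 c2 c3 C] assms(5,6) by (simp add: vanish3_def)
qed

text \<open>Orthogonality of C to the monomials removes the interior residual. What remains at r = 0
  is one coefficient of the tt trace times the slope of C plus one coefficient of the
  \<open>chi\<close> trace times its value; the sign depends on the side from which the edge is
  approached.\<close>

lemma residual_edge:
  assumes "s0 \<le> s1" "l \<le> u" "vanish3 B s0" "vanish3 B s1" "i \<le> k"
    and B: "\<And>a. a \<le> k \<Longrightarrow> integral {s0..s1} (\<lambda>s. s ^ a * poly B s) = (if a = i then 1 else 0)"
    and C: "\<And>j. j \<le> k \<Longrightarrow> integral {l..u} (\<lambda>r. r ^ j * poly C r) = 0"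
  shows "u = 0 \<Longrightarrow> vanish3 C l \<Longrightarrow> integral (cbox (s0, l) (s1, u)) (\<lambda>p. residual k c1 c2 c3 B C (fst p) (snd p)) =
       c1 i 0 * poly (pderiv C) 0 + chi k c1 c2 i 0 * poly C 0" (is "_ \<Longrightarrow> _ \<Longrightarrow> ?I = ?E")
    and "l = 0 \<Longrightarrow> vanish3 C u \<Longrightarrow> integral (cbox (s0, l) (s1, u)) (\<lambda>p. residual k c1 c2 c3 B C (fst p) (snd p)) =
       - (c1 i 0 * poly (pderiv C) 0 + chi k c1 c2 i 0 * poly C 0)"
proof -
  have 0: "integral (cbox (s0, l) (s1, u)) (\<lambda>p. tpoly k (rho k c1 c2 c3) (fst p) (snd p) * (poly B (fst p) * poly C (snd p))) = 0"
    unfolding integral_tpoly_product by (intro sum.neutral ballI) (simp add: C)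
  have E: "integral {s0..s1} (\<lambda>s. (tpoly k c1 s 0 * poly (pderiv C) 0 + tpoly k (chi k c1 c2) s 0 * poly C 0) * poly B s) = ?E"
  proof -
    have "integral {s0..s1} (\<lambda>s. (tpoly k c1 s 0 * poly (pderiv C) 0 + tpoly k (chi k c1 c2) s 0 * poly C 0) * poly B s) =
       integral {s0..s1} (\<lambda>s. (tpoly k c1 s 0 * poly B s) * poly (pderiv C) 0 + (tpoly k (chi k c1 c2) s 0 * poly B s) * poly C 0)"
      by (simp add: algebra_simps)
    also have "\<dots> = integral {s0..s1} (\<lambda>s. (tpoly k c1 s 0 * poly B s)) * poly (pderiv C) 0 + integral {s0..s1} (\<lambda>s. (tpoly k (chi k c1 c2) s 0 * poly B s)) * poly C 0"
      by (subst Henstock_Kurzweil_Integration.integral_add) (auto intro!: integrable_poly_intro continuous_intros)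
    finally show ?thesis
      using assms(5) by (simp add: integral_trace_dual[OF B])
  qed
  show "u = 0 \<Longrightarrow> vanish3 C l \<Longrightarrow> ?I = ?E"
    using integral_residual[OF assms(1-4), of k c1 c2 c3 C] 0 E by (simp add: vanish3_def)
  show "l = 0 \<Longrightarrow> vanish3 C u \<Longrightarrow> ?I = - ?E"
    using integral_residual[OF assms(1-4), of k c1 c2 c3 C] 0 E by (simp add: vanish3_def Henstock_Kurzweil_Integration.integral_neg)
qed

section \<open>Triangles\<close>

text \<open>A triangle with one edge from a to F 1 0 and the third vertex w at negative height, so
  that \<nu> is its outward normal on that edge and h the length of the edge.\<close>

locale triangle_frame = frame +
  fixes w :: "real^2"
  assumes R_w: "R w < 0"
begin

definition K :: "(real^2) set" where "K = convex hull {a, F 1 0, w}"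
definition e :: "(real^2) set" where "e = closed_segment a (F 1 0)"

lemma a_eq: "a = F 0 0" by (simp add: fr_def)

lemma F_affine: "u + v + z = 1 \<Longrightarrow> u *\<^sub>R F s1 r1 + v *\<^sub>R F s2 r2 + z *\<^sub>R F s3 r3 =
    F (u * s1 + v * s2 + z * s3) (u * r1 + v * r2 + z * r3)"
proof -
  assume uvz: "u + v + z = 1"
  have "u *\<^sub>R a + v *\<^sub>R a + z *\<^sub>R a = a"
    unfolding scaleR_left_distrib[symmetric] uvz by simp
  then show ?thesis
    by (simp add: fr_def algebra_simps)
qed

lemma K_iff: "F s r \<in> K \<longleftrightarrow> (\<exists>v z. 0 \<le> v \<and> 0 \<le> z \<and> v + z \<le> 1 \<and> s = v + z * S w \<and> r = z * R w)"
proof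
  assume "F s r \<in> K"
  then obtain u v z where uvz: "0 \<le> u" "0 \<le> v" "0 \<le> z" "u + v + z = 1" "F s r = u *\<^sub>R a + v *\<^sub>R F 1 0 + z *\<^sub>R w"
    unfolding K_def convex_hull_3 by auto
  have "F s r = u *\<^sub>R F 0 0 + v *\<^sub>R F 1 0 + z *\<^sub>R F (S w) (R w)" using uvz(5) a_eq by simp
  also have "\<dots> = F (v + z * S w) (z * R w)" using F_affine[OF uvz(4), of 0 0 1 0 "S w" "R w"] by simp
  finally have eq: "F s r = F (v + z * S w) (z * R w)" .
  have "s = v + z * S w" "r = z * R w"
    using arg_cong[OF eq, of S] arg_cong[OF eq, of R] by simp_all
  then have "0 \<le> v \<and> 0 \<le> z \<and> v + z \<le> 1 \<and> s = v + z * S w \<and> r = z * R w"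
    using uvz(1-4) by auto
  then show "\<exists>v z. 0 \<le> v \<and> 0 \<le> z \<and> v + z \<le> 1 \<and> s = v + z * S w \<and> r = z * R w"
    by blast
next
  assume "\<exists>v z. 0 \<le> v \<and> 0 \<le> z \<and> v + z \<le> 1 \<and> s = v + z * S w \<and> r = z * R w"
  then obtain v z where vz: "0 \<le> v" "0 \<le> z" "v + z \<le> 1" "s = v + z * S w" "r = z * R w" by blast
  have "F s r = (1 - v - z) *\<^sub>R a + v *\<^sub>R F 1 0 + z *\<^sub>R w"
    using F_affine[of "1 - v - z" v z 0 0 1 0 "S w" "R w"] vz a_eq by simp
  moreover have "0 \<le> 1 - v - z" "1 - v - z + v + z = 1" using vz by auto
  ultimately show "F s r \<in> K" 
    unfolding K_def convex_hull_3 using vz(1,2) by blast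
qed

lemma in_K_iff: "x \<in> K \<longleftrightarrow> (\<exists>v z. 0 \<le> v \<and> 0 \<le> z \<and> v + z \<le> 1 \<and> S x = v + z * S w \<and> R x = z * R w)"
  using K_iff[of "S x" "R x"] by simp

lemma e_iff: "x \<in> e \<longleftrightarrow> (0 \<le> S x \<and> S x \<le> 1 \<and> R x = 0)"
proof -
  have lin: "(1 - u) *\<^sub>R a + u *\<^sub>R F 1 0 = F u 0" for u
    by (simp add: fr_def algebra_simps)
  show ?thesis
  proof
    assume "x \<in> e"
    then show "0 \<le> S x \<and> S x \<le> 1 \<and> R x = 0"
      unfolding e_def in_segment lin by auto
  next
    assume "0 \<le> S x \<and> S x \<le> 1 \<and> R x = 0"
    then show "x \<in> e"
      unfolding e_def in_segment lin by (intro conjI exI[of _ "S x"]) (use F_S_R[of x] in auto)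
  qed
qed

lemma R_nonpos: "x \<in> K \<Longrightarrow> R x \<le> 0"
  using R_w by (auto simp: in_K_iff mult_nonneg_nonpos)

lemma vertices: "a \<in> K" "F 1 0 \<in> K" "w \<in> K"
  unfolding K_def by (simp_all add: hull_inc)

lemma bounded_K: "bounded K" and compact_K: "compact K" and convex_K: "convex K"
  unfolding K_def by (simp_all add: compact_convex_hull finite_imp_compact finite_imp_bounded_convex_hull compact_imp_bounded)

lemma norm_F: "norm (F s r - F s' r') = h * norm (vector [s - s', r - r'] :: real^2)"
proof -
  have "F s r - F s' r' = h *\<^sub>R ((s - s') *\<^sub>R tau + (r - r') *\<^sub>R \<nu>)"
    by (simp add: fr_def algebra_simps)
  moreover have "((s - s') *\<^sub>R tau + (r - r') *\<^sub>R \<nu>) \<bullet> ((s - s') *\<^sub>R tau + (r - r') *\<^sub>R \<nu>) =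
      (vector [s - s', r - r'] :: real^2) \<bullet> vector [s - s', r - r']"
  proof -
    have "(vector [s - s', r - r'] :: real^2) \<bullet> vector [s - s', r - r'] = (s - s') * (s - s') + (r - r') * (r - r')"
      by (simp add: inner_vec2)
    then show ?thesis by (simp add: inner_add_left inner_add_right)
  qed
  then have "norm ((s - s') *\<^sub>R tau + (r - r') *\<^sub>R \<nu>) = norm (vector [s - s', r - r'] :: real^2)"
    by (simp only: norm_eq_sqrt_inner)
  ultimately show ?thesis using h_pos by simp
qed

lemma dist_a_b: "dist a (F 1 0) = h"
proof -
  have "norm (vector [1 - 0, 0 - 0] :: real^2) = 1"
    by (simp add: norm_eq_sqrt_inner inner_vec2)
  then have "norm (F 1 0 - F 0 0) = h" using norm_F[of 1 0 0 0] by simp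
  then show ?thesis using a_eq by (simp add: dist_norm norm_minus_commute)
qed

lemma diameter_e: "diameter e = h"
proof (rule antisym)
  show "diameter e \<le> h"
  proof (rule diameter_le)
    fix x y assume "x \<in> e" "y \<in> e"
    then have x: "x = F (S x) 0" "0 \<le> S x" "S x \<le> 1" and y: "y = F (S y) 0" "0 \<le> S y" "S y \<le> 1"
      using F_S_R[of x] F_S_R[of y] unfolding e_iff by auto
    have "norm (x - y) = norm (F (S x) 0 - F (S y) 0)" using x(1) y(1) by simp
    also have "\<dots> = h * \<bar>S x - S y\<bar>"
      unfolding norm_F by (simp add: norm_eq_sqrt_inner inner_vec2)
    also have "\<dots> \<le> h * 1" using x y h_pos by (intro mult_left_mono) auto
    finally show "norm (x - y) \<le> h" by simp
  qed (simp add: e_def)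
  show "h \<le> diameter e"
    using diameter_bounded_bound[OF compact_imp_bounded[OF compact_segment], of a a "F 1 0" "F 1 0"] dist_a_b by (simp add: e_def)
qed

lemma h_le_diameter: "h \<le> diameter K"
  using diameter_bounded_bound[OF bounded_K vertices(1,2)] dist_a_b by simp

lemma coord_le_diameter:
  assumes "x \<in> K"
  shows "\<bar>S x\<bar> \<le> diameter K / h" "\<bar>R x\<bar> \<le> diameter K / h"
proof -
  have n: "norm (x - a) \<le> diameter K"
    using diameter_bounded_bound[OF bounded_K assms vertices(1)] by (simp add: dist_norm)
  have "norm tau = 1" using inner_frame(2) by (simp add: norm_eq_sqrt_inner)
  then have "\<bar>(x - a) \<bullet> tau\<bar> \<le> diameter K" "\<bar>(x - a) \<bullet> \<nu>\<bar> \<le> diameter K"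
    using n Cauchy_Schwarz_ineq2[of "x - a" tau] Cauchy_Schwarz_ineq2[of "x - a" \<nu>] norm_nu by auto
  then show "\<bar>S x\<bar> \<le> diameter K / h" "\<bar>R x\<bar> \<le> diameter K / h"
    using h_pos by (auto simp: cs_def cr_def divide_right_mono)
qed

text \<open>Compare the extreme points of the ball in the directions \<nu> and \<open>perp\<close>
  \<nu> with the height of the triangle and with its chord parallel to the edge. Thus the inball
  diameter bounds from below both the length of each edge and the height over it.\<close>

lemma ball_radius_le:
  assumes r: "0 \<le> r" and sub: "cball x r \<subseteq> K"
  shows "2 * r \<le> h" "2 * r \<le> h * (- R w)"
proof -
  have nt: "norm tau = 1" using inner_frame(2) by (simp add: norm_eq_sqrt_inner)
  have in_K: "x + r *\<^sub>R \<nu> \<in> K" "x - r *\<^sub>R \<nu> \<in> K" "x + r *\<^sub>R tau \<in> K" "x - r *\<^sub>R tau \<in> K"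
    using sub r norm_nu nt by (auto simp: dist_norm subset_iff)
  have SR: "R (x + r *\<^sub>R \<nu>) = R x + r / h" "R (x - r *\<^sub>R \<nu>) = R x - r / h" 
     "S (x + r *\<^sub>R tau) = S x + r / h" "S (x - r *\<^sub>R tau) = S x - r / h"
     "R (x + r *\<^sub>R tau) = R x" "R (x - r *\<^sub>R tau) = R x"
    using h_pos by (simp_all add: cs_def cr_def inner_add_left inner_diff_left add_divide_distrib diff_divide_distrib)
  have "R y \<ge> R w" if y: "y \<in> K" for y
  proof -
    obtain v z where vz: "0 \<le> v" "0 \<le> z" "v + z \<le> 1" "R y = z * R w" using y unfolding in_K_iff by blast
    then show ?thesis using R_w mult_right_mono_neg[of z 1 "R w"] by simp
  qed
  from this[OF in_K(2)] R_nonpos[OF in_K(1)] have "2 * (r / h) \<le> - R w" unfolding SR by linarith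
  then show "2 * r \<le> h * (- R w)" using h_pos by (simp add: field_simps)
  obtain v z where 1: "0 \<le> v" "0 \<le> z" "v + z \<le> 1" "S x + r / h = v + z * S w" "R x = z * R w"
    using in_K(3) SR by (auto simp: in_K_iff)
  obtain v' z' where 2: "0 \<le> v'" "0 \<le> z'" "v' + z' \<le> 1" "S x - r / h = v' + z' * S w" "R x = z' * R w"
    using in_K(4) SR by (auto simp: in_K_iff)
  \<comment> \<open>The two horizontal extreme points have the same height, hence the same
    barycentric weight at w, and their S-coordinates differ only by the weight of F 1 0, which lies
    between 0 and 1.\<close>
  have "z = z'" using 1(5) 2(5) R_w by simp
  then have "z' * S w = z * S w" by simp
  then have "2 * (r / h) \<le> 1" using 1 2 by linarith
  then show "2 * r \<le> h" using h_pos by (simp add: field_simps)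
qed

lemma inball_diameter_le: "inball_diameter K \<le> h" "inball_diameter K \<le> h * (- R w)"
proof -
  have ne: "{2 * r |r. 0 \<le> r \<and> (\<exists>x. cball x r \<subseteq> K)} \<noteq> {}"
  proof -
    have "0 \<in> {2 * r |r. 0 \<le> r \<and> (\<exists>x. cball x r \<subseteq> K)}"
      using vertices(1) by (intro CollectI exI[of _ 0]) (auto intro!: exI[of _ a])
    then show ?thesis by blast
  qed
  show "inball_diameter K \<le> h"
    unfolding inball_diameter_def by (rule cSup_least[OF ne]) (use ball_radius_le(1) in blast)
  show "inball_diameter K \<le> h * (- R w)"
    unfolding inball_diameter_def by (rule cSup_least[OF ne]) (use ball_radius_le(2) in blast)
qed

lemma shape_regular_bounds:
  assumes sr: "diameter K \<le> \<kappa> * inball_diameter K" and \<kappa>: "1 \<le> \<kappa>"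
  shows "diameter K \<le> \<kappa> * h" "1 / \<kappa> \<le> - R w" "\<And>x. x \<in> K \<Longrightarrow> \<bar>S x\<bar> \<le> \<kappa>" "\<And>x. x \<in> K \<Longrightarrow> \<bar>R x\<bar> \<le> \<kappa>"
proof -
  show d: "diameter K \<le> \<kappa> * h"
    using sr mult_left_mono[OF inball_diameter_le(1), of \<kappa>] \<kappa> by linarith
  have "h \<le> \<kappa> * (h * (- R w))"
    using h_le_diameter sr mult_left_mono[OF inball_diameter_le(2), of \<kappa>] \<kappa> by linarith
  then have "h * 1 \<le> h * (\<kappa> * (- R w))" by (simp add: mult_ac)
  then have "1 \<le> \<kappa> * (- R w)" using h_pos mult_le_cancel_left_pos by blast
  then show "1 / \<kappa> \<le> - R w" using \<kappa> by (simp add: field_simps)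
  have "diameter K / h \<le> \<kappa>" using d h_pos by (simp add: field_simps)
  then show "\<bar>S x\<bar> \<le> \<kappa>" "\<bar>R x\<bar> \<le> \<kappa>" if "x \<in> K" for x
    using coord_le_diameter[OF that] by linarith+
qed

text \<open>At depth at most 1 / (4 \<kappa> (1 + \<kappa>)) the barycentric weight z of w is at
  most 1 / (4 (1 + \<kappa>)), because the scaled height is at least 1 / \<kappa>. As S w is bounded
  by \<kappa>, the horizontal shift plus z is at most 1/4, which the distance of [1/4, 3/4] from the
  ends of [0, 1] absorbs.\<close>

lemma rect_subset_K:
  assumes sr: "diameter K \<le> \<kappa> * inball_diameter K" and \<kappa>: "1 \<le> \<kappa>"
  shows "rect (1/4) (3/4) (- (1 / (4 * \<kappa> * (1 + \<kappa>)))) 0 \<subseteq> K"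
proof
  fix x assume "x \<in> rect (1/4) (3/4) (- (1 / (4 * \<kappa> * (1 + \<kappa>)))) 0"
  then have x: "1/4 \<le> S x" "S x \<le> 3/4" "- (1 / (4 * \<kappa> * (1 + \<kappa>))) \<le> R x" "R x \<le> 0" by (auto simp: rect_def)
  note b = shape_regular_bounds[OF assms]
  define z where "z = R x / R w"
  have z0: "0 \<le> z" using x R_w by (simp add: z_def divide_nonpos_neg)
  have "z = - R x * (1 / (- R w))" using R_w by (simp add: z_def)
  also have "\<dots> \<le> (1 / (4 * \<kappa> * (1 + \<kappa>))) * \<kappa>"
  proof (intro mult_mono)
    show "1 / - R w \<le> \<kappa>" using b(2) \<kappa> R_w by (simp add: field_simps)
  qed (use x R_w \<kappa> in \<open>auto simp: divide_nonneg_neg\<close>)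
  also have "\<dots> = 1 / (4 * (1 + \<kappa>))"
  proof -
    have "4 * \<kappa> * (1 + \<kappa>) = \<kappa> * (4 * (1 + \<kappa>))" by simp
    then show ?thesis using \<kappa> by (simp only: times_divide_eq_left) simp
  qed
  finally have z1: "z * (1 + \<kappa>) \<le> 1/4" using \<kappa> by (simp add: field_simps)
  have Sw: "\<bar>S w\<bar> \<le> \<kappa>" using b(3) vertices(3) by blast
  have "\<bar>z * S w\<bar> \<le> z * \<kappa>" using z0 Sw by (simp add: abs_mult mult_left_mono)
  then have zz: "\<bar>z * S w\<bar> + z \<le> 1/4" using z1 by (simp add: algebra_simps)
  have "0 \<le> S x - z * S w" "(S x - z * S w) + z \<le> 1"
    using zz z0 x(1,2) by linarith+
  moreover have "S x = (S x - z * S w) + z * S w" "R x = z * R w" using R_w by (simp_all add: z_def)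
  ultimately show "x \<in> K"
    unfolding in_K_iff using z0 by blast
qed

text \<open>The conditions in the \<open>THE\<close> description have a unique solution:
  orthogonality to the edge leaves the multiples of \<nu>, the norm leaves two of them, and the
  vertex w excludes the wrong sign.\<close>

lemma outward_normal_eq: "outward_normal K e = \<nu>"
  unfolding outward_normal_def
proof (rule the_equality)
  have ab: "a \<in> e" "F 1 0 \<in> e" by (simp_all add: e_def)
  have R: "R x = ((x - a) \<bullet> \<nu>) / h" for x by (simp add: cr_def)
  have 1: "\<nu> \<bullet> (y - x) = h * (R y - R x)" for x y
    using h_pos by (simp add: R inner_diff_left diff_divide_distrib[symmetric] inner_diff_right inner_commute)
  show "norm \<nu> = 1 \<and> (\<forall>x\<in>e. \<forall>y\<in>e. \<nu> \<bullet> (y - x) = 0) \<and> (\<forall>x\<in>e. \<forall>y\<in>K. \<nu> \<bullet> (y - x) \<le> 0)"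
    unfolding 1 using norm_nu R_nonpos h_pos by (auto simp: e_iff mult_nonneg_nonpos)
  fix n assume n: "norm n = 1 \<and> (\<forall>x\<in>e. \<forall>y\<in>e. n \<bullet> (y - x) = 0) \<and> (\<forall>x\<in>e. \<forall>y\<in>K. n \<bullet> (y - x) \<le> 0)"
  have "n \<bullet> (F 1 0 - a) = 0" using n ab by blast
  then have nt: "n \<bullet> tau = 0" using h_pos by (simp add: fr_def)
  then have neq: "n = (n \<bullet> \<nu>) *\<^sub>R \<nu>" using frame_decomp[of n] by simp
  have "n \<bullet> (w - a) \<le> 0" using n ab vertices by blast
  moreover have "n \<bullet> (w - a) = (n \<bullet> \<nu>) * (h * R w)"
    by (subst neq) (use h_pos in \<open>simp add: R inner_commute\<close>)
  ultimately have "0 \<le> n \<bullet> \<nu>" 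
    using R_w h_pos by (simp add: mult_le_0_iff zero_le_mult_iff) 
  moreover have "\<bar>n \<bullet> \<nu>\<bar> = 1" using neq n norm_nu by (metis mult.right_neutral norm_scaleR)
  ultimately show "n = \<nu>" using neq by simp
qed

text \<open>The end points in \<open>edge_norm_sq\<close> are chosen by \<open>SOME\<close>, but a
  segment determines them up to order, and the integral is invariant under reversing the
  parameter.\<close>

lemma edge_norm_sq_eq: "edge_norm_sq e g = h * integral {0..1} (\<lambda>s. (g (F s 0))\<^sup>2)"
proof -
  define ab where "ab = (SOME (a', b'). e = closed_segment a' b')"
  obtain a' b' where ab': "ab = (a', b')" by (cases ab)
  have "case ab of (a', b') \<Rightarrow> e = closed_segment a' b'"
    unfolding ab_def by (rule someI[of _ "(a, F 1 0)"]) (simp add: e_def)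
  then have "{a', b'} = {a, F 1 0}" unfolding ab' e_def by auto
  then have cases: "a' = a \<and> b' = F 1 0 \<or> a' = F 1 0 \<and> b' = a" by (auto simp: doubleton_eq_iff)
  have l: "linepath a (F 1 0) s = F s 0" "linepath (F 1 0) a s = F (1 - s) 0" for s
    by (simp_all add: linepath_def fr_def algebra_simps)
  have refl: "integral {0..1} (\<lambda>s. f (1 - s)) = integral {0..1} f" for f :: "real \<Rightarrow> real"
    using Henstock_Kurzweil_Integration.integral_reflect_real[of 0 "-1" "\<lambda>x. f (1 + x)"] integral_shift_Icc_real[of "-1" 0 f 1] by (simp add: o_def)
  have "edge_norm_sq e g = dist a' b' * integral {0..1} (\<lambda>s. (g (linepath a' b' s))\<^sup>2)"
    unfolding edge_norm_sq_def ab_def[symmetric] ab' by simp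
  also have "\<dots> = h * integral {0..1} (\<lambda>s. (g (F s 0))\<^sup>2)"
    using cases dist_a_b refl[of "\<lambda>s. (g (F s 0))\<^sup>2"] by (auto simp: l dist_commute)
  finally show ?thesis .
qed

end

text \<open>The only freedom is the order of the two end points, and exchanging them flips the
  normal; one of the two orders puts the third vertex on the negative side.\<close>

lemma triangle_frame_of_edge:
  fixes K e :: "(real^2) set"
  assumes "2 simplex K" "e edge_of K"
  obtains a \<nu> h w where "triangle_frame a \<nu> h w" "K = triangle_frame.K a \<nu> h w" "e = triangle_frame.e a \<nu> h"
proof -
  note goal = that
  obtain C where C: "\<not> affine_dependent C" "card C = 3" "K = convex hull C"
    using assms(1) by (auto simp: simplex_def)
  obtain c where c: "c \<subseteq> C" "e = convex hull c"
    using assms(2) C face_of_convex_hull_affine_independent[OF C(1)] by (auto simp: edge_of_def)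
  have "\<not> affine_dependent c" using C(1) c(1) affine_dependent_subset by blast
  then have "card c = 2"
    using assms(2) c aff_dim_affine_independent[of c] by (simp add: edge_of_def aff_dim_convex_hull)
  then obtain p q where pq: "c = {p, q}" "p \<noteq> q" by (meson card_2_iff)
  have "card (C - c) = 1" using C(2) \<open>card c = 2\<close> c(1) pq by (simp add: card_Diff_subset)
  then obtain w where w: "C - c = {w}" by (meson card_1_singletonE)
  then have Cw: "C = {p, q, w}" "w \<noteq> p" "w \<noteq> q" using c(1) pq by auto
  have main: thesis if K: "K = convex hull {p, q, w}" and e: "e = closed_segment p q" and pq: "p \<noteq> q"
     and lt: "(w - p) \<bullet> vector [(q - p) $ 2, - ((q - p) $ 1)] < 0" for p q
  proof -
    define h where "h = norm (q - p)"
    define \<nu> :: "real^2" where "\<nu> = vector [(q - p) $ 2 / h, - ((q - p) $ 1) / h]"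
    have h: "0 < h" using pq by (simp add: h_def)
    have hh: "(q - p) $ 1 * (q - p) $ 1 + (q - p) $ 2 * (q - p) $ 2 = h * h"
      using dot_square_norm[of "q - p"] by (simp add: h_def inner_vec2 power2_eq_square)
    have "\<nu> \<bullet> \<nu> = ((q - p) $ 1 * (q - p) $ 1 + (q - p) $ 2 * (q - p) $ 2) / (h * h)"
      by (simp add: inner_vec2 \<nu>_def add_divide_distrib) (simp add: algebra_simps)
    then have "norm \<nu> = 1" unfolding hh using h by (simp add: norm_eq_sqrt_inner)
    then interpret frame p \<nu> h using h by unfold_locales
    have q: "F 1 0 = q"
      using h by (simp add: fr_def vec2_eq_iff \<nu>_def)
    have "R w = ((w - p) \<bullet> vector [(q - p) $ 2, - ((q - p) $ 1)]) / (h * h)"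
      using h by (simp add: cr_def inner_vec2 \<nu>_def field_simps)
    then have "R w < 0" using lt h by (simp add: divide_neg_pos)
    then interpret triangle_frame p \<nu> h w by unfold_locales
    show thesis
      by (rule goal[of p \<nu> h w]) (use triangle_frame_axioms in \<open>auto simp: K_def e_def q K e\<close>)
  qed
  let ?n = "vector [(q - p) $ 2, - ((q - p) $ 1)] :: real^2"
  \<comment> \<open>Otherwise w would lie on the line through p and q, against the affine
    independence of the three vertices.\<close>
  have "(w - p) \<bullet> ?n \<noteq> 0"
  proof
    assume z: "(w - p) \<bullet> ?n = 0"
    define l where "l = ((w - p) \<bullet> (q - p)) / ((q - p) \<bullet> (q - p))"
    have d0: "(q - p) \<bullet> (q - p) \<noteq> 0" using pq by simp
    have z': "(w $ 1 - p $ 1) * (q $ 2 - p $ 2) = (w $ 2 - p $ 2) * (q $ 1 - p $ 1)" using z by (simp add: inner_vec2 algebra_simps)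
    have alg: "(c * c + d * d) * x = (x * c + y * d) * c" "(c * c + d * d) * y = (x * c + y * d) * d" if "x * d = y * c" for x y c d :: real
      using that by algebra+
    have "((q - p) \<bullet> (q - p)) * (w - p) $ i = ((w - p) \<bullet> (q - p)) * (q - p) $ i" for i
      using exhaust_2[of i] alg[OF z'] by (auto simp: inner_vec2)
    then have "(w - p) $ i = l * (q - p) $ i" for i
      using d0 by (simp add: l_def field_simps)
    then have "w - p = l *\<^sub>R (q - p)" by (simp add: vec_eq_iff)
    then have "w = (1 - l) *\<^sub>R p + l *\<^sub>R q" by (simp add: algebra_simps)
    then have "w \<in> affine hull {p, q}" unfolding affine_hull_2 using diff_add_cancel[of 1 l] by blast
    moreover have "C - {w} = {p, q}" using Cw by auto
    ultimately have "affine_dependent C" unfolding affine_dependent_def using Cw by auto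
    then show False using C by simp
  qed
  then consider "(w - p) \<bullet> ?n < 0" | "(w - p) \<bullet> ?n > 0" by linarith
  then show thesis
  proof cases
    case 1
    show thesis by (rule main[of p q]) (use 1 pq c C Cw in \<open>auto simp: segment_convex_hull\<close>)
  next
    case 2
    have "(w - q) \<bullet> vector [(p - q) $ 2, - ((p - q) $ 1)] = - ((w - p) \<bullet> ?n)"
      by (simp add: inner_vec2 algebra_simps)
    then show thesis 
      by (intro main[of q p]) (use 2 pq c C Cw in \<open>auto simp: segment_convex_hull insert_commute\<close>)
  qed
qed

lemma finite_edges: 
  fixes K :: "(real^2) set"
  assumes "2 simplex K" shows "finite {e. e edge_of K}" "card {e. e edge_of K} \<le> 8" "\<exists>e. e edge_of K"
proof -
  obtain C where C: "\<not> affine_dependent C" "card C = 3" "K = convex hull C"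
    using assms(1) by (auto simp: simplex_def)
  have fin: "finite C" using C(2) card_ge_0_finite[of C] by simp
  have sub: "{e. e edge_of K} \<subseteq> (\<lambda>c. convex hull c) ` Pow C"
    using C face_of_convex_hull_affine_independent[OF C(1)] by (auto simp: edge_of_def)
  then show "finite {e. e edge_of K}" using fin finite_subset by blast
  \<comment> \<open>The crude count by all subsets of three vertices is the source of the factor 8
    in the final constant.\<close>
  have "card {e. e edge_of K} \<le> card (Pow C)"
    using sub fin by (meson card_image_le card_mono finite_Pow_iff finite_imageI le_trans)
  then show "card {e. e edge_of K} \<le> 8" using fin C(2) by (simp add: card_Pow)
  obtain c where c: "c \<subseteq> C" "card c = 2" using C(2) obtain_subset_with_card_n[of 2 C] by auto
  have "\<not> affine_dependent c" using C(1) c(1) affine_dependent_subset by blast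
  then have "(convex hull c) edge_of K"
    using c C face_of_convex_hull_affine_independent[OF C(1)] aff_dim_affine_independent[of c]
    by (auto simp: edge_of_def aff_dim_convex_hull)
  then show "\<exists>e. e edge_of K" by blast
qed

section \<open>Meshes\<close>

lemma simplex_2_facts:
  fixes K :: "(real^2) set"
  assumes "2 simplex K" 
  shows "convex K" "compact K" "K \<in> sets lebesgue" "bounded K" "aff_dim K = 2"
proof -
  obtain C where C: "\<not> affine_dependent C" "card C = 3" "K = convex hull C"
    using assms(1) by (auto simp: simplex_def)
  have fin: "finite C" using C(2) card_ge_0_finite[of C] by simp
  show "convex K" "compact K" "bounded K" using C fin by (simp_all add: finite_imp_compact_convex_hull finite_imp_bounded_convex_hull)
  then show "K \<in> sets lebesgue" by (simp add: compact_imp_closed)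
  show "aff_dim K = 2" using C aff_dim_affine_independent[OF C(1)] by (simp add: aff_dim_convex_hull)
qed

lemma mesh_facts:
  assumes "mesh \<Omega> \<T>"
  shows "finite \<T>" "K \<in> \<T> \<Longrightarrow> 2 simplex K" "\<Union>\<T> = closure \<Omega>" "K \<in> \<T> \<Longrightarrow> K' \<in> \<T> \<Longrightarrow> (K \<inter> K') face_of K"
  using assms by (auto simp: mesh_def triangulation_def)

text \<open>The intersection is a face of both triangles and a proper face of at least one, as they
  differ; a proper face misses the interior. Convex sets with empty interior are null sets.\<close>

lemma mesh_Int_interior:
  assumes m: "mesh \<Omega> \<T>" and K: "K \<in> \<T>" "K' \<in> \<T>" "K \<noteq> K'"
  shows "interior (K \<inter> K') = {}" "negligible (K \<inter> K')"
proof -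
  have f: "(K \<inter> K') face_of K" "(K \<inter> K') face_of K'"
    using mesh_facts(4)[OF m K(1,2)] mesh_facts(4)[OF m K(2,1)] by (simp_all add: Int_commute)
  show i: "interior (K \<inter> K') = {}"
  proof (cases "K \<inter> K' = K")
    case True
    then have "K \<inter> K' \<noteq> K'" using K(3) by auto
    from face_of_disjoint_interior[OF f(2) this] show ?thesis
      using interior_subset[of K] interior_subset[of K'] by (auto simp: interior_Int)
  next
    case False
    from face_of_disjoint_interior[OF f(1) this] show ?thesis
      using interior_subset[of K] interior_subset[of K'] by (auto simp: interior_Int)
  qed
  have "convex (K \<inter> K')" using m K by (intro convex_Int simplex_2_facts(1)[OF mesh_facts(2)])
  then show "negligible (K \<inter> K')" using i negligible_convex_interior by blast
qed

lemma polygonal_domain_facts: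
  assumes "polygonal_domain \<Omega>"
  shows "open \<Omega>" "bounded \<Omega>" "\<Omega> \<in> sets lebesgue" "negligible (frontier \<Omega>)" "interior (closure \<Omega>) = \<Omega>" "\<Omega> \<noteq> {}"
proof -
  show o: "open \<Omega>" "bounded \<Omega>" "interior (closure \<Omega>) = \<Omega>" "\<Omega> \<noteq> {}" using assms by (auto simp: polygonal_domain_def)
  then show "\<Omega> \<in> sets lebesgue" by auto
  obtain S where S: "finite S" "frontier \<Omega> = (\<Union>(a, b)\<in>S. closed_segment a b)"
    using assms by (auto simp: polygonal_domain_def)
  have seg: "negligible (closed_segment a b)" for a b :: "real^2"
  proof -
    have "interior (closed_segment a b) = {}" 
      by (rule interior_closed_segment_ge2) simp
    then show ?thesis using negligible_convex_interior convex_closed_segment by blast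
  qed
  show "negligible (frontier \<Omega>)"
    unfolding S(2) using S(1) seg by (intro negligible_Union) auto
qed

text \<open>Shows that \<open>K_minus\<close>, chosen by \<open>SOME\<close>, exists. Near a point y
  of \<Omega> in the relative interior of the edge there are points of \<Omega> beyond the edge,
  covered by other triangles; these being finitely many closed sets, one of them contains y. Its
  intersection with the first triangle is a common face that meets the relative interior of e, so it
  contains e, and by dimension it equals e.\<close>

lemma K_minus_props:
  assumes p: "polygonal_domain \<Omega>" and m: "mesh \<Omega> \<T>" and e: "e \<in> interior_edges \<Omega> \<T>"
  shows "K_plus \<T> e \<in> \<T>" "e edge_of K_plus \<T> e" "K_minus \<T> e \<in> \<T>" "e edge_of K_minus \<T> e" "K_minus \<T> e \<noteq> K_plus \<T> e"
proof -
  have ex: "\<exists>K. K \<in> \<T> \<and> e edge_of K" using e by (auto simp: interior_edges_def edges_def)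
  from someI_ex[OF this] show Kp: "K_plus \<T> e \<in> \<T>" "e edge_of K_plus \<T> e" by (auto simp: K_plus_def)
  define K where "K = K_plus \<T> e"
  have K: "K \<in> \<T>" "e edge_of K" "2 simplex K" using Kp mesh_facts(2)[OF m] by (auto simp: K_def)
  obtain a \<nu> h w where tf: "triangle_frame a \<nu> h w" and Keq: "K = triangle_frame.K a \<nu> h w" and eeq: "e = triangle_frame.e a \<nu> h"
    using triangle_frame_of_edge[OF K(3,2)] .
  interpret tf: triangle_frame a \<nu> h w by (rule tf)
  have nf: "\<not> e \<subseteq> frontier \<Omega>" "e \<in> edges \<T>" using e by (auto simp: interior_edges_def boundary_edges_def)
  then obtain x0 where x0: "x0 \<in> e" "x0 \<notin> frontier \<Omega>" by blast
  have "e \<subseteq> K" using K(2) by (simp add: edge_of_imp_subset)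
  then have "x0 \<in> closure \<Omega>" using x0 K(1) mesh_facts(3)[OF m] by blast
  then have x0\<Omega>: "x0 \<in> \<Omega>" using x0 polygonal_domain_facts(1)[OF p] by (simp add: frontier_def interior_open)
  obtain \<epsilon> where \<epsilon>: "0 < \<epsilon>" "ball x0 \<epsilon> \<subseteq> \<Omega>" using x0\<Omega> polygonal_domain_facts(1)[OF p] openE by blast
  let ?F = "fr a \<nu> h"
  have s0: "0 \<le> cs a \<nu> h x0" "cs a \<nu> h x0 \<le> 1" "?F (cs a \<nu> h x0) 0 = x0"
    using x0(1) tf.F_S_R[of x0] unfolding eeq tf.e_iff by auto
  \<comment> \<open>The point x0 may be an end point of the edge. Since \<Omega> is open, it can be
    moved along the edge into the relative interior.\<close>
  obtain s where s: "0 < s" "s < 1" "?F s 0 \<in> \<Omega>"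
  proof -
    have "continuous_on UNIV (\<lambda>s. ?F s 0)" by (intro tf.continuous_on_F continuous_intros)
    then have op: "open ((\<lambda>s. ?F s 0) -` \<Omega>)" using polygonal_domain_facts(1)[OF p] by (simp add: open_vimage)
    have "cs a \<nu> h x0 \<in> closure {0<..<1}" using s0 by simp
    moreover have "cs a \<nu> h x0 \<in> (\<lambda>s. ?F s 0) -` \<Omega>" using s0 x0\<Omega> by simp
    ultimately have "(\<lambda>s. ?F s 0) -` \<Omega> \<inter> {0<..<1} \<noteq> {}"
      using open_Int_closure_eq_empty[OF op, of "{0<..<1}"] by blast
    then show thesis using that by auto
  qed
  define y where "y = ?F s 0"
  have y: "y \<in> \<Omega>" using s by (simp add: y_def)
  let ?H = "{x. cr a \<nu> h x > 0}"
  have "y \<in> closure ?H"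
    unfolding closure_approachable
  proof (intro allI impI)
    fix t :: real assume t: "0 < t"
    have "dist (?F s (t / (2 * h))) y = t / 2"
      using t tf.h_pos tf.norm_nu by (simp add: y_def dist_norm fr_def)
    then show "\<exists>z\<in>?H. dist z y < t"
      using t tf.h_pos by (intro bexI[of _ "?F s (t / (2 * h))"]) auto
  qed
  then have "y \<in> closure (\<Omega> \<inter> ?H)" using open_Int_closure_subset[OF polygonal_domain_facts(1)[OF p]] y by blast
  moreover have "\<Omega> \<inter> ?H \<subseteq> \<Union>(\<T> - {K})"
  proof
    fix x assume x: "x \<in> \<Omega> \<inter> ?H"
    then have "x \<notin> K" using tf.R_nonpos[of x] Keq by auto
    then show "x \<in> \<Union>(\<T> - {K})" using x mesh_facts(3)[OF m] closure_subset[of \<Omega>] by blast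
  qed
  moreover have "closed (\<Union>(\<T> - {K}))"
    using mesh_facts(1,2)[OF m] simplex_2_facts(2) by (intro closed_Union) (auto simp: compact_imp_closed)
  ultimately have "y \<in> \<Union>(\<T> - {K})" using closure_minimal by blast
  then obtain K' where K': "K' \<in> \<T>" "K' \<noteq> K" "y \<in> K'" by blast
  have f: "(K \<inter> K') face_of K" "(K \<inter> K') face_of K'"
    using mesh_facts(4)[OF m K(1) K'(1)] mesh_facts(4)[OF m K'(1) K(1)] by (simp_all add: Int_commute)
  have ye: "y \<in> rel_interior e"
  proof -
    have ne: "a \<noteq> ?F 1 0" using tf.dist_a_b tf.h_pos by auto
    have "y = (1 - s) *\<^sub>R a + s *\<^sub>R ?F 1 0" by (simp add: y_def fr_def algebra_simps)
    then have "y \<in> open_segment a (?F 1 0)" using s ne by (auto simp: in_segment)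
    then show ?thesis using ne by (simp add: eeq tf.e_def rel_interior_closed_segment)
  qed
  have "y \<in> K" using ye \<open>e \<subseteq> K\<close> rel_interior_subset by blast
  then have eg: "e \<subseteq> K \<inter> K'" using subset_of_face_of[OF f(1) \<open>e \<subseteq> K\<close>] ye K' by blast
  have S': "2 simplex K'" using mesh_facts(2)[OF m K'(1)] .
  have "K \<inter> K' \<noteq> K"
  proof
    assume eq: "K \<inter> K' = K"
    then have "K face_of K'" "K \<noteq> K'" using f K' by auto
    from face_of_aff_dim_lt[OF simplex_2_facts(1)[OF S'] this] show False
      using simplex_2_facts(5)[OF S'] simplex_2_facts(5)[OF K(3)] by simp
  qed
  from face_of_aff_dim_lt[OF simplex_2_facts(1)[OF K(3)] f(1) this] have d2: "aff_dim (K \<inter> K') < 2"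
    using simplex_2_facts(5)[OF K(3)] by simp
  have de: "aff_dim e = 1" "e face_of K" using K(2) by (auto simp: edge_of_def)
  have ef: "e face_of (K \<inter> K')" using face_of_subset[OF de(2) eg] by blast
  have "e = K \<inter> K'"
  proof (rule ccontr)
    assume "e \<noteq> K \<inter> K'"
    from face_of_aff_dim_lt[OF _ ef this] show False
      using d2 de simplex_2_facts(1)[OF K(3)] simplex_2_facts(1)[OF S'] by (auto simp: convex_Int)
  qed
  then have "e edge_of K'" using f(2) de by (simp add: edge_of_def)
  then have "\<exists>K'. K' \<in> \<T> \<and> e edge_of K' \<and> K' \<noteq> K_plus \<T> e" using K' K_def by blast
  from someI_ex[OF this] show "K_minus \<T> e \<in> \<T>" "e edge_of K_minus \<T> e" "K_minus \<T> e \<noteq> K_plus \<T> e"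
    by (auto simp: K_minus_def)
qed

text \<open>Two triangles sharing an edge lie on opposite sides of it, so the frame of the second one is
  that of the first one read from the other end point with the opposite normal.\<close>

lemma opposite_triangle_frame:
  assumes m: "mesh \<Omega> \<T>" and K: "triangle_frame.K a \<nu> h w \<in> \<T>" "K' \<in> \<T>" "K' \<noteq> triangle_frame.K a \<nu> h w"
    and tf: "triangle_frame a \<nu> h w" and e: "triangle_frame.e a \<nu> h edge_of K'"
    and sr: "shape_regular \<kappa> \<T>" and \<kappa>: "1 \<le> \<kappa>"
  obtains w' where "triangle_frame (fr a \<nu> h 1 0) (- \<nu>) h w'" "K' = triangle_frame.K (fr a \<nu> h 1 0) (- \<nu>) h w'"
    "triangle_frame.e a \<nu> h = triangle_frame.e (fr a \<nu> h 1 0) (- \<nu>) h"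
proof -
  interpret tf: triangle_frame a \<nu> h w by (rule tf)
  obtain a' \<nu>' h' w' where tf': "triangle_frame a' \<nu>' h' w'" and Keq: "K' = triangle_frame.K a' \<nu>' h' w'" and eeq: "tf.e = triangle_frame.e a' \<nu>' h'"
    using triangle_frame_of_edge[OF mesh_facts(2)[OF m K(2)] e] .
  interpret tf': triangle_frame a' \<nu>' h' w' by (rule tf')
  have h': "h' = h" using tf.diameter_e tf'.diameter_e eeq by simp
  have "{a, fr a \<nu> h 1 0} = {a', fr a' \<nu>' h' 1 0}" using eeq by (simp add: tf.e_def tf'.e_def)
  then consider "a' = a" "fr a' \<nu>' h' 1 0 = fr a \<nu> h 1 0" | "a' = fr a \<nu> h 1 0" "fr a' \<nu>' h' 1 0 = a"
    by (auto simp: doubleton_eq_iff)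
  then show thesis
  proof cases
    case 1
    then have "perp \<nu>' = perp \<nu>" using h' tf.h_pos by (simp add: fr_def)
    then have \<nu>: "\<nu>' = \<nu>" by (simp add: vec2_eq_iff)
    \<comment> \<open>If both triangles were on the same side, the rectangle next to the middle half
      of the edge would lie in both, and their intersection would have interior points.\<close>
    define d where "d = 1 / (4 * \<kappa> * (1 + \<kappa>))"
    have d: "0 < d" using \<kappa> by (simp add: d_def)
    have "tf.rect (1/4) (3/4) (- d) 0 \<subseteq> tf.K" "tf.rect (1/4) (3/4) (- d) 0 \<subseteq> K'"
      using tf.rect_subset_K[of \<kappa>] tf'.rect_subset_K[of \<kappa>] sr K \<kappa> h' 1 \<nu> Keq unfolding d_def by (auto simp: shape_regular_def)
    then have sub: "tf.rect (1/4) (3/4) (- d) 0 \<subseteq> tf.K \<inter> K'" by blast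
    let ?O = "{x. 1/4 < cs a \<nu> h x \<and> cs a \<nu> h x < 3/4 \<and> - d < cr a \<nu> h x \<and> cr a \<nu> h x < 0}"
    have "open ?O" by (intro open_Collect_conj open_Collect_less continuous_intros tf.continuous_on_S tf.continuous_on_R)
    moreover have "?O \<subseteq> tf.K \<inter> K'" using sub by (auto simp: tf.rect_def)
    moreover have "fr a \<nu> h (1/2) (- d/2) \<in> ?O" using d by simp
    ultimately have "interior (tf.K \<inter> K') \<noteq> {}" using interior_maximal by blast
    then show thesis using mesh_Int_interior(1)[OF m K(1,2)] K(3) by auto
  next
    case 2
    have "fr a' \<nu>' h' 1 0 = a' + h *\<^sub>R perp \<nu>'" "fr a \<nu> h 1 0 = a + h *\<^sub>R perp \<nu>" using h' by (simp_all add: fr_def)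
    then have "h *\<^sub>R perp \<nu>' = h *\<^sub>R (- perp \<nu>)" using 2 by (simp add: eq_neg_iff_add_eq_0) (metis add.assoc add.commute add_cancel_left_left)
    then have "perp \<nu>' = - perp \<nu>" using tf.h_pos by (metis scaleR_left_imp_eq less_irrefl)
    then have "\<nu>' = - \<nu>" by (simp add: vec2_eq_iff)
    then show thesis using that[of w'] tf' Keq eeq 2(1) h' by simp
  qed
qed

section \<open>Piecewise polynomials in frame coordinates\<close>

definition is_tpoly :: "nat \<Rightarrow> (real \<Rightarrow> real \<Rightarrow> real) \<Rightarrow> bool" where
  "is_tpoly k f \<longleftrightarrow> (\<exists>c. \<forall>s r. f s r = tpoly k c s r)"

lemma is_tpoly_cmult: "is_tpoly k f \<Longrightarrow> is_tpoly k (\<lambda>s r. x * f s r)"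
  unfolding is_tpoly_def using tpoly_cmult by metis

lemma is_tpoly_sum: "(\<And>i. i \<in> I \<Longrightarrow> is_tpoly k (f i)) \<Longrightarrow> is_tpoly k (\<lambda>s r. \<Sum>i\<in>I. f i s r)"
proof (induction I rule: infinite_finite_induct)
  case (insert i I)
  then obtain c d where "\<forall>s r. f i s r = tpoly k c s r" "\<forall>s r. (\<Sum>i\<in>I. f i s r) = tpoly k d s r"
    unfolding is_tpoly_def by (metis insertCI)
  then show ?case using insert.hyps
    by (auto simp: is_tpoly_def intro!: exI[of _ "\<lambda>i j. c i j + d i j"] tpoly_add[symmetric])
qed (auto simp: is_tpoly_def tpoly_def intro!: exI[of _ "\<lambda>_ _. 0"])

lemma is_tpoly_monomial: "i \<le> k \<Longrightarrow> j \<le> k \<Longrightarrow> is_tpoly k (\<lambda>s r. s ^ i * r ^ j)"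
  unfolding is_tpoly_def using tpoly_monomial by metis

lemma is_tpoly_mult:
  assumes "is_tpoly m f" "is_tpoly n g" "m + n \<le> k"
  shows "is_tpoly k (\<lambda>s r. f s r * g s r)"
proof -
  obtain c d where c: "\<And>s r. f s r = tpoly m c s r" and d: "\<And>s r. g s r = tpoly n d s r"
    using assms by (auto simp: is_tpoly_def)
  have "f s r * g s r = (\<Sum>i\<le>m. \<Sum>j\<le>m. \<Sum>i'\<le>n. \<Sum>j'\<le>n. (c i j * d i' j') * (s ^ (i + i') * r ^ (j + j')))" for s r
    by (simp only: c d tpoly_def sum_distrib_right, simp only: sum_distrib_left, simp add: power_add mult_ac)
  moreover have "is_tpoly k (\<lambda>s r. \<Sum>i\<le>m. \<Sum>j\<le>m. \<Sum>i'\<le>n. \<Sum>j'\<le>n. (c i j * d i' j') * (s ^ (i + i') * r ^ (j + j')))"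
    using assms(3) by (intro is_tpoly_sum is_tpoly_cmult is_tpoly_monomial) auto
  ultimately show ?thesis by simp
qed

lemma is_tpoly_power:
  assumes "is_tpoly 1 f" shows "is_tpoly i (\<lambda>s r. f s r ^ i)"
proof (induction i)
  case 0
  show ?case using is_tpoly_monomial[of 0 0 0] by simp
next
  case (Suc i)
  show ?case using is_tpoly_mult[OF assms Suc, of "Suc i"] by simp
qed

lemma tpoly_zero_coeffs:
  assumes z: "\<And>s r. s0 < s \<Longrightarrow> s < s1 \<Longrightarrow> r0 < r \<Longrightarrow> r < r1 \<Longrightarrow> tpoly k c s r = 0"
    and lt: "s0 < s1" "r0 < r1" and ij: "i \<le> k" "j \<le> k"
  shows "c i j = 0"
proof -
  have inf: "infinite {s0<..<s1}" "infinite {r0<..<r1}" using lt by simp_all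
  have 1: "(\<Sum>j\<le>k. c i j * r ^ j) = 0" if r: "r0 < r" "r < r1" and "i \<le> k" for i r
  proof -
    have "(\<Sum>i\<le>k. (\<Sum>j\<le>k. c i j * r ^ j) * s ^ i) = tpoly k c s r" for s
      by (simp add: tpoly_def sum_distrib_right) (simp add: mult_ac)
    then have "{s0<..<s1} \<subseteq> {s. (\<Sum>i\<le>k. (\<Sum>j\<le>k. c i j * r ^ j) * s ^ i) = 0}" using z r by auto
    then have "infinite {s. (\<Sum>i\<le>k. (\<Sum>j\<le>k. c i j * r ^ j) * s ^ i) = 0}" using inf finite_subset by blast
    then show ?thesis using polyfun_finite_roots[of "\<lambda>i. \<Sum>j\<le>k. c i j * r ^ j" k] \<open>i \<le> k\<close> by blast
  qed
  have "{r0<..<r1} \<subseteq> {r. (\<Sum>j\<le>k. c i j * r ^ j) = 0}" using 1 ij by auto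
  then have "infinite {r. (\<Sum>j\<le>k. c i j * r ^ j) = 0}" using inf finite_subset by blast
  then show ?thesis using polyfun_finite_roots[of "\<lambda>j. c i j" k] ij by blast
qed

lemma tpoly_trace_coeffs:
  assumes "\<And>s. s0 < s \<Longrightarrow> s < s1 \<Longrightarrow> tpoly k c s 0 = 0" "s0 < s1" "i \<le> k"
  shows "c i 0 = 0"
proof -
  have "{s0<..<s1} \<subseteq> {s. (\<Sum>i\<le>k. c i 0 * s ^ i) = 0}" using assms(1) by (auto simp: tpoly_0)
  moreover have "infinite {s0<..<s1}" using assms(2) by simp
  ultimately have "infinite {s. (\<Sum>i\<le>k. c i 0 * s ^ i) = 0}" using finite_subset by blast
  then show ?thesis using polyfun_finite_roots[of "\<lambda>i. c i 0" k] assms(3) by blast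
qed

lemma polys_component:
  fixes p :: "real^2 \<Rightarrow> real^2^2"
  assumes "p \<in> polys k" shows "(\<lambda>x. p x $ i $ j) \<in> polys k"
proof -
  obtain c where c: "\<And>x. p x = (\<Sum>(i, j) | i + j \<le> k. ((x $ 1) ^ i * (x $ 2) ^ j) *\<^sub>R c i j)"
    using assms by (auto simp: polys_def)
  have "p x $ i $ j = (\<Sum>(a, b) | a + b \<le> k. ((x $ 1) ^ a * (x $ 2) ^ b) *\<^sub>R (c a b $ i $ j))" for x
    unfolding c by (simp add: case_prod_unfold)
  then show ?thesis unfolding polys_def by (intro CollectI exI[of _ "\<lambda>a b. c a b $ i $ j"]) simp
qed

lemma polys_linear:
  fixes p :: "real^2 \<Rightarrow> real^2^2"
  assumes "p \<in> polys k" "linear A" shows "(\<lambda>x. A (p x)) \<in> polys k"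
proof -
  obtain c where c: "\<And>x. p x = (\<Sum>(i, j) | i + j \<le> k. ((x $ 1) ^ i * (x $ 2) ^ j) *\<^sub>R c i j)"
    using assms by (auto simp: polys_def)
  have "A (p x) = (\<Sum>(i, j) | i + j \<le> k. ((x $ 1) ^ i * (x $ 2) ^ j) *\<^sub>R A (c i j))" for x
    unfolding c using assms(2) by (simp add: linear_sum linear_scale case_prod_unfold)
  then show ?thesis unfolding polys_def by (intro CollectI exI[of _ "\<lambda>a b. A (c a b)"]) simp
qed

lemma polys_add:
  fixes p q :: "real^2 \<Rightarrow> real^2^2"
  assumes "p \<in> polys k" "q \<in> polys k" shows "(\<lambda>x. p x + q x) \<in> polys k"
proof -
  obtain c d where c: "\<And>x. p x = (\<Sum>(i, j) | i + j \<le> k. ((x $ 1) ^ i * (x $ 2) ^ j) *\<^sub>R c i j)"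
    and d: "\<And>x. q x = (\<Sum>(i, j) | i + j \<le> k. ((x $ 1) ^ i * (x $ 2) ^ j) *\<^sub>R d i j)"
    using assms by (auto simp: polys_def)
  have "p x + q x = (\<Sum>(i, j) | i + j \<le> k. ((x $ 1) ^ i * (x $ 2) ^ j) *\<^sub>R (c i j + d i j))" for x
    unfolding c d by (simp add: case_prod_unfold sum.distrib scaleR_add_right)
  then show ?thesis unfolding polys_def by (intro CollectI exI[of _ "\<lambda>a b. c a b + d a b"]) simp
qed

lemma polys_continuous: 
  fixes p :: "real^2 \<Rightarrow> real^2^2"
  assumes "p \<in> polys k" shows "continuous_on A p"
proof -
  obtain c where c: "p = (\<lambda>x. (\<Sum>(i, j) | i + j \<le> k. ((x $ 1) ^ i * (x $ 2) ^ j) *\<^sub>R c i j))"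
    using assms by (auto simp: polys_def)
  show ?thesis unfolding c case_prod_unfold by (intro continuous_intros)
qed

section \<open>Polynomial fields, uniqueness, and the operators curl and curl curl in frame
  coordinates\<close>

context frame
begin

lemma F_nth: "F s r $ i = a $ i + (h * s) * tau $ i + (h * r) * \<nu> $ i"
  by (simp add: fr_def)

lemma polys_frame:
  fixes p :: "real^2 \<Rightarrow> real"
  assumes "p \<in> polys k"
  shows "\<exists>c. \<forall>x. p x = tpoly k c (S x) (R x)"
proof -
  obtain c where c: "\<And>x. p x = (\<Sum>(i, j) | i + j \<le> k. ((x $ 1) ^ i * (x $ 2) ^ j) *\<^sub>R c i j)"
    using assms by (auto simp: polys_def)
  have lin: "is_tpoly 1 (\<lambda>s r. F s r $ i)" for i
  proof -
    define d where "d = (\<lambda>(m :: nat) (n :: nat). if m = 0 \<and> n = 0 then a $ i else if m = 1 \<and> n = 0 then h * tau $ i else if m = 0 \<and> n = 1 then h * \<nu> $ i else 0)"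
    have "F s r $ i = tpoly 1 d s r" for s r
      by (simp add: tpoly_def d_def F_nth atMost_Suc mult_ac)
    then show ?thesis unfolding is_tpoly_def by blast
  qed
  have "is_tpoly k (\<lambda>s r. \<Sum>(i, j) | i + j \<le> k. c i j * ((F s r $ 1) ^ i * (F s r $ 2) ^ j))"
    unfolding case_prod_unfold
    by (intro is_tpoly_sum is_tpoly_cmult is_tpoly_mult[OF is_tpoly_power[OF lin] is_tpoly_power[OF lin]]) auto
  then obtain d where "\<And>s r. (\<Sum>(i, j) | i + j \<le> k. c i j * ((F s r $ 1) ^ i * (F s r $ 2) ^ j)) = tpoly k d s r"
    unfolding is_tpoly_def by blast
  then have "p (F s r) = tpoly k d s r" for s r
    unfolding c by (simp add: mult.commute)
  then have "p x = tpoly k d (S x) (R x)" for x using F_S_R[of x] by metis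
  then show ?thesis by blast
qed

text \<open>Makes the \<open>SOME\<close> in \<open>piece\<close> harmless. Two continuous functions
  that agree almost everywhere agree on an open rectangle, and there all coefficients of the
  difference vanish.\<close>

lemma polys_eq_of_AE:
  fixes p q :: "real^2 \<Rightarrow> real^2^2"
  assumes p: "p \<in> polys m" and q: "q \<in> polys n" and K: "K \<in> sets lebesgue"
    and sub: "rect s0 s1 l u \<subseteq> K" and lt: "s0 < s1" "l < u"
    and ae: "AE x in lebesgue_on K. p x = q x"
  shows "p = q"
proof -
  define O' where "O' = {x. s0 < S x \<and> S x < s1 \<and> l < R x \<and> R x < u}"
  have op: "open O'" unfolding O'_def by (intro open_Collect_conj open_Collect_less continuous_intros)
  have sub': "O' \<subseteq> K" using sub by (auto simp: O'_def rect_def)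
  have eqO: "p x = q x" if "x \<in> O'" for x
  proof (rule ccontr)
    assume ne: "p x \<noteq> q x"
    let ?U = "O' \<inter> {x. p x \<noteq> q x}"
    have opU: "open ?U" using op polys_continuous[OF p, of UNIV] polys_continuous[OF q, of UNIV]
      by (intro open_Int open_Collect_neq)
    have "AE x in lebesgue. x \<in> K \<longrightarrow> p x = q x"
      using ae K by (simp add: AE_restrict_space_iff)
    then have "AE x in lebesgue. x \<notin> ?U" by eventually_elim (use sub' in auto)
    then have "?U \<in> null_sets lebesgue" using opU by (subst AE_iff_null_sets) auto
    then have "negligible ?U" by (simp add: negligible_iff_null_sets)
    then show False using open_not_negligible[OF opU] that ne by blast
  qed
  have "p x $ i $ j = q x $ i $ j" for x i j
  proof -
    obtain c where c: "\<And>x. p x $ i $ j = tpoly m c (S x) (R x)" using polys_frame[OF polys_component[OF p]] by metis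
    obtain d where d: "\<And>x. q x $ i $ j = tpoly n d (S x) (R x)" using polys_frame[OF polys_component[OF q]] by metis
    \<comment> \<open>The chosen polynomial may have any degree m, so both are padded to the common
      degree m + n before coefficients are compared.\<close>
    have one: "is_tpoly N (\<lambda>s r. 1)" for N using is_tpoly_monomial[of 0 N 0] by simp
    have "is_tpoly (m + n) (\<lambda>s r. tpoly m c s r * 1)" "is_tpoly (m + n) (\<lambda>s r. tpoly n d s r * 1)"
      by (rule is_tpoly_mult[OF _ one[of n]], auto simp: is_tpoly_def)
         (rule is_tpoly_mult[OF _ one[of m], unfolded is_tpoly_def, simplified], auto)
    then obtain c' d' where c': "\<And>s r. tpoly m c s r = tpoly (m + n) c' s r" and d': "\<And>s r. tpoly n d s r = tpoly (m + n) d' s r"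
      unfolding is_tpoly_def by auto
    have "tpoly (m + n) (\<lambda>i j. c' i j - d' i j) s r = 0" if "s0 < s" "s < s1" "l < r" "r < u" for s r
    proof -
      have "F s r \<in> O'" using that by (simp add: O'_def)
      from eqO[OF this] have "tpoly m c s r = tpoly n d s r" using c[of "F s r"] d[of "F s r"] by simp
      then show ?thesis by (simp add: tpoly_diff c' d')
    qed
    from tpoly_zero_coeffs[OF this lt] have "c' i j = d' i j" if "i \<le> m + n" "j \<le> m + n" for i j using that by fastforce
    then have "tpoly (m + n) c' s r = tpoly (m + n) d' s r" for s r
      unfolding tpoly_def by (intro sum.cong refl) auto
    then show ?thesis by (simp add: c d c' d')
  qed
  then show "p = q" by (simp add: fun_eq_iff vec_eq_iff)
qed

lemma pd_tpoly: "pd i (\<lambda>y. tpoly k c (S y) (R y)) x = tau $ i / h * tpoly k (ds k c) (S x) (R x) + \<nu> $ i / h * tpoly k (dr k c) (S x) (R x)"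
  unfolding pd_def frechet_derivative_at[OF has_derivative_tpoly[OF has_derivative_S has_derivative_R], symmetric]
  by (simp add: inner_axis' mult.commute)

text \<open>Coefficients of the components \<open>m\<^sub>t\<^sub>t\<close>, \<open>m\<^sub>t\<^sub>n\<close>, \<open>m\<^sub>n\<^sub>n\<close> of a symmetric matrix field with entries
  \<open>c\<^sub>1\<^sub>1\<close>, \<open>c\<^sub>1\<^sub>2\<close>, \<open>c\<^sub>2\<^sub>2\<close>.\<close>

definition ctt :: "(nat \<Rightarrow> nat \<Rightarrow> real) \<Rightarrow> (nat \<Rightarrow> nat \<Rightarrow> real) \<Rightarrow> (nat \<Rightarrow> nat \<Rightarrow> real) \<Rightarrow> nat \<Rightarrow> nat \<Rightarrow> real" where
  "ctt c11 c12 c22 = (\<lambda>i j. (\<nu> $ 2)\<^sup>2 * c11 i j - 2 * \<nu> $ 1 * \<nu> $ 2 * c12 i j + (\<nu> $ 1)\<^sup>2 * c22 i j)"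

definition ctn :: "(nat \<Rightarrow> nat \<Rightarrow> real) \<Rightarrow> (nat \<Rightarrow> nat \<Rightarrow> real) \<Rightarrow> (nat \<Rightarrow> nat \<Rightarrow> real) \<Rightarrow> nat \<Rightarrow> nat \<Rightarrow> real" where
  "ctn c11 c12 c22 = (\<lambda>i j. \<nu> $ 1 * \<nu> $ 2 * c22 i j + ((\<nu> $ 1)\<^sup>2 - (\<nu> $ 2)\<^sup>2) * c12 i j - \<nu> $ 1 * \<nu> $ 2 * c11 i j)"

definition cnn :: "(nat \<Rightarrow> nat \<Rightarrow> real) \<Rightarrow> (nat \<Rightarrow> nat \<Rightarrow> real) \<Rightarrow> (nat \<Rightarrow> nat \<Rightarrow> real) \<Rightarrow> nat \<Rightarrow> nat \<Rightarrow> real" where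
  "cnn c11 c12 c22 = (\<lambda>i j. (\<nu> $ 1)\<^sup>2 * c11 i j + 2 * \<nu> $ 1 * \<nu> $ 2 * c12 i j + (\<nu> $ 2)\<^sup>2 * c22 i j)"

definition matrix_field :: "nat \<Rightarrow> (nat \<Rightarrow> nat \<Rightarrow> real) \<Rightarrow> (nat \<Rightarrow> nat \<Rightarrow> real) \<Rightarrow> (nat \<Rightarrow> nat \<Rightarrow> real) \<Rightarrow> (real^2 \<Rightarrow> real^2^2) \<Rightarrow> bool" where
  "matrix_field k c11 c12 c22 M \<longleftrightarrow> (\<forall>x. M x $ 1 $ 1 = tpoly k c11 (S x) (R x) \<and> M x $ 1 $ 2 = tpoly k c12 (S x) (R x) \<and>
      M x $ 2 $ 1 = tpoly k c12 (S x) (R x) \<and> M x $ 2 $ 2 = tpoly k c22 (S x) (R x))"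

lemma polys_Sym_matrix_field:
  assumes "M \<in> polys_Sym k" shows "\<exists>c11 c12 c22. matrix_field k c11 c12 c22 M"
proof -
  have "M x \<in> Sym" for x using assms by (auto simp: polys_Sym_def)
  then have M: "M \<in> polys k" "\<And>x. M x $ 2 $ 1 = M x $ 1 $ 2" using assms by (simp_all add: polys_Sym_def Sym_iff)
  obtain c11 c12 c22 where "\<forall>x. M x $ 1 $ 1 = tpoly k c11 (S x) (R x)" "\<forall>x. M x $ 1 $ 2 = tpoly k c12 (S x) (R x)"
     "\<forall>x. M x $ 2 $ 2 = tpoly k c22 (S x) (R x)"
    using polys_frame[OF polys_component[OF M(1)]] by metis
  then show ?thesis using M(2) unfolding matrix_field_def by auto
qed

context
  fixes k c11 c12 c22 M
  assumes mf: "matrix_field k c11 c12 c22 M"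
begin

lemma matrix_field_entries:
  "(\<lambda>y. M y $ 1 $ 1) = (\<lambda>y. tpoly k c11 (S y) (R y))" "(\<lambda>y. M y $ 1 $ 2) = (\<lambda>y. tpoly k c12 (S y) (R y))"
  "(\<lambda>y. M y $ 2 $ 1) = (\<lambda>y. tpoly k c12 (S y) (R y))" "(\<lambda>y. M y $ 2 $ 2) = (\<lambda>y. tpoly k c22 (S y) (R y))"
  using mf by (auto simp: matrix_field_def)

lemma matrix_field_frame:
  "(M x *v tau) \<bullet> tau = tpoly k (ctt c11 c12 c22) (S x) (R x)"
  "(M x *v tau) \<bullet> \<nu> = tpoly k (ctn c11 c12 c22) (S x) (R x)"
  "(M x *v \<nu>) \<bullet> \<nu> = tpoly k (cnn c11 c12 c22) (S x) (R x)"
  using mf by (simp_all add: matrix_field_def ctt_def ctn_def cnn_def tpoly_add tpoly_diff tpoly_cmult inner_vec2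
      matrix_vector_mult_def sum_2) (simp_all add: algebra_simps power2_eq_square)

lemma matrix_field_Sym: "M x \<in> Sym"
  using mf by (simp add: matrix_field_def Sym_iff)

lemma matrix_field_curl:
  "curl_tensor M x \<bullet> tau = (tpoly k (dr k (ctt c11 c12 c22)) (S x) (R x) - tpoly k (ds k (ctn c11 c12 c22)) (S x) (R x)) / h"
proof -
  have n: "\<nu> $ 1 * \<nu> $ 1 = 1 - \<nu> $ 2 * \<nu> $ 2" using nu_sq by simp
  show ?thesis
    using h_pos unfolding curl_tensor_def matrix_field_entries pd_tpoly
    by (simp add: ctt_def ctn_def ds_add ds_diff ds_cmult dr_add dr_diff dr_cmult tpoly_add tpoly_diff tpoly_cmult inner_vec2)
       (simp add: field_simps power2_eq_square)
qed

lemma matrix_field_tangential_derivative: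
  "frechet_derivative (\<lambda>y. (M y *v tau) \<bullet> \<nu>) (at x) tau = tpoly k (ds k (ctn c11 c12 c22)) (S x) (R x) / h"
  unfolding matrix_field_frame frechet_derivative_at[OF has_derivative_tpoly[OF has_derivative_S has_derivative_R], symmetric]
  by simp

text \<open>The Cartesian derivatives are combinations of \<open>ds\<close> and \<open>dr\<close>
  with constant weights \<open>tau $ i / h\<close> and \<open>\<nu> $ i / h\<close>. Expanding the
  second-order operator collects precisely the components m_tt, m_tn and m_nn, and the two
  derivatives give the factor 1 / h ^ 2.\<close>

lemma matrix_field_curl_curl:
  "curl_vec (curl_tensor M) x = tpoly k (rho k (ctt c11 c12 c22) (ctn c11 c12 c22) (cnn c11 c12 c22)) (S x) (R x) / h\<^sup>2"
proof -
  define D where "D = (\<lambda>i c m n. tau $ i / h * ds k c m n + \<nu> $ i / h * dr k c m n)"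
  have pdD: "pd i (\<lambda>y. tpoly k c (S y) (R y)) = (\<lambda>x. tpoly k (D i c) (S x) (R x))" for i c
    by (rule ext) (simp only: pd_tpoly D_def tpoly_add tpoly_cmult)
  have "(\<lambda>y. curl_tensor M y $ 2) = (\<lambda>y. tpoly k (\<lambda>m n. D 1 c22 m n - D 2 c12 m n) (S y) (R y))"
    "(\<lambda>y. curl_tensor M y $ 1) = (\<lambda>y. tpoly k (\<lambda>m n. D 1 c12 m n - D 2 c11 m n) (S y) (R y))"
    unfolding curl_tensor_def matrix_field_entries pdD by (simp_all add: tpoly_diff)
  then have "curl_vec (curl_tensor M) x = tpoly k (D 1 (\<lambda>m n. D 1 c22 m n - D 2 c12 m n)) (S x) (R x) - tpoly k (D 2 (\<lambda>m n. D 1 c12 m n - D 2 c11 m n)) (S x) (R x)"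
    unfolding curl_vec_def by (simp only: pdD)
  also have "\<dots> = tpoly k (rho k (ctt c11 c12 c22) (ctn c11 c12 c22) (cnn c11 c12 c22)) (S x) (R x) / h\<^sup>2"
    using h_pos unfolding D_def
    by (simp only: rho_def ctt_def ctn_def cnn_def ds_add ds_diff ds_cmult dr_add dr_diff dr_cmult tpoly_add tpoly_diff tpoly_cmult dr_ds perp_nth)
       (simp add: field_simps power2_eq_square)
  finally show ?thesis .
qed

end

end

section \<open>The pieces of a discrete stress\<close>

lemma Sigma_h_decomp:
  assumes "\<sigma>h \<in> Sigma_h k \<Omega> \<T>"
  obtains \<tau> \<beta> where "\<tau> \<in> H1_space k \<Omega> \<T>" "\<beta> \<in> bubble_space k \<Omega> \<T>" "\<sigma>h = (\<lambda>x. \<tau> x + \<beta> x)"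
  using assms by (auto simp: Sigma_h_def)

lemma polys_Sym_add: "p \<in> polys_Sym k \<Longrightarrow> q \<in> polys_Sym k \<Longrightarrow> (\<lambda>x. p x + q x) \<in> polys_Sym k"
  by (auto simp: polys_Sym_def polys_add image_subset_iff Sym_closed)

lemma piece_eqI:
  fixes p :: "real^2 \<Rightarrow> real^2^2"
  assumes K: "2 simplex K" "diameter K \<le> \<kappa> * inball_diameter K" "1 \<le> \<kappa>" and p: "p \<in> polys k" and ae: "AE x in lebesgue_on K. \<sigma>h x = p x"
  shows "piece \<sigma>h K = p"
proof -
  have "(\<exists>m. piece \<sigma>h K \<in> polys m) \<and> (AE x in lebesgue_on K. \<sigma>h x = piece \<sigma>h K x)"
    unfolding piece_def by (rule someI[of _ p]) (use p ae in auto)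
  then obtain m where m: "piece \<sigma>h K \<in> polys m" and ae': "AE x in lebesgue_on K. \<sigma>h x = piece \<sigma>h K x" by blast
  obtain e where e: "e edge_of K" using finite_edges(3)[OF K(1)] by blast
  obtain a \<nu> h w where tf: "triangle_frame a \<nu> h w" and Keq: "K = triangle_frame.K a \<nu> h w" 
    using triangle_frame_of_edge[OF K(1) e] .
  interpret triangle_frame a \<nu> h w by (rule tf)
  show ?thesis
  proof (rule polys_eq_of_AE[OF m p simplex_2_facts(3)[OF K(1)]])
    show "rect (1/4) (3/4) (- (1 / (4 * \<kappa> * (1 + \<kappa>)))) 0 \<subseteq> K"
      using rect_subset_K[of \<kappa>] K(2,3) Keq by simp
    show "AE x in lebesgue_on K. piece \<sigma>h K x = p x"
      using ae ae' by eventually_elim simp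
  qed (use K(3) in auto)
qed

lemma piece_Sigma_h:
  assumes m: "mesh \<Omega> \<T>" and sr: "shape_regular \<kappa> \<T>" and \<kappa>: "1 \<le> \<kappa>" and \<sigma>h: "\<sigma>h \<in> Sigma_h k \<Omega> \<T>" and K: "K \<in> \<T>"
  shows "piece \<sigma>h K \<in> polys_Sym k" "AE x in lebesgue_on K. \<sigma>h x = piece \<sigma>h K x"
proof -
  obtain \<tau> \<beta> where tb: "\<tau> \<in> H1_space k \<Omega> \<T>" "\<beta> \<in> bubble_space k \<Omega> \<T>" "\<sigma>h = (\<lambda>x. \<tau> x + \<beta> x)"
    using Sigma_h_decomp[OF \<sigma>h] .
  obtain p where p: "p \<in> polys_Sym k" "AE x in lebesgue_on K. \<tau> x = p x" using tb(1) K by (auto simp: H1_space_def)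
  obtain q where q: "q \<in> bubbles k K" "AE x in lebesgue_on K. \<beta> x = q x" using tb(2) K by (auto simp: bubble_space_def)
  have q': "q \<in> polys_Sym k" using q by (simp add: bubbles_def)
  have pq: "(\<lambda>x. p x + q x) \<in> polys_Sym k" by (rule polys_Sym_add[OF p(1) q'])
  have ae: "AE x in lebesgue_on K. \<sigma>h x = p x + q x" using p(2) q(2) by eventually_elim (simp add: tb)
  have "piece \<sigma>h K = (\<lambda>x. p x + q x)"
    by (rule piece_eqI[OF mesh_facts(2)[OF m K] _ \<kappa> _ ae]) (use sr K pq in \<open>auto simp: shape_regular_def polys_Sym_def\<close>)
  then show "piece \<sigma>h K \<in> polys_Sym k" "AE x in lebesgue_on K. \<sigma>h x = piece \<sigma>h K x" using pq ae by auto
qed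

section \<open>Square integrable fields\<close>

lemma L2_measurable: "f \<in> L2 \<Omega> \<Longrightarrow> f \<in> borel_measurable (lebesgue_on \<Omega>)"
  and L2_norm_sq: "f \<in> L2 \<Omega> \<Longrightarrow> integrable (lebesgue_on \<Omega>) (\<lambda>x. (norm (f x))\<^sup>2)"
  by (auto simp: L2_def)

lemma L2_inner_integrable:
  assumes "f \<in> L2 \<Omega>" "g \<in> L2 \<Omega>"
  shows "integrable (lebesgue_on \<Omega>) (\<lambda>x. f x \<bullet> g x)"
proof (rule Bochner_Integration.integrable_bound)
  show "integrable (lebesgue_on \<Omega>) (\<lambda>x. (norm (f x))\<^sup>2 + (norm (g x))\<^sup>2)"
    using assms by (intro Bochner_Integration.integrable_add L2_norm_sq)
  show "(\<lambda>x. f x \<bullet> g x) \<in> borel_measurable (lebesgue_on \<Omega>)"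
    using assms by (intro borel_measurable_inner L2_measurable)
  have "\<bar>f x \<bullet> g x\<bar> \<le> (norm (f x))\<^sup>2 + (norm (g x))\<^sup>2" for x
  proof -
    have "\<bar>f x \<bullet> g x\<bar> \<le> norm (f x) * norm (g x)" by (rule Cauchy_Schwarz_ineq2)
    moreover have "2 * (norm (f x) * norm (g x)) \<le> (norm (f x))\<^sup>2 + (norm (g x))\<^sup>2"
      using sum_squares_bound[of "norm (f x)" "norm (g x)"] by (simp add: mult.assoc)
    moreover have "0 \<le> norm (f x) * norm (g x)" by simp
    ultimately show ?thesis by linarith
  qed
  then show "AE x in lebesgue_on \<Omega>. norm (f x \<bullet> g x) \<le> norm ((norm (f x))\<^sup>2 + (norm (g x))\<^sup>2)"
    by (intro AE_I2) simp
qed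

lemma L2_add:
  assumes "f \<in> L2 \<Omega>" "g \<in> L2 \<Omega>"
  shows "(\<lambda>x. f x + g x) \<in> L2 \<Omega>"
proof -
  have "integrable (lebesgue_on \<Omega>) (\<lambda>x. (norm (f x))\<^sup>2 + 2 * (f x \<bullet> g x) + (norm (g x))\<^sup>2)"
    using assms by (intro Bochner_Integration.integrable_add Bochner_Integration.integrable_mult_right L2_norm_sq L2_inner_integrable)
  moreover have "(norm (f x + g x))\<^sup>2 = (norm (f x))\<^sup>2 + 2 * (f x \<bullet> g x) + (norm (g x))\<^sup>2" for x
    by (simp add: power2_norm_eq_inner inner_add_left inner_add_right inner_commute)
  ultimately show ?thesis
    using assms by (auto simp: L2_def)
qed

lemma L2_linear:
  fixes f :: "real^2 \<Rightarrow> 'b::euclidean_space" and A :: "'b \<Rightarrow> 'c::euclidean_space"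
  assumes "f \<in> L2 \<Omega>" "linear A"
  shows "(\<lambda>x. A (f x)) \<in> L2 \<Omega>"
proof -
  obtain B where B: "0 < B" "\<And>x. norm (A x) \<le> B * norm x" using linear_bounded_pos[OF assms(2)] by blast
  have cA: "continuous_on UNIV A" using assms(2) by (simp add: linear_continuous_on linear_conv_bounded_linear)
  have m: "(\<lambda>x. A (f x)) \<in> borel_measurable (lebesgue_on \<Omega>)"
    by (rule measurable_compose[OF L2_measurable[OF assms(1)]]) (simp add: borel_measurable_continuous_onI cA)
  have le: "(norm (A (f x)))\<^sup>2 \<le> B\<^sup>2 * (norm (f x))\<^sup>2" for x
    using power_mono[OF B(2), of "f x" 2] by (simp add: power_mult_distrib)
  have "integrable (lebesgue_on \<Omega>) (\<lambda>x. (norm (A (f x)))\<^sup>2)"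
    using m le by (intro Bochner_Integration.integrable_bound[OF integrable_mult_right[OF L2_norm_sq[OF assms(1)], of "B\<^sup>2"]])
      (auto intro!: AE_I2 borel_measurable_power borel_measurable_norm)
  then show ?thesis using m by (simp add: L2_def)
qed

lemma L2_diff:
  assumes "f \<in> L2 \<Omega>" "g \<in> L2 \<Omega>"
  shows "(\<lambda>x. f x - g x) \<in> L2 \<Omega>"
  using L2_add[OF assms(1) L2_linear[OF assms(2), of uminus]] by (simp add: linear_uminus module_hom_uminus)

lemma L2_integrable:
  fixes g :: "real^2 \<Rightarrow> 'b::euclidean_space"
  assumes "g \<in> L2 \<Omega>" "\<Omega> \<in> lmeasurable"
  shows "integrable (lebesgue_on \<Omega>) g"
proof (rule Bochner_Integration.integrable_bound)
  show "integrable (lebesgue_on \<Omega>) (\<lambda>x. 1 + (norm (g x))\<^sup>2)"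
    using assms by (intro Bochner_Integration.integrable_add L2_norm_sq) (auto simp: lmeasurable_iff_integrable_on integrable_on_lebesgue_on
        fmeasurable_def emeasure_restrict_space intro!: finite_measure.integrable_const finite_measureI)
  show "AE x in lebesgue_on \<Omega>. norm (g x) \<le> norm (1 + (norm (g x))\<^sup>2)"
  proof (rule AE_I2)
    fix x
    have "0 \<le> (norm (g x) - 1)\<^sup>2" by simp
    then have "2 * norm (g x) \<le> 1 + (norm (g x))\<^sup>2" by (simp add: power2_diff)
    moreover have "0 \<le> norm (g x)" by simp
    ultimately have "norm (g x) \<le> 1 + (norm (g x))\<^sup>2" by linarith
    then show "norm (g x) \<le> norm (1 + (norm (g x))\<^sup>2)" by simp
  qed
qed (use assms L2_measurable in blast)

text \<open>Cauchy-Schwarz for a form that is only known to be nonnegative along a line; the leading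
  coefficient N may be zero and is then treated apart.\<close>

lemma quadratic_nonneg_discriminant:
  fixes P Q N :: real
  assumes "\<And>y. 0 \<le> P + 2 * y * Q + y\<^sup>2 * N" and "0 \<le> N"
  shows "Q\<^sup>2 \<le> P * N"
proof (cases "N = 0")
  case True
  have "Q = 0"
  proof (rule ccontr)
    assume "Q \<noteq> 0"
    \<comment> \<open>At this y the affine function P + 2 y Q takes the value -1.\<close>
    then show False using assms(1)[of "- (P + 1) / (2 * Q)"] True by (simp add: field_simps)
  qed
  then show ?thesis using True by simp
next
  case False
  then have N: "0 < N" using assms(2) by simp
  have "0 \<le> P + 2 * (- Q / N) * Q + (- Q / N)\<^sup>2 * N" by (rule assms)
  also have "\<dots> = P - Q\<^sup>2 / N" using N by (simp add: field_simps power2_eq_square)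
  finally show ?thesis using N by (simp add: field_simps)
qed

section \<open>The error functional\<close>

text \<open>Having zero as a weak divergence does not by itself determine the representative chosen
  in \<open>wdiv\<close>; the fundamental lemma does, up to a null set.\<close>

lemma wdiv_zero:
  assumes "open \<Omega>" "bounded \<Omega>" "has_weak_div \<Omega> \<tau> (\<lambda>_. 0)"
  shows "AE x in lebesgue_on \<Omega>. wdiv \<Omega> \<tau> x = 0"
proof -
  have lm: "\<Omega> \<in> lmeasurable" using assms lmeasurable_open by blast
  have z: "(\<lambda>_. 0) \<in> L2 \<Omega>" by (simp add: L2_def)
  have g: "wdiv \<Omega> \<tau> \<in> L2 \<Omega> \<and> has_weak_div \<Omega> \<tau> (wdiv \<Omega> \<tau>)"
    unfolding wdiv_def by (rule someI[of _ "\<lambda>_. 0"]) (use z assms in auto)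
  have "(LINT x|lebesgue_on \<Omega>. \<phi> x *\<^sub>R wdiv \<Omega> \<tau> x) = 0" if "\<phi> \<in> test_functions \<Omega>" for \<phi>
    using g assms(3) that by (auto simp: has_weak_div_def)
  then show ?thesis
    using AE_zero_of_test_functions[OF assms(1) L2_integrable[OF _ lm]] g by blast
qed

lemma stress_orthogonal:
  assumes \<Omega>: "open \<Omega>" "bounded \<Omega>" and sol: "mixed_solution \<Omega> A f (Hdiv_Sym \<Omega>) (L2 \<Omega>) \<sigma> u"
    and \<tau>: "\<tau> \<in> L2 \<Omega>" "\<And>x. \<tau> x \<in> Sym" "has_weak_div \<Omega> \<tau> (\<lambda>_. 0)"
  shows "L2_inner \<Omega> (\<lambda>x. A (\<sigma> x)) \<tau> = 0"
proof -
  have "(\<lambda>_. 0) \<in> L2 \<Omega>" by (simp add: L2_def)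
  then have "\<tau> \<in> Hdiv_Sym \<Omega>" using \<tau> by (auto simp: Hdiv_Sym_def)
  then have "L2_inner \<Omega> (\<lambda>x. A (\<sigma> x)) \<tau> + L2_inner \<Omega> (wdiv \<Omega> \<tau>) u = 0"
    using sol by (simp add: mixed_solution_def)
  moreover have "L2_inner \<Omega> (wdiv \<Omega> \<tau>) u = 0"
    unfolding L2_inner_def by (rule integral_eq_zero_AE) (use wdiv_zero[OF \<Omega> \<tau>(3)] in \<open>eventually_elim, simp\<close>)
  ultimately show ?thesis by simp
qed

text \<open>The tensor A enters the estimates through two numbers that stay bounded as
  \<open>lam\<close> grows: \<beta> bounds the energy of the test tensors, and \<rho> bounds the tn
  component of A (t x t) by its tt component. The latter is the proportion in which the jumps of
  these components occur across interior edges.\<close>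

locale discrete_problem =
  fixes k :: nat and \<kappa> \<beta> \<rho> :: real and A :: "real^2^2 \<Rightarrow> real^2^2" and \<Omega> :: "(real^2) set" and \<T> :: "(real^2) set set"
    and f u :: "real^2 \<Rightarrow> real^2" and \<sigma> \<sigma>h :: "real^2 \<Rightarrow> real^2^2"
  assumes kappa: "1 \<le> \<kappa>" and rho_nonneg: "0 \<le> \<rho>" and beta_nonneg: "0 \<le> \<beta>"
    and compliance: "compliance_tensor A"
    and upper: "\<And>\<tau>. \<tau> \<in> Sym \<Longrightarrow> A \<tau> \<bullet> \<tau> \<le> \<beta> * (norm \<tau>)\<^sup>2"
    and ratio: "\<And>\<nu>. norm \<nu> = 1 \<Longrightarrow> \<bar>(A (outer (perp \<nu>) (perp \<nu>)) *v perp \<nu>) \<bullet> \<nu>\<bar> \<le> \<rho> * ((A (outer (perp \<nu>) (perp \<nu>)) *v perp \<nu>) \<bullet> perp \<nu>)"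
    and domain: "polygonal_domain \<Omega>" and mesh: "mesh \<Omega> \<T>" and regular: "shape_regular \<kappa> \<T>"
    and sol: "mixed_solution \<Omega> A f (Hdiv_Sym \<Omega>) (L2 \<Omega>) \<sigma> u"
    and sigma_h: "\<sigma>h \<in> Sigma_h k \<Omega> \<T>"
begin

lemma linear_A: "linear A" and A_Sym: "\<tau> \<in> Sym \<Longrightarrow> A \<tau> \<in> Sym"
  and A_symmetric: "\<tau> \<in> Sym \<Longrightarrow> \<tau>' \<in> Sym \<Longrightarrow> A \<tau> \<bullet> \<tau>' = \<tau> \<bullet> A \<tau>'"
  and A_nonneg: "\<tau> \<in> Sym \<Longrightarrow> 0 \<le> A \<tau> \<bullet> \<tau>"
proof -
  show lin: "linear A" using compliance by (simp add: compliance_tensor_def)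
  show "\<tau> \<in> Sym \<Longrightarrow> A \<tau> \<in> Sym" "\<tau> \<in> Sym \<Longrightarrow> \<tau>' \<in> Sym \<Longrightarrow> A \<tau> \<bullet> \<tau>' = \<tau> \<bullet> A \<tau>'"
    using compliance by (auto simp: compliance_tensor_def)
  show "\<tau> \<in> Sym \<Longrightarrow> 0 \<le> A \<tau> \<bullet> \<tau>"
    using compliance linear_0[OF lin] by (cases "\<tau> = 0") (auto simp: compliance_tensor_def less_imp_le)
qed

lemmas Omega = polygonal_domain_facts[OF domain]

lemma Omega_lmeasurable: "\<Omega> \<in> lmeasurable"
  using Omega(1,2) lmeasurable_open by blast

lemma sigma_props: "\<sigma> \<in> L2 \<Omega>" "AE x in lebesgue_on \<Omega>. \<sigma> x \<in> Sym"
  using sol by (auto simp: mixed_solution_def Hdiv_Sym_def)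

lemma sigma_h_props: "\<sigma>h \<in> L2 \<Omega>" "AE x in lebesgue_on \<Omega>. \<sigma>h x \<in> Sym"
proof -
  obtain \<tau> b where tb: "\<tau> \<in> H1_space k \<Omega> \<T>" "b \<in> bubble_space k \<Omega> \<T>" "\<sigma>h = (\<lambda>x. \<tau> x + b x)"
    using Sigma_h_decomp[OF sigma_h] .
  have t: "\<tau> \<in> L2 \<Omega>" "AE x in lebesgue_on \<Omega>. \<tau> x \<in> Sym" and b: "b \<in> L2 \<Omega>" "AE x in lebesgue_on \<Omega>. b x \<in> Sym"
    using tb by (auto simp: H1_space_def bubble_space_def H1_Sym_def Hdiv_Sym_def)
  show "\<sigma>h \<in> L2 \<Omega>" unfolding tb(3) by (rule L2_add[OF t(1) b(1)])
  show "AE x in lebesgue_on \<Omega>. \<sigma>h x \<in> Sym" using t(2) b(2) unfolding tb(3) by eventually_elim (rule Sym_closed)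
qed

definition err :: "real^2 \<Rightarrow> real^2^2" where "err x = \<sigma> x - \<sigma>h x"

definition energy :: "(real^2) set \<Rightarrow> real" where
  "energy D = (LINT x|lebesgue_on \<Omega>. indicator D x * (A (err x) \<bullet> err x))"

lemma err_props: "err \<in> L2 \<Omega>" "AE x in lebesgue_on \<Omega>. err x \<in> Sym"
proof -
  show "err \<in> L2 \<Omega>" unfolding err_def [abs_def] by (rule L2_diff[OF sigma_props(1) sigma_h_props(1)])
  show "AE x in lebesgue_on \<Omega>. err x \<in> Sym"
    using sigma_props(2) sigma_h_props(2) unfolding err_def by eventually_elim (rule Sym_closed)
qed

lemma integrable_indicator_inner:
  assumes "g \<in> L2 \<Omega>" "g' \<in> L2 \<Omega>" "D \<in> sets lebesgue"
  shows "integrable (lebesgue_on \<Omega>) (\<lambda>x. indicator D x * (g x \<bullet> g' x))"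
proof -
  have "D \<inter> \<Omega> \<in> sets (lebesgue_on \<Omega>)" using assms(3) Omega(3) by (simp add: sets_restrict_space_iff)
  then have "integrable (lebesgue_on \<Omega>) (\<lambda>x. indicator (D \<inter> \<Omega>) x *\<^sub>R (g x \<bullet> g' x))"
    using integrable_mult_indicator[OF _ L2_inner_integrable[OF assms(1,2)]] by blast
  then show ?thesis
    by (rule Bochner_Integration.integrable_cong[THEN iffD1, rotated 2]) (auto simp: indicator_def)
qed

lemma energy_integrable: "D \<in> sets lebesgue \<Longrightarrow> integrable (lebesgue_on \<Omega>) (\<lambda>x. indicator D x * (A (err x) \<bullet> err x))"
  by (intro integrable_indicator_inner L2_linear[OF err_props(1) linear_A] err_props(1))

lemma AE_energy_nonneg: "AE x in lebesgue_on \<Omega>. 0 \<le> A (err x) \<bullet> err x"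
  using err_props(2) by eventually_elim (rule A_nonneg)

lemma energy_nonneg: "0 \<le> energy D"
  unfolding energy_def using AE_energy_nonneg by (intro integral_nonneg_AE) (auto elim!: eventually_mono)

lemma energy_Un:
  assumes "D \<in> sets lebesgue" "D' \<in> sets lebesgue"
  shows "energy (D \<union> D') \<le> energy D + energy D'"
proof -
  have "energy (D \<union> D') \<le> (LINT x|lebesgue_on \<Omega>. indicator D x * (A (err x) \<bullet> err x) + indicator D' x * (A (err x) \<bullet> err x))"
    unfolding energy_def
    by (rule integral_mono_AE[OF energy_integrable Bochner_Integration.integrable_add[OF energy_integrable[OF assms(1)] energy_integrable[OF assms(2)]]])
       (use AE_energy_nonneg assms in \<open>auto elim!: eventually_mono simp: indicator_def\<close>)
  then show ?thesis
    unfolding energy_def using energy_integrable[OF assms(1)] energy_integrable[OF assms(2)] by simp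
qed

lemma AE_in_Omega: "AE x in lebesgue. x \<in> closure \<Omega> \<longrightarrow> x \<in> \<Omega>"
proof -
  have "frontier \<Omega> \<in> null_sets lebesgue" using Omega(4) by (simp add: negligible_iff_null_sets)
  from AE_not_in[OF this] show ?thesis
    using Omega(1) by (auto simp: frontier_def interior_open elim!: eventually_mono)
qed

text \<open>Distinct triangles overlap in null sets only, so the indicators of all triangles add up
  to at most 1 almost everywhere.\<close>

lemma sum_energy_le: "(\<Sum>K\<in>\<T>. energy K) \<le> (norm_A \<Omega> A err)\<^sup>2"
proof -
  have fin: "finite \<T>" using mesh_facts(1)[OF mesh] .
  have m: "K \<in> sets lebesgue" if "K \<in> \<T>" for K using simplex_2_facts(3) mesh_facts(2)[OF mesh that] .
  have "finite {K \<inter> K' |K K'. K \<in> \<T> \<and> K' \<in> \<T> \<and> K \<noteq> K'}"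
    by (rule finite_subset[of _ "(\<lambda>(K, K'). K \<inter> K') ` (\<T> \<times> \<T>)"]) (use fin in auto)
  moreover have "\<forall>D\<in>{K \<inter> K' |K K'. K \<in> \<T> \<and> K' \<in> \<T> \<and> K \<noteq> K'}. negligible D"
    using mesh_Int_interior(2)[OF mesh] by blast
  ultimately have "negligible (\<Union>{K \<inter> K' |K K'. K \<in> \<T> \<and> K' \<in> \<T> \<and> K \<noteq> K'})"
    using negligible_Union by blast
  then have "AE x in lebesgue. x \<notin> \<Union>{K \<inter> K' |K K'. K \<in> \<T> \<and> K' \<in> \<T> \<and> K \<noteq> K'}"
    by (intro AE_not_in) (simp add: negligible_iff_null_sets)
  then have ae1: "AE x in lebesgue. (\<Sum>K\<in>\<T>. indicat_real K x) \<le> 1"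
  proof eventually_elim
    case (elim x)
    have "card {K\<in>\<T>. x \<in> K} \<le> 1"
    proof (rule ccontr)
      assume "\<not> card {K\<in>\<T>. x \<in> K} \<le> 1"
      then obtain K K' where "K \<in> \<T>" "K' \<in> \<T>" "x \<in> K" "x \<in> K'" "K \<noteq> K'"
        using fin by (auto simp: card_le_Suc0_iff_eq)
      then show False using elim by blast
    qed
    moreover have "(\<Sum>K\<in>\<T>. indicat_real K x) = real (card {K\<in>\<T>. x \<in> K})"
      using fin by (simp add: indicator_def sum.If_cases Int_def)
    ultimately show ?case by simp
  qed
  then have ae: "AE x in lebesgue_on \<Omega>. (\<Sum>K\<in>\<T>. indicat_real K x) \<le> 1"
    using Omega(3) by (simp add: AE_restrict_space_iff eventually_mono)
  have "(\<Sum>K\<in>\<T>. energy K) = (LINT x|lebesgue_on \<Omega>. (\<Sum>K\<in>\<T>. indicator K x * (A (err x) \<bullet> err x)))"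
    unfolding energy_def using energy_integrable[OF m] by (subst Bochner_Integration.integral_sum) auto
  also have "\<dots> \<le> (LINT x|lebesgue_on \<Omega>. A (err x) \<bullet> err x)"
  proof (rule integral_mono_AE)
    show "AE x in lebesgue_on \<Omega>. (\<Sum>K\<in>\<T>. indicator K x * (A (err x) \<bullet> err x)) \<le> A (err x) \<bullet> err x"
      using ae AE_energy_nonneg
    proof eventually_elim
      case (elim x)
      then have "(\<Sum>K\<in>\<T>. indicat_real K x) * (A (err x) \<bullet> err x) \<le> 1 * (A (err x) \<bullet> err x)"
        by (intro mult_right_mono)
      then show ?case by (simp add: sum_distrib_right)
    qed
  qed (use energy_integrable[OF m] L2_inner_integrable[OF L2_linear[OF err_props(1) linear_A] err_props(1)] in auto)
  also have "\<dots> = (norm_A \<Omega> A err)\<^sup>2"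
    unfolding norm_A_def L2_inner_def
    by (subst real_sqrt_pow2) (use AE_energy_nonneg in \<open>auto intro!: integral_nonneg_AE\<close>)
  finally show ?thesis .
qed

text \<open>Orthogonality of A \<sigma> to the test tensor turns the pairing into minus the A-inner
  product of the error with it, and Cauchy-Schwarz is applied on D only. It is derived from the
  nonnegative energy of \<open>err\<close> + y \<tau> on D as a quadratic in y.\<close>

lemma residual_bound:
  assumes \<tau>: "\<tau> \<in> L2 \<Omega>" "\<And>x. \<tau> x \<in> Sym" "has_weak_div \<Omega> \<tau> (\<lambda>_. 0)" and D: "D \<in> sets lebesgue" "\<And>x. x \<notin> D \<Longrightarrow> \<tau> x = 0"
  shows "(L2_inner \<Omega> (\<lambda>x. A (\<sigma>h x)) \<tau>)\<^sup>2 \<le> energy D * (\<beta> * (LINT x|lebesgue_on \<Omega>. (norm (\<tau> x))\<^sup>2))"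
proof -
  let ?M = "lebesgue_on \<Omega>"
  define Q where "Q = (LINT x|?M. indicator D x * (A (err x) \<bullet> \<tau> x))"
  define N where "N = (LINT x|?M. indicator D x * (A (\<tau> x) \<bullet> \<tau> x))"
  note LA = L2_linear[OF _ linear_A]
  have iQ: "integrable ?M (\<lambda>x. indicator D x * (A (err x) \<bullet> \<tau> x))" 
    and iN: "integrable ?M (\<lambda>x. indicator D x * (A (\<tau> x) \<bullet> \<tau> x))"
    by (intro integrable_indicator_inner LA \<tau> err_props D(1))+
  have "L2_inner \<Omega> (\<lambda>x. A (\<sigma>h x)) \<tau> = L2_inner \<Omega> (\<lambda>x. A (\<sigma> x)) \<tau> - (LINT x|?M. A (err x) \<bullet> \<tau> x)"
  proof -
    have "A (err x) \<bullet> \<tau> x = A (\<sigma> x) \<bullet> \<tau> x - A (\<sigma>h x) \<bullet> \<tau> x" for x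
      by (simp add: err_def linear_diff[OF linear_A] inner_diff_left)
    moreover have "integrable ?M (\<lambda>x. A (\<sigma> x) \<bullet> \<tau> x)" "integrable ?M (\<lambda>x. A (\<sigma>h x) \<bullet> \<tau> x)"
      by (intro L2_inner_integrable LA sigma_props(1) sigma_h_props(1) \<tau>(1))+
    ultimately show ?thesis unfolding L2_inner_def by simp
  qed
  also have "L2_inner \<Omega> (\<lambda>x. A (\<sigma> x)) \<tau> = 0" by (rule stress_orthogonal[OF Omega(1,2) sol \<tau>])
  also have "(LINT x|?M. A (err x) \<bullet> \<tau> x) = Q"
    unfolding Q_def by (rule Bochner_Integration.integral_cong) (use D(2) in \<open>auto simp: indicator_def\<close>)
  finally have L: "(L2_inner \<Omega> (\<lambda>x. A (\<sigma>h x)) \<tau>)\<^sup>2 = Q\<^sup>2" by simp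
  have "0 \<le> energy D + 2 * y * Q + y\<^sup>2 * N" for y
  proof -
    have "AE x in ?M. 0 \<le> indicator D x * (A (err x) \<bullet> err x) + 2 * y * (indicator D x * (A (err x) \<bullet> \<tau> x)) + y\<^sup>2 * (indicator D x * (A (\<tau> x) \<bullet> \<tau> x))"
      using err_props(2)
    proof eventually_elim
      case (elim x)
      have "0 \<le> A (err x + y *\<^sub>R \<tau> x) \<bullet> (err x + y *\<^sub>R \<tau> x)"
        by (intro A_nonneg Sym_closed elim \<tau>(2))
      also have "\<dots> = A (err x) \<bullet> err x + 2 * y * (A (err x) \<bullet> \<tau> x) + y\<^sup>2 * (A (\<tau> x) \<bullet> \<tau> x)"
        using A_symmetric[OF elim \<tau>(2)[of x]]
        by (simp add: linear_add[OF linear_A] linear_scale[OF linear_A] inner_add_left inner_add_right power2_eq_square inner_commute algebra_simps)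
      finally show ?case by (cases "x \<in> D") auto
    qed
    then have "0 \<le> (LINT x|?M. indicator D x * (A (err x) \<bullet> err x) + 2 * y * (indicator D x * (A (err x) \<bullet> \<tau> x)) + y\<^sup>2 * (indicator D x * (A (\<tau> x) \<bullet> \<tau> x)))"
      by (rule integral_nonneg_AE)
    also have "\<dots> = energy D + 2 * y * Q + y\<^sup>2 * N"
      unfolding energy_def Q_def N_def using energy_integrable[OF D(1)] iQ iN by simp
    finally show ?thesis .
  qed
  moreover have "0 \<le> N"
    unfolding N_def using A_nonneg[OF \<tau>(2)] by (intro Bochner_Integration.integral_nonneg) simp
  ultimately have "Q\<^sup>2 \<le> energy D * N" by (rule quadratic_nonneg_discriminant)
  also have "N \<le> \<beta> * (LINT x|?M. (norm (\<tau> x))\<^sup>2)"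
  proof -
    have "N \<le> (LINT x|?M. \<beta> * (norm (\<tau> x))\<^sup>2)"
      unfolding N_def using upper[OF \<tau>(2)] beta_nonneg
      by (intro integral_mono iN Bochner_Integration.integrable_mult_right L2_norm_sq \<tau>(1)) (auto simp: indicator_def)
    then show ?thesis by simp
  qed
  finally show ?thesis unfolding L using energy_nonneg by (simp add: mult_left_mono)
qed

end

section \<open>Local efficiency\<close>

definition airy_sq :: "real \<Rightarrow> real \<Rightarrow> real \<Rightarrow> real \<Rightarrow> real poly \<Rightarrow> real poly \<Rightarrow> real" where
  "airy_sq s0 s1 l u B C = integral (cbox (s0, l) (s1, u))
     (\<lambda>p. (poly B (fst p) * poly (pderiv (pderiv C)) (snd p))\<^sup>2
     + 2 * (poly (pderiv B) (fst p) * poly (pderiv C) (snd p))\<^sup>2 + (poly (pderiv (pderiv B)) (fst p) * poly C (snd p))\<^sup>2)"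

lemma airy_sq_nonneg: "0 \<le> airy_sq s0 s1 l u B C"
  unfolding airy_sq_def by (intro Henstock_Kurzweil_Integration.integral_nonneg integrable_continuous continuous_intros) auto

text \<open>A finite family of bumps on the reference rectangles \<open>[1/4, 3/4] \<times> [-d, 0]\<close> and
  \<open>[1/4, 3/4] \<times> [0, d]\<close> whose residual functionals read off all coefficients of the residuals.\<close>

definition reference_bumps :: "nat \<Rightarrow> real \<Rightarrow> real \<Rightarrow> (nat \<Rightarrow> real poly) \<Rightarrow> (nat \<Rightarrow> real poly) \<Rightarrow>
    (real \<Rightarrow> real \<Rightarrow> real poly) \<Rightarrow> (real \<Rightarrow> real \<Rightarrow> real poly) \<Rightarrow> bool" where
  "reference_bumps k d N B D Cm Cp \<longleftrightarrow>
     (\<forall>i\<le>k. vanish3 (B i) (1/4) \<and> vanish3 (B i) (3/4) \<and>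
        (\<forall>a\<le>k. integral {1/4..3/4} (\<lambda>s. s ^ a * poly (B i) s) = (if a = i then 1 else 0))) \<and>
     (\<forall>j\<le>k. vanish3 (D j) (- d) \<and> vanish3 (D j) 0 \<and>
        (\<forall>a\<le>k. integral {- d..0} (\<lambda>r. r ^ a * poly (D j) r) = (if a = j then 1 else 0))) \<and>
     (\<forall>\<alpha> \<beta>. poly (Cm \<alpha> \<beta>) 0 = \<alpha> \<and> poly (pderiv (Cm \<alpha> \<beta>)) 0 = \<beta> \<and> vanish3 (Cm \<alpha> \<beta>) (- d) \<and>
        (\<forall>j\<le>k. integral {- d..0} (\<lambda>r. r ^ j * poly (Cm \<alpha> \<beta>) r) = 0)) \<and>
     (\<forall>\<alpha> \<beta>. poly (Cp \<alpha> \<beta>) 0 = \<alpha> \<and> poly (pderiv (Cp \<alpha> \<beta>)) 0 = \<beta> \<and> vanish3 (Cp \<alpha> \<beta>) d \<and>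
        (\<forall>j\<le>k. integral {0..d} (\<lambda>r. r ^ j * poly (Cp \<alpha> \<beta>) r) = 0)) \<and>
     (\<forall>i\<le>k. \<forall>j\<le>k. airy_sq (1/4) (3/4) (- d) 0 (B i) (D j) \<le> N) \<and>
     (\<forall>i\<le>k. \<forall>(\<alpha>, \<beta>)\<in>{(0, 1), (1, 0)}.
        airy_sq (1/4) (3/4) (- d) 0 (B i) (Cm \<alpha> \<beta>) + airy_sq (1/4) (3/4) 0 d (B i) (Cp \<alpha> \<beta>) \<le> N)"

lemma reference_bumps_exist:
  assumes "0 < d"
  shows "\<exists>N B D Cm Cp. 0 \<le> N \<and> reference_bumps k d N B D Cm Cp"
proof -
  obtain B where B: "\<forall>i\<le>k. vanish3 (B i) (1/4) \<and> vanish3 (B i) (3/4) \<and>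
        (\<forall>a\<le>k. integral {1/4..3/4} (\<lambda>s. s ^ a * poly (B i) s) = (if a = i then 1 else 0))"
    using dual_bump_polys[of "1/4" "3/4" k] by auto
  obtain D where D: "\<forall>j\<le>k. vanish3 (D j) (- d) \<and> vanish3 (D j) 0 \<and>
        (\<forall>a\<le>k. integral {- d..0} (\<lambda>r. r ^ a * poly (D j) r) = (if a = j then 1 else 0))"
    using dual_bump_polys[of "- d" 0 k] assms by auto
  have "\<forall>\<alpha> \<beta>. \<exists>C. poly C 0 = \<alpha> \<and> poly (pderiv C) 0 = \<beta> \<and> vanish3 C (- d) \<and> (\<forall>j\<le>k. integral {- d..0} (\<lambda>r. r ^ j * poly C r) = 0)"
    using edge_bump_poly[of 0 "- d" _ _ k] assms by simp
  then obtain Cm where Cm: "\<forall>\<alpha> \<beta>. poly (Cm \<alpha> \<beta>) 0 = \<alpha> \<and> poly (pderiv (Cm \<alpha> \<beta>)) 0 = \<beta> \<and> vanish3 (Cm \<alpha> \<beta>) (- d) \<and>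
        (\<forall>j\<le>k. integral {- d..0} (\<lambda>r. r ^ j * poly (Cm \<alpha> \<beta>) r) = 0)" by metis
  have "\<forall>\<alpha> \<beta>. \<exists>C. poly C 0 = \<alpha> \<and> poly (pderiv C) 0 = \<beta> \<and> vanish3 C d \<and> (\<forall>j\<le>k. integral {0..d} (\<lambda>r. r ^ j * poly C r) = 0)"
    using edge_bump_poly[of 0 d _ _ k] assms by simp
  then obtain Cp where Cp: "\<forall>\<alpha> \<beta>. poly (Cp \<alpha> \<beta>) 0 = \<alpha> \<and> poly (pderiv (Cp \<alpha> \<beta>)) 0 = \<beta> \<and> vanish3 (Cp \<alpha> \<beta>) d \<and>
        (\<forall>j\<le>k. integral {0..d} (\<lambda>r. r ^ j * poly (Cp \<alpha> \<beta>) r) = 0)" by metis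
  define a1 where "a1 = (\<lambda>(i, j). airy_sq (1/4) (3/4) (- d) 0 (B i) (D j))"
  define a2 where "a2 = (\<lambda>(i, \<alpha>, \<beta>). airy_sq (1/4) (3/4) (- d) 0 (B i) (Cm \<alpha> \<beta>) + airy_sq (1/4) (3/4) 0 d (B i) (Cp \<alpha> \<beta>))"
  let ?I = "{..k} \<times> {..k}" and ?J = "{..k} \<times> {(0::real, 1::real), (1, 0)}"
  \<comment> \<open>A sum of nonnegative terms bounds each of them. The index sets are finite and
    the bumps live on reference rectangles, so N depends on k and d alone.\<close>
  define N where "N = (\<Sum>x\<in>?I. a1 x) + (\<Sum>x\<in>?J. a2 x)"
  have nn: "0 \<le> a1 x" "0 \<le> a2 y" for x y
    by (auto simp: a1_def a2_def case_prod_unfold airy_sq_nonneg)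
  have le1: "a1 x \<le> N" if "x \<in> ?I" for x
    unfolding N_def using member_le_sum[OF that, of a1] nn sum_nonneg[of ?J a2] by (smt (verit) finite_SigmaI finite_atMost)
  have le2: "a2 x \<le> N" if "x \<in> ?J" for x
    unfolding N_def using member_le_sum[OF that, of a2] nn sum_nonneg[of ?I a1] by (smt (verit) finite_SigmaI finite_atMost finite.intros)
  have "0 \<le> N" unfolding N_def using nn by (intro add_nonneg_nonneg sum_nonneg) auto
  moreover have "reference_bumps k d N B D Cm Cp"
    unfolding reference_bumps_def
    by (intro conjI B D Cm Cp) (use le1 le2 in \<open>fastforce simp: a1_def a2_def\<close>)+
  ultimately show ?thesis by blast
qed

lemma integrable_lebesgue_on_subset:
  fixes f :: "'a::euclidean_space \<Rightarrow> 'b::euclidean_space"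
  assumes "integrable lebesgue f" "\<Omega> \<in> sets lebesgue"
  shows "integrable (lebesgue_on \<Omega>) f"
  using integrable_mult_indicator[OF assms(2,1)] assms(2) by (simp add: integrable_lebesgue_on_iff)

lemma integral_lebesgue_on_le:
  fixes f :: "'a::euclidean_space \<Rightarrow> real"
  assumes "integrable lebesgue f" "\<Omega> \<in> sets lebesgue" "\<And>x. 0 \<le> f x"
  shows "(LINT x|lebesgue_on \<Omega>. f x) \<le> (LINT x|lebesgue. f x)"
  unfolding integral_lebesgue_on_eq[OF assms(2)]
  by (rule integral_mono[OF integrable_mult_indicator[OF assms(2,1)] assms(1)]) (use assms(3) in \<open>auto simp: indicator_def\<close>)

context frame
begin

lemma test_tensor_L2: "\<Omega> \<in> sets lebesgue \<Longrightarrow> test_tensor s0 s1 l u B C \<in> L2 \<Omega>"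
  using integrable_lebesgue_on_subset[OF test_tensor_integrable(2)[of s0 s1 l u B C]]
    measurable_restrict_space1[OF borel_measurable_integrable[OF test_tensor_integrable(1)[of s0 s1 l u B C]]]
  by (auto simp: L2_def)

lemma test_tensor_norm_le: "\<Omega> \<in> sets lebesgue \<Longrightarrow> (LINT x|lebesgue_on \<Omega>. (norm (test_tensor s0 s1 l u B C x))\<^sup>2) \<le> h\<^sup>2 * airy_sq s0 s1 l u B C"
  using integral_lebesgue_on_le[OF test_tensor_integrable(2)[of s0 s1 l u B C], of \<Omega>]
  by (simp add: test_tensor_integrable(3) airy_sq_def)

end

text \<open>The pairing and the squared norm of the test tensor both scale like h ^ 2. After
  squaring the pairing, a factor 1 / h ^ 2 is left in front of the energy.\<close>

lemma scaled_square_bound: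
  fixes h x E \<beta> N :: real
  assumes "(h\<^sup>2 * x)\<^sup>2 \<le> E * (\<beta> * (h\<^sup>2 * N))" "0 < h"
  shows "x\<^sup>2 \<le> \<beta> * N * E / h\<^sup>2"
proof -
  have "h\<^sup>2 * (h\<^sup>2 * x\<^sup>2) \<le> h\<^sup>2 * (\<beta> * N * E)"
    using assms(1) by (simp add: power_mult_distrib power2_eq_square mult_ac)
  then have "h\<^sup>2 * x\<^sup>2 \<le> \<beta> * N * E" using assms(2) by (subst (asm) mult_le_cancel_left_pos) auto
  then show ?thesis using assms(2) by (simp add: field_simps)
qed

section \<open>Bounds for single coefficients of the residuals by the local energy\<close>

context discrete_problem
begin

definition stress :: "(real^2) set \<Rightarrow> real^2 \<Rightarrow> real^2^2" where
  "stress K x = A (piece \<sigma>h K x)"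

definition width :: real where "width = 1 / (4 * \<kappa> * (1 + \<kappa>))"

lemma width_pos: "0 < width" using kappa by (simp add: width_def)

lemma stress_polys_Sym: "K \<in> \<T> \<Longrightarrow> stress K \<in> polys_Sym k"
  using piece_Sigma_h(1)[OF mesh regular kappa sigma_h, of K] polys_linear[OF _ linear_A]
  by (auto simp: polys_Sym_def stress_def [abs_def] image_subset_iff A_Sym)

lemma mesh_element: "K \<in> \<T> \<Longrightarrow> 2 simplex K" "K \<in> \<T> \<Longrightarrow> diameter K \<le> \<kappa> * inball_diameter K" "K \<in> \<T> \<Longrightarrow> K \<in> sets lebesgue"
  "K \<in> \<T> \<Longrightarrow> K \<subseteq> closure \<Omega>"
  using mesh_facts[OF mesh] regular simplex_2_facts(3) by (auto simp: shape_regular_def)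

lemma L2_inner_test_tensor:
  assumes fr: "frame \<nu> h" and K: "K \<in> \<T>" and sub: "frame.rect a \<nu> h s0 s1 r0 r1 \<subseteq> K"
    and mf: "frame.matrix_field a \<nu> h k c11 c12 c22 (stress K)"
  shows "L2_inner \<Omega> (\<lambda>x. A (\<sigma>h x)) (frame.test_tensor a \<nu> h s0 s1 r0 r1 B C) =
     h\<^sup>2 * integral (cbox (s0, r0) (s1, r1))
       (\<lambda>p. residual k (frame.ctt \<nu> c11 c12 c22) (frame.ctn \<nu> c11 c12 c22) (frame.cnn \<nu> c11 c12 c22) B C (fst p) (snd p))"
proof -
  interpret frame a \<nu> h by (rule fr)
  let ?r = "residual k (ctt c11 c12 c22) (ctn c11 c12 c22) (cnn c11 c12 c22) B C"
  have inner: "stress K x \<bullet> airy B C (S x) (R x) = ?r (S x) (R x)" for x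
    unfolding inner_airy[OF matrix_field_Sym[OF mf]] matrix_field_frame[OF mf] residual_def ..
  have cont: "continuous_on (cbox (s0, r0) (s1, r1)) (\<lambda>p. ?r (S (F (fst p) (snd p))) (R (F (fst p) (snd p))))"
    unfolding residual_def S_F R_F by (intro continuous_intros)
  have aeK: "AE x in lebesgue. x \<in> K \<longrightarrow> \<sigma>h x = piece \<sigma>h K x"
    using piece_Sigma_h(2)[OF mesh regular kappa sigma_h K] mesh_element(3)[OF K] by (simp add: AE_restrict_space_iff)
  have "L2_inner \<Omega> (\<lambda>x. A (\<sigma>h x)) (test_tensor s0 s1 r0 r1 B C) = (LINT x|lebesgue. indicator \<Omega> x *\<^sub>R (A (\<sigma>h x) \<bullet> test_tensor s0 s1 r0 r1 B C x))"
    unfolding L2_inner_def using Omega(3) by (rule integral_lebesgue_on_eq)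
  also have "\<dots> = (LINT x|lebesgue. indicator (rect s0 s1 r0 r1) x *\<^sub>R ?r (S x) (R x))"
  proof (rule integral_cong_AE)
    show "(\<lambda>x. indicator \<Omega> x *\<^sub>R (A (\<sigma>h x) \<bullet> test_tensor s0 s1 r0 r1 B C x)) \<in> borel_measurable lebesgue"
      using L2_inner_integrable[OF L2_linear[OF sigma_h_props(1) linear_A] test_tensor_L2[OF Omega(3)]] Omega(3)
      by (intro borel_measurable_integrable) (simp add: integrable_lebesgue_on_iff)
    show "(\<lambda>x. indicator (rect s0 s1 r0 r1) x *\<^sub>R ?r (S x) (R x)) \<in> borel_measurable lebesgue"
      using rect_integral(1)[OF cont] by (intro borel_measurable_integrable) (simp add: set_integrable_def)
    show "AE x in lebesgue. indicator \<Omega> x *\<^sub>R (A (\<sigma>h x) \<bullet> test_tensor s0 s1 r0 r1 B C x) = indicator (rect s0 s1 r0 r1) x *\<^sub>R ?r (S x) (R x)"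
      using aeK AE_in_Omega
    proof eventually_elim
      case (elim x)
      show ?case
      proof (cases "x \<in> rect s0 s1 r0 r1")
        case True
        then have "x \<in> K" "x \<in> \<Omega>" using sub elim mesh_element(4)[OF K] by blast+
        then show ?thesis using True elim inner[of x] by (simp add: test_tensor_def stress_def)
      qed (simp add: test_tensor_def)
    qed
  qed
  also have "\<dots> = h\<^sup>2 * integral (cbox (s0, r0) (s1, r1)) (\<lambda>p. ?r (fst p) (snd p))"
    using rect_integral(2)[OF cont] by (simp add: set_lebesgue_integral_def)
  finally show ?thesis .
qed

lemma residual_bound_scaled:
  assumes fr: "0 < h" and \<tau>: "\<tau> \<in> L2 \<Omega>" "\<And>x. \<tau> x \<in> Sym" "has_weak_div \<Omega> \<tau> (\<lambda>_. 0)" and D: "D \<in> sets lebesgue" "\<And>x. x \<notin> D \<Longrightarrow> \<tau> x = 0"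
    and n: "(LINT x|lebesgue_on \<Omega>. (norm (\<tau> x))\<^sup>2) \<le> h\<^sup>2 * N" and L: "L2_inner \<Omega> (\<lambda>x. A (\<sigma>h x)) \<tau> = h\<^sup>2 * x"
  shows "x\<^sup>2 \<le> \<beta> * N * energy D / h\<^sup>2"
proof (rule scaled_square_bound[OF _ fr])
  have "(h\<^sup>2 * x)\<^sup>2 \<le> energy D * (\<beta> * (LINT x|lebesgue_on \<Omega>. (norm (\<tau> x))\<^sup>2))"
    using residual_bound[OF \<tau> D] L by simp
  also have "\<dots> \<le> energy D * (\<beta> * (h\<^sup>2 * N))"
    using n energy_nonneg beta_nonneg by (intro mult_left_mono)
  finally show "(h\<^sup>2 * x)\<^sup>2 \<le> energy D * (\<beta> * (h\<^sup>2 * N))" .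
qed

context
  fixes N B D Cm Cp
  assumes ref: "reference_bumps k width N B D Cm Cp"
begin

lemma ref_B: "i \<le> k \<Longrightarrow> vanish3 (B i) (1/4)" "i \<le> k \<Longrightarrow> vanish3 (B i) (3/4)"
    "i \<le> k \<Longrightarrow> a \<le> k \<Longrightarrow> integral {1/4..3/4} (\<lambda>s. s ^ a * poly (B i) s) = (if a = i then 1 else 0)"
  and ref_D: "j \<le> k \<Longrightarrow> vanish3 (D j) (- width)" "j \<le> k \<Longrightarrow> vanish3 (D j) 0"
    "j \<le> k \<Longrightarrow> a \<le> k \<Longrightarrow> integral {- width..0} (\<lambda>r. r ^ a * poly (D j) r) = (if a = j then 1 else 0)"
  and ref_Cm: "poly (Cm \<alpha> \<beta>') 0 = \<alpha>" "poly (pderiv (Cm \<alpha> \<beta>')) 0 = \<beta>'" "vanish3 (Cm \<alpha> \<beta>') (- width)"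
    "j \<le> k \<Longrightarrow> integral {- width..0} (\<lambda>r. r ^ j * poly (Cm \<alpha> \<beta>') r) = 0"
  and ref_Cp: "poly (Cp \<alpha> \<beta>') 0 = \<alpha>" "poly (pderiv (Cp \<alpha> \<beta>')) 0 = \<beta>'" "vanish3 (Cp \<alpha> \<beta>') width"
    "j \<le> k \<Longrightarrow> integral {0..width} (\<lambda>r. r ^ j * poly (Cp \<alpha> \<beta>') r) = 0"
  and ref_N: "i \<le> k \<Longrightarrow> j \<le> k \<Longrightarrow> airy_sq (1/4) (3/4) (- width) 0 (B i) (D j) \<le> N"
    "i \<le> k \<Longrightarrow> (\<alpha>, \<beta>') \<in> {(0, 1), (1, 0)} \<Longrightarrow> airy_sq (1/4) (3/4) (- width) 0 (B i) (Cm \<alpha> \<beta>') + airy_sq (1/4) (3/4) 0 width (B i) (Cp \<alpha> \<beta>') \<le> N"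
  using ref unfolding reference_bumps_def by blast+

lemma element_coeff_bound:
  assumes tf: "triangle_frame a \<nu> h w" and K: "triangle_frame.K a \<nu> h w \<in> \<T>"
    and mf: "frame.matrix_field a \<nu> h k c11 c12 c22 (stress (triangle_frame.K a \<nu> h w))" and ij: "i \<le> k" "j \<le> k"
  shows "(rho k (frame.ctt \<nu> c11 c12 c22) (frame.ctn \<nu> c11 c12 c22) (frame.cnn \<nu> c11 c12 c22) i j)\<^sup>2 \<le>
     \<beta> * N * energy (triangle_frame.K a \<nu> h w) / h\<^sup>2"
proof -
  interpret tf: triangle_frame a \<nu> h w by (rule tf)
  let ?\<tau> = "tf.test_tensor (1/4) (3/4) (- width) 0 (B i) (D j)"
  have sub: "tf.rect (1/4) (3/4) (- width) 0 \<subseteq> tf.K"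
    unfolding width_def by (rule tf.rect_subset_K[OF mesh_element(2)[OF K] kappa])
  have L: "L2_inner \<Omega> (\<lambda>x. A (\<sigma>h x)) ?\<tau> = h\<^sup>2 * rho k (tf.ctt c11 c12 c22) (tf.ctn c11 c12 c22) (tf.cnn c11 c12 c22) i j"
    unfolding L2_inner_test_tensor[OF tf.frame_axioms K sub mf]
    by (subst residual_element[OF _ _ ref_B(1) ref_B(2) ref_D(1) ref_D(2) ij ref_B(3) ref_D(3)]) (use ij width_pos in auto)
  show ?thesis
  proof (rule residual_bound_scaled[OF tf.h_pos _ _ _ mesh_element(3)[OF K] _ _ L])
    show "?\<tau> \<in> L2 \<Omega>" by (rule tf.test_tensor_L2[OF Omega(3)])
    show "has_weak_div \<Omega> ?\<tau> (\<lambda>_. 0)"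
      by (rule tf.weak_div_test_tensor[OF Omega(1)]) (use ref_B ref_D ij width_pos in \<open>auto simp: vanish3_def\<close>)
    show "?\<tau> x = 0" if "x \<notin> tf.K" for x using that sub by (auto simp: tf.test_tensor_def indicator_def)
    have "(LINT x|lebesgue_on \<Omega>. (norm (?\<tau> x))\<^sup>2) \<le> h\<^sup>2 * airy_sq (1/4) (3/4) (- width) 0 (B i) (D j)"
      by (rule tf.test_tensor_norm_le[OF Omega(3)])
    also have "\<dots> \<le> h\<^sup>2 * N" by (intro mult_left_mono ref_N ij) simp
    finally show "(LINT x|lebesgue_on \<Omega>. (norm (?\<tau> x))\<^sup>2) \<le> h\<^sup>2 * N" .
  qed (rule tf.test_tensor_Sym)
qed

text \<open>The choice (0, 1) of value and slope isolates a coefficient of the tt trace, the choice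
  (1, 0) a coefficient of \<open>chi\<close>. The bump does not vanish on the edge; its flux does no
  harm because the edge lies outside \<Omega>.\<close>

lemma boundary_coeff_bound:
  assumes tf: "triangle_frame a \<nu> h w" and K: "triangle_frame.K a \<nu> h w \<in> \<T>"
    and e: "triangle_frame.e a \<nu> h \<subseteq> frontier \<Omega>"
    and mf: "frame.matrix_field a \<nu> h k c11 c12 c22 (stress (triangle_frame.K a \<nu> h w))" and i: "i \<le> k" and \<alpha>\<beta>: "(\<alpha>, \<beta>') \<in> {(0, 1), (1, 0)}"
  shows "(frame.ctt \<nu> c11 c12 c22 i 0 * \<beta>' + chi k (frame.ctt \<nu> c11 c12 c22) (frame.ctn \<nu> c11 c12 c22) i 0 * \<alpha>)\<^sup>2 \<le>
     \<beta> * N * energy (triangle_frame.K a \<nu> h w) / h\<^sup>2"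
proof -
  interpret tf: triangle_frame a \<nu> h w by (rule tf)
  let ?C = "Cm \<alpha> \<beta>'"
  let ?\<tau> = "tf.test_tensor (1/4) (3/4) (- width) 0 (B i) ?C"
  have sub: "tf.rect (1/4) (3/4) (- width) 0 \<subseteq> tf.K"
    unfolding width_def by (rule tf.rect_subset_K[OF mesh_element(2)[OF K] kappa])
  have L: "L2_inner \<Omega> (\<lambda>x. A (\<sigma>h x)) ?\<tau> = h\<^sup>2 * (tf.ctt c11 c12 c22 i 0 * \<beta>' + chi k (tf.ctt c11 c12 c22) (tf.ctn c11 c12 c22) i 0 * \<alpha>)"
    unfolding L2_inner_test_tensor[OF tf.frame_axioms K sub mf]
    by (subst residual_edge(1)[OF _ _ ref_B(1) ref_B(2) i ref_B(3) ref_Cm(4)]) (use i width_pos ref_Cm in auto)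
  have "\<forall>s\<in>{1/4..3/4}. fr a \<nu> h s 0 \<notin> \<Omega>"
  proof
    fix s :: real assume "s \<in> {1/4..3/4}"
    then have "fr a \<nu> h s 0 \<in> tf.e" by (simp add: tf.e_iff)
    then have "fr a \<nu> h s 0 \<in> frontier \<Omega>" using e by blast
    then show "fr a \<nu> h s 0 \<notin> \<Omega>" using Omega(1) by (simp add: frontier_def interior_open)
  qed
  note out = this
  show ?thesis
  proof (rule residual_bound_scaled[OF tf.h_pos _ _ _ mesh_element(3)[OF K] _ _ L])
    show "?\<tau> \<in> L2 \<Omega>" by (rule tf.test_tensor_L2[OF Omega(3)])
    show "has_weak_div \<Omega> ?\<tau> (\<lambda>_. 0)"
      by (rule tf.weak_div_test_tensor[OF Omega(1)]) (use ref_B ref_Cm i width_pos out in auto)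
    show "?\<tau> x = 0" if "x \<notin> tf.K" for x using that sub by (auto simp: tf.test_tensor_def indicator_def)
    have "(LINT x|lebesgue_on \<Omega>. (norm (?\<tau> x))\<^sup>2) \<le> h\<^sup>2 * airy_sq (1/4) (3/4) (- width) 0 (B i) ?C"
      by (rule tf.test_tensor_norm_le[OF Omega(3)])
    also have "\<dots> \<le> h\<^sup>2 * N" using ref_N(2)[OF i \<alpha>\<beta>] airy_sq_nonneg[of "1/4" "3/4" 0 width "B i" "Cp \<alpha> \<beta>'"] by (intro mult_left_mono) auto
    finally show "(LINT x|lebesgue_on \<Omega>. (norm (?\<tau> x))\<^sup>2) \<le> h\<^sup>2 * N" .
  qed (rule tf.test_tensor_Sym)
qed

text \<open>Two bumps with the same value and slope on the edge, one on each side. Since the two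
  sides contribute with opposite signs, their sum tests the jump of the traces.\<close>

lemma interior_coeff_bound:
  assumes tf: "triangle_frame a \<nu> h w" and K: "triangle_frame.K a \<nu> h w \<in> \<T>" "K' \<in> \<T>"
    and sub': "frame.rect a \<nu> h (1/4) (3/4) 0 width \<subseteq> K'"
    and mf: "frame.matrix_field a \<nu> h k c11 c12 c22 (stress (triangle_frame.K a \<nu> h w))" 
    and mf': "frame.matrix_field a \<nu> h k d11 d12 d22 (stress K')" and i: "i \<le> k" and \<alpha>\<beta>: "(\<alpha>, \<beta>') \<in> {(0, 1), (1, 0)}"
  shows "((frame.ctt \<nu> c11 c12 c22 i 0 * \<beta>' + chi k (frame.ctt \<nu> c11 c12 c22) (frame.ctn \<nu> c11 c12 c22) i 0 * \<alpha>) -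
     (frame.ctt \<nu> d11 d12 d22 i 0 * \<beta>' + chi k (frame.ctt \<nu> d11 d12 d22) (frame.ctn \<nu> d11 d12 d22) i 0 * \<alpha>))\<^sup>2 \<le>
     \<beta> * (2 * N) * (energy (triangle_frame.K a \<nu> h w) + energy K') / h\<^sup>2"
proof -
  interpret tf: triangle_frame a \<nu> h w by (rule tf)
  let ?C = "Cm \<alpha> \<beta>'" and ?C' = "Cp \<alpha> \<beta>'"
  let ?t1 = "tf.test_tensor (1/4) (3/4) (- width) 0 (B i) ?C" and ?t2 = "tf.test_tensor (1/4) (3/4) 0 width (B i) ?C'"
  let ?\<tau> = "\<lambda>x. ?t1 x + ?t2 x"
  have sub: "tf.rect (1/4) (3/4) (- width) 0 \<subseteq> tf.K"
    unfolding width_def by (rule tf.rect_subset_K[OF mesh_element(2)[OF K(1)] kappa])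
  let ?E1 = "tf.ctt c11 c12 c22 i 0 * \<beta>' + chi k (tf.ctt c11 c12 c22) (tf.ctn c11 c12 c22) i 0 * \<alpha>"
  let ?E2 = "tf.ctt d11 d12 d22 i 0 * \<beta>' + chi k (tf.ctt d11 d12 d22) (tf.ctn d11 d12 d22) i 0 * \<alpha>"
  have L1: "L2_inner \<Omega> (\<lambda>x. A (\<sigma>h x)) ?t1 = h\<^sup>2 * ?E1"
    unfolding L2_inner_test_tensor[OF tf.frame_axioms K(1) sub mf]
    by (subst residual_edge(1)[OF _ _ ref_B(1) ref_B(2) i ref_B(3) ref_Cm(4)]) (use i width_pos ref_Cm in auto)
  have L2: "L2_inner \<Omega> (\<lambda>x. A (\<sigma>h x)) ?t2 = h\<^sup>2 * (- ?E2)"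
    unfolding L2_inner_test_tensor[OF tf.frame_axioms K(2) sub' mf']
    by (subst residual_edge(2)[OF _ _ ref_B(1) ref_B(2) i ref_B(3) ref_Cp(4)]) (use i width_pos ref_Cp in auto)
  note t_L2 = tf.test_tensor_L2[OF Omega(3)]
  have "L2_inner \<Omega> (\<lambda>x. A (\<sigma>h x)) ?\<tau> = L2_inner \<Omega> (\<lambda>x. A (\<sigma>h x)) ?t1 + L2_inner \<Omega> (\<lambda>x. A (\<sigma>h x)) ?t2"
    unfolding L2_inner_def inner_add_right
    by (intro Bochner_Integration.integral_add L2_inner_integrable L2_linear[OF sigma_h_props(1) linear_A] t_L2)
  then have L: "L2_inner \<Omega> (\<lambda>x. A (\<sigma>h x)) ?\<tau> = h\<^sup>2 * (?E1 - ?E2)"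
    unfolding L1 L2 by (simp add: algebra_simps)
  have mK: "tf.K \<union> K' \<in> sets lebesgue" using mesh_element(3)[OF K(1)] mesh_element(3)[OF K(2)] by auto
  have "(?E1 - ?E2)\<^sup>2 \<le> \<beta> * (2 * N) * energy (tf.K \<union> K') / h\<^sup>2"
  proof (rule residual_bound_scaled[OF tf.h_pos _ _ _ mK _ _ L])
    show "?\<tau> \<in> L2 \<Omega>" by (intro L2_add t_L2)
    show "?\<tau> x \<in> Sym" for x by (intro Sym_closed tf.test_tensor_Sym)
    show "has_weak_div \<Omega> ?\<tau> (\<lambda>_. 0)"
      by (rule tf.weak_div_test_tensor_pair[OF Omega(1)]) (use ref_B ref_Cm ref_Cp i width_pos in auto)
    show "?\<tau> x = 0" if "x \<notin> tf.K \<union> K'" for x using that sub sub' by (auto simp: tf.test_tensor_def indicator_def)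
    \<comment> \<open>The factor 2 N comes from bounding the square of a sum by twice the sum of
      squares.\<close>
    have le: "(norm (?\<tau> x))\<^sup>2 \<le> 2 * (norm (?t1 x))\<^sup>2 + 2 * (norm (?t2 x))\<^sup>2" for x
    proof -
      have "(norm (?\<tau> x))\<^sup>2 \<le> (norm (?t1 x) + norm (?t2 x))\<^sup>2" by (intro power_mono norm_triangle_ineq) simp
      also have "\<dots> \<le> 2 * (norm (?t1 x))\<^sup>2 + 2 * (norm (?t2 x))\<^sup>2"
        using sum_squares_bound[of "norm (?t1 x)" "norm (?t2 x)"] by (simp add: power2_sum)
      finally show ?thesis .
    qed
    have "(LINT x|lebesgue_on \<Omega>. (norm (?\<tau> x))\<^sup>2) \<le> (LINT x|lebesgue_on \<Omega>. 2 * (norm (?t1 x))\<^sup>2 + 2 * (norm (?t2 x))\<^sup>2)"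
      by (rule integral_mono[OF L2_norm_sq[OF L2_add[OF t_L2 t_L2]] _ le])
         (intro Bochner_Integration.integrable_add Bochner_Integration.integrable_mult_right L2_norm_sq t_L2)
    also have "\<dots> = 2 * (LINT x|lebesgue_on \<Omega>. (norm (?t1 x))\<^sup>2) + 2 * (LINT x|lebesgue_on \<Omega>. (norm (?t2 x))\<^sup>2)"
      by (simp add: Bochner_Integration.integral_add[OF Bochner_Integration.integrable_mult_right[OF L2_norm_sq[OF t_L2]] Bochner_Integration.integrable_mult_right[OF L2_norm_sq[OF t_L2]]])
    also have "\<dots> \<le> 2 * (h\<^sup>2 * airy_sq (1/4) (3/4) (- width) 0 (B i) ?C) + 2 * (h\<^sup>2 * airy_sq (1/4) (3/4) 0 width (B i) ?C')"
      using tf.test_tensor_norm_le[OF Omega(3), of "1/4" "3/4" "- width" 0 "B i" ?C] tf.test_tensor_norm_le[OF Omega(3), of "1/4" "3/4" 0 width "B i" ?C'] by linarith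
    also have "\<dots> = h\<^sup>2 * (2 * (airy_sq (1/4) (3/4) (- width) 0 (B i) ?C + airy_sq (1/4) (3/4) 0 width (B i) ?C'))" by (simp add: algebra_simps)
    also have "\<dots> \<le> h\<^sup>2 * (2 * N)" using ref_N(2)[OF i \<alpha>\<beta>] by (intro mult_left_mono) auto
    finally show "(LINT x|lebesgue_on \<Omega>. (norm (?\<tau> x))\<^sup>2) \<le> h\<^sup>2 * (2 * N)" .
  qed
  also have "\<dots> \<le> \<beta> * (2 * N) * (energy tf.K + energy K') / h\<^sup>2"
  proof -
    have "0 \<le> N" using ref_N(1)[OF i i] airy_sq_nonneg order_trans by blast
    then show ?thesis
      using energy_Un[OF mesh_element(3)[OF K(1)] mesh_element(3)[OF K(2)]] beta_nonneg by (intro divide_right_mono mult_left_mono) auto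
  qed
  finally show ?thesis .
qed

end

end

section \<open>Normal continuity of the discrete stress\<close>

lemma Sym_matrix_inner_commute: "M \<in> Sym \<Longrightarrow> (M *v x) \<bullet> y = (M *v y) \<bullet> x"
  by (simp add: Sym_iff inner_vec2 matrix_vector_mult_def sum_2 algebra_simps)

context frame
begin

lemma reversed_coords: "cs (F 1 0) (- \<nu>) h x = 1 - S x" "cr (F 1 0) (- \<nu>) h x = - R x"
proof -
  have "perp (- \<nu>) = - tau" by (simp add: vec2_eq_iff)
  moreover have "F 1 0 = a + h *\<^sub>R tau" by (simp add: fr_def)
  moreover have "x - (a + h *\<^sub>R tau) = (x - a) - h *\<^sub>R tau" by simp
  ultimately show "cs (F 1 0) (- \<nu>) h x = 1 - S x" "cr (F 1 0) (- \<nu>) h x = - R x"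
    using h_pos by (simp_all only: cs_def cr_def inner_diff_left inner_minus_right inner_scaleR_left inner_frame) (simp_all add: field_simps)
qed

lemma reversed_frame: "frame (- \<nu>) h"
  using norm_nu h_pos by unfold_locales auto

text \<open>Reading the frame from the other end point with the opposite normal maps (s, r) to (1 -
  s, - r). The interval [1/4, 3/4] is symmetric, so the inner rectangle of the neighbour becomes the
  one just above the edge.\<close>

lemma rect_reversed: "frame.rect (F 1 0) (- \<nu>) h s0 s1 l u = rect (1 - s1) (1 - s0) (- u) (- l)"
  by (auto simp: frame.rect_def[OF reversed_frame] rect_def reversed_coords)

text \<open>By symmetry M \<nu> = 0 kills both off-diagonal components in the frame as well as the
  nn component, so only the tt component survives.\<close>

lemma normal_free_matrix:
  assumes M: "M \<in> Sym" "M *v \<nu> = 0"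
  shows "M = ((M *v tau) \<bullet> tau) *\<^sub>R outer tau tau"
proof -
  have "(M *v tau) \<bullet> \<nu> = 0" using Sym_matrix_inner_commute[OF M(1), of tau \<nu>] M(2) by simp
  then have t: "M *v tau = ((M *v tau) \<bullet> tau) *\<^sub>R tau" using frame_decomp[of "M *v tau"] by simp
  have "M *v x = (((M *v tau) \<bullet> tau) *\<^sub>R outer tau tau) *v x" for x
  proof -
    have "M *v x = M *v ((x \<bullet> tau) *\<^sub>R tau + (x \<bullet> \<nu>) *\<^sub>R \<nu>)" by (simp only: frame_decomp)
    also have "\<dots> = (x \<bullet> tau) *\<^sub>R (M *v tau)"
      using M(2) by (simp add: matrix_vector_right_distrib matrix_vector_mult_scaleR)
    also have "\<dots> = (((M *v tau) \<bullet> tau) *\<^sub>R outer tau tau) *v x"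
      by (subst t) (simp add: scaleR_matrix_vector_assoc[symmetric] outer_mult_vec inner_commute)
    finally show ?thesis .
  qed
  then show ?thesis by (intro iffD2[OF matrix_eq] allI)
qed

end

lemma has_weak_pd_component:
  fixes \<tau> g :: "real^2 \<Rightarrow> real^2^2"
  assumes \<Omega>: "\<Omega> \<in> sets lebesgue" and int: "integrable (lebesgue_on \<Omega>) \<tau>" "integrable (lebesgue_on \<Omega>) g" and w: "has_weak_pd \<Omega> j \<tau> g"
  shows "has_weak_pd \<Omega> j (\<lambda>x. \<tau> x $ i $ l) (\<lambda>x. g x $ i $ l)"
  unfolding has_weak_pd_def
proof
  fix \<phi> assume \<phi>: "\<phi> \<in> test_functions \<Omega>"
  then have sm: "smooth \<phi>" by (simp add: test_functions_def)
  have bl: "bounded_linear (\<lambda>M::real^2^2. M $ i $ l)"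
    using bounded_linear_compose[OF bounded_linear_vec_nth[of l] bounded_linear_vec_nth[of i]] by simp
  note i1 = integral_bounded_linear[OF bl integrable_bounded_continuous_scaleR[OF \<Omega> int(1) smooth_continuous_pd(2)[OF sm] test_function_bounds(2)[OF \<phi>]]]
  note i2 = integral_bounded_linear[OF bl integrable_bounded_continuous_scaleR[OF \<Omega> int(2) smooth_continuous_pd(1)[OF sm] test_function_bounds(1)[OF \<phi>]]]
  have "(LINT x|lebesgue_on \<Omega>. pd j \<phi> x *\<^sub>R \<tau> x) = - (LINT x|lebesgue_on \<Omega>. \<phi> x *\<^sub>R g x)"
    using w \<phi> by (simp add: has_weak_pd_def)
  then show "(LINT x|lebesgue_on \<Omega>. pd j \<phi> x *\<^sub>R \<tau> x $ i $ l) = - (LINT x|lebesgue_on \<Omega>. \<phi> x *\<^sub>R g x $ i $ l)"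
    using i1 i2 by simp
qed

context discrete_problem
begin

text \<open>The bubble part has zero normal trace from each side by definition of
  \<open>bubbles\<close>, and each entry of the H1 part has equal traces by
  \<open>weak_pd_no_jump\<close>. Only the middle half of the edge is treated, which is enough for
  polynomial identities.\<close>

lemma normal_jump_zero:
  assumes tf: "triangle_frame a \<nu> h w" and K: "K \<in> \<T>" "K = triangle_frame.K a \<nu> h w" 
    and tf': "triangle_frame (fr a \<nu> h 1 0) (- \<nu>) h w'" and K': "K' \<in> \<T>" "K' = triangle_frame.K (fr a \<nu> h 1 0) (- \<nu>) h w'"
    and e: "e = triangle_frame.e a \<nu> h" "e = triangle_frame.e (fr a \<nu> h 1 0) (- \<nu>) h" "e edge_of K" "e edge_of K'"
    and s: "1/4 < s" "s < 3/4"
  shows "(piece \<sigma>h K (fr a \<nu> h s 0) - piece \<sigma>h K' (fr a \<nu> h s 0)) *v \<nu> = 0"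
proof -
  interpret tf: triangle_frame a \<nu> h w by (rule tf)
  interpret tf': triangle_frame "fr a \<nu> h 1 0" "- \<nu>" h w' by (rule tf')
  let ?x = "fr a \<nu> h s 0"
  obtain \<tau> b where tb: "\<tau> \<in> H1_space k \<Omega> \<T>" "b \<in> bubble_space k \<Omega> \<T>" "\<sigma>h = (\<lambda>x. \<tau> x + b x)"
    using Sigma_h_decomp[OF sigma_h] .
  have pieces: "\<exists>p q. p \<in> polys k \<and> (AE x in lebesgue_on K. \<tau> x = p x) \<and> q \<in> bubbles k K \<and> piece \<sigma>h K = (\<lambda>x. p x + q x)"
    if K: "K \<in> \<T>" for K
  proof -
    obtain p where p: "p \<in> polys_Sym k" "AE x in lebesgue_on K. \<tau> x = p x" using tb(1) K by (auto simp: H1_space_def)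
    obtain q where q: "q \<in> bubbles k K" "AE x in lebesgue_on K. b x = q x" using tb(2) K by (auto simp: bubble_space_def)
    have pq: "p \<in> polys k" "q \<in> polys k" using p(1) q(1) by (auto simp: bubbles_def polys_Sym_def)
    have ae: "AE x in lebesgue_on K. \<sigma>h x = p x + q x" using p(2) q(2) by eventually_elim (simp add: tb)
    have "piece \<sigma>h K = (\<lambda>x. p x + q x)"
      by (rule piece_eqI[OF mesh_element(1,2)[OF K] kappa polys_add[OF pq] ae])
    then show ?thesis using pq(1) p(2) q(1) by blast
  qed
  obtain p q where p: "p \<in> polys k" "AE x in lebesgue_on K. \<tau> x = p x" and q: "q \<in> bubbles k K" and pc: "piece \<sigma>h K = (\<lambda>x. p x + q x)"
    using pieces[OF K(1)] by blast
  obtain p' q' where p': "p' \<in> polys k" "AE x in lebesgue_on K'. \<tau> x = p' x" and q': "q' \<in> bubbles k K'" and pc': "piece \<sigma>h K' = (\<lambda>x. p' x + q' x)"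
    using pieces[OF K'(1)] by blast
  have xe: "?x \<in> e" using s by (simp add: e(1) tf.e_iff)
  have "q ?x *v \<nu> = 0" 
    using q e(3) xe tf.outward_normal_eq K(2) e(1) by (auto simp: bubbles_def)
  moreover have "q' ?x *v (- \<nu>) = 0"
    using q' e(4) xe tf'.outward_normal_eq K'(2) e(2) by (auto simp: bubbles_def)
  then have "q' ?x *v \<nu> = 0" using matrix_vector_mult_diff_distrib[of "q' ?x" 0 \<nu>] by simp
  moreover have "p ?x = p' ?x"
  proof -
    have \<tau>: "\<tau> \<in> L2 \<Omega>" "\<forall>j. \<exists>g\<in>L2 \<Omega>. has_weak_pd \<Omega> j \<tau> g"
      using tb(1) by (auto simp: H1_space_def H1_Sym_def)
    then obtain G where G: "\<And>j. G j \<in> L2 \<Omega>" "\<And>j. has_weak_pd \<Omega> j \<tau> (G j)" by metis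
    note L1 = L2_integrable[OF _ Omega_lmeasurable]
    have comp_int: "integrable (lebesgue_on \<Omega>) (\<lambda>x. M x $ i $ l)" if "integrable (lebesgue_on \<Omega>) M" for M :: "real^2 \<Rightarrow> real^2^2" and i l
      using integrable_bounded_linear[OF bounded_linear_compose[OF bounded_linear_vec_nth[of l] bounded_linear_vec_nth[of i]] that] by simp
    have sub: "tf.rect (1/4) (3/4) (- width) 0 \<subseteq> K" 
      unfolding width_def K(2) by (rule tf.rect_subset_K[OF mesh_element(2)[OF K(1)[unfolded K(2)]] kappa])
    have "tf'.rect (1/4) (3/4) (- width) 0 \<subseteq> K'" 
      unfolding width_def K'(2) by (rule tf'.rect_subset_K[OF mesh_element(2)[OF K'(1)[unfolded K'(2)]] kappa])
    then have sub': "tf.rect (1/4) (3/4) 0 width \<subseteq> K'"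
      unfolding tf.rect_reversed by simp
    let ?O = "{x. 1/4 < cs a \<nu> h x \<and> cs a \<nu> h x < 3/4 \<and> - width < cr a \<nu> h x \<and> cr a \<nu> h x < width}"
    have "open ?O" by (intro open_Collect_conj open_Collect_less continuous_intros tf.continuous_on_S tf.continuous_on_R)
    moreover have "?O \<subseteq> closure \<Omega>"
    proof
      fix x assume "x \<in> ?O"
      then have "x \<in> tf.rect (1/4) (3/4) (- width) 0 \<or> x \<in> tf.rect (1/4) (3/4) 0 width" by (auto simp: tf.rect_def)
      then show "x \<in> closure \<Omega>" using sub sub' mesh_element(4)[OF K(1)] mesh_element(4)[OF K'(1)] by blast
    qed
    \<comment> \<open>An open subset of the closure of \<Omega> lies in \<Omega> because \<Omega> is
      the interior of its closure; hence the strip around the edge contains no boundary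
      points.\<close>
    ultimately have O: "?O \<subseteq> \<Omega>" using interior_maximal Omega(5) by blast
    have ae: "AE x in lebesgue. x \<in> K \<longrightarrow> \<tau> x = p x" "AE x in lebesgue. x \<in> K' \<longrightarrow> \<tau> x = p' x"
      using p(2) p'(2) mesh_element(3)[OF K(1)] mesh_element(3)[OF K'(1)] by (simp_all add: AE_restrict_space_iff)
    have "p ?x $ i $ l = p' ?x $ i $ l" for i l
    proof -
      obtain c where c: "\<And>x. p x $ i $ l = tpoly k c (cs a \<nu> h x) (cr a \<nu> h x)" using tf.polys_frame[OF polys_component[OF p(1)]] by metis
      obtain d where d: "\<And>x. p' x $ i $ l = tpoly k d (cs a \<nu> h x) (cr a \<nu> h x)" using tf.polys_frame[OF polys_component[OF p'(1)]] by metis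
      have "tpoly k c s 0 = tpoly k d s 0"
      proof (rule tf.weak_pd_no_jump[where f = "\<lambda>x. \<tau> x $ i $ l" and g = "\<lambda>j x. G j x $ i $ l" and ?s0.0 = "1/4" and ?s1.0 = "3/4" and d = width, OF _ width_pos Omega(1) O])
        show "has_weak_pd \<Omega> j (\<lambda>x. \<tau> x $ i $ l) (\<lambda>x. G j x $ i $ l)" for j
          by (rule has_weak_pd_component[OF Omega(3) L1[OF \<tau>(1)] L1[OF G(1)] G(2)])
        show "AE x in lebesgue. x \<in> tf.rect (1/4) (3/4) (- width) 0 \<longrightarrow> \<tau> x $ i $ l = tpoly k c (cs a \<nu> h x) (cr a \<nu> h x)"
          using ae(1) by eventually_elim (use sub c in auto)
        show "AE x in lebesgue. x \<in> tf.rect (1/4) (3/4) 0 width \<longrightarrow> \<tau> x $ i $ l = tpoly k d (cs a \<nu> h x) (cr a \<nu> h x)"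
          using ae(2) by eventually_elim (use sub' d in auto)
      qed (use s comp_int[OF L1[OF \<tau>(1)]] comp_int[OF L1[OF G(1)]] in auto)
      then show ?thesis using c[of ?x] d[of ?x] by simp
    qed
    then show ?thesis by (simp add: vec_eq_iff)
  qed
  ultimately show ?thesis
    unfolding pc pc' by (simp add: matrix_vector_mult_diff_rdistrib matrix_vector_mult_add_rdistrib)
qed

text \<open>The jump of \<sigma>h is a scalar y times the tensor t x t, so the jump of the stress is
  y times the fixed matrix T. Its tn and tt components therefore have the constant ratio \<theta>,
  and this identity on an open interval passes to the coefficients.\<close>

lemma stress_jump_coeffs:
  assumes tf: "triangle_frame a \<nu> h w" and K: "K \<in> \<T>" "K = triangle_frame.K a \<nu> h w" 
    and tf': "triangle_frame (fr a \<nu> h 1 0) (- \<nu>) h w'" and K': "K' \<in> \<T>" "K' = triangle_frame.K (fr a \<nu> h 1 0) (- \<nu>) h w'"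
    and e: "e = triangle_frame.e a \<nu> h" "e = triangle_frame.e (fr a \<nu> h 1 0) (- \<nu>) h" "e edge_of K" "e edge_of K'"
    and mf: "frame.matrix_field a \<nu> h k c11 c12 c22 (stress K)" and mf': "frame.matrix_field a \<nu> h k d11 d12 d22 (stress K')"
    and i: "i \<le> k"
  shows "\<bar>frame.ctn \<nu> c11 c12 c22 i 0 - frame.ctn \<nu> d11 d12 d22 i 0\<bar> \<le> \<rho> * \<bar>frame.ctt \<nu> c11 c12 c22 i 0 - frame.ctt \<nu> d11 d12 d22 i 0\<bar>"
proof -
  interpret tf: triangle_frame a \<nu> h w by (rule tf)
  let ?t = "perp \<nu>"
  define T where "T = A (outer ?t ?t)"
  \<comment> \<open>If the tt component of T is zero, the ratio bound forces the tn component to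
    vanish too, so the default value 0 is consistent.\<close>
  define \<theta> where "\<theta> = (if (T *v ?t) \<bullet> ?t = 0 then 0 else ((T *v ?t) \<bullet> \<nu>) / ((T *v ?t) \<bullet> ?t))"
  have TT: "outer ?t ?t \<in> Sym" by (simp add: Sym_iff outer_def)
  have nn: "0 \<le> (T *v ?t) \<bullet> ?t" using A_nonneg[OF TT] by (simp add: T_def inner_outer)
  have ratio': "\<bar>(T *v ?t) \<bullet> \<nu>\<bar> \<le> \<rho> * ((T *v ?t) \<bullet> ?t)" unfolding T_def by (rule ratio[OF tf.norm_nu])
  have \<theta>: "(T *v ?t) \<bullet> \<nu> = \<theta> * ((T *v ?t) \<bullet> ?t)" "\<bar>\<theta>\<bar> \<le> \<rho>"
    using nn ratio' rho_nonneg by (auto simp: \<theta>_def divide_le_eq abs_divide)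
  let ?c1 = "tf.ctn c11 c12 c22" and ?d1 = "tf.ctn d11 d12 d22" and ?c2 = "tf.ctt c11 c12 c22" and ?d2 = "tf.ctt d11 d12 d22"
  have z: "tpoly k (\<lambda>i j. (?c1 i j - ?d1 i j) - \<theta> * (?c2 i j - ?d2 i j)) s 0 = 0" if s: "1/4 < s" "s < 3/4" for s
  proof -
    let ?x = "fr a \<nu> h s 0"
    define M where "M = piece \<sigma>h K ?x - piece \<sigma>h K' ?x"
    have "piece \<sigma>h K ?x \<in> Sym" "piece \<sigma>h K' ?x \<in> Sym"
      using piece_Sigma_h(1)[OF mesh regular kappa sigma_h K(1)] piece_Sigma_h(1)[OF mesh regular kappa sigma_h K'(1)]
      by (auto simp: polys_Sym_def)
    then have MS: "M \<in> Sym" unfolding M_def by (rule Sym_closed)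
    define y where "y = (M *v ?t) \<bullet> ?t"
    have "M = y *\<^sub>R outer ?t ?t"
      unfolding y_def by (rule tf.normal_free_matrix[OF MS]) (use normal_jump_zero[OF tf K tf' K' e s] in \<open>simp add: M_def\<close>)
    then have "stress K ?x - stress K' ?x = y *\<^sub>R T"
      by (simp add: stress_def M_def T_def linear_diff[OF linear_A, symmetric] linear_scale[OF linear_A])
    then have "(stress K ?x *v ?t) \<bullet> n - (stress K' ?x *v ?t) \<bullet> n = y * ((T *v ?t) \<bullet> n)" for n
      by (simp add: inner_diff_left[symmetric] matrix_vector_mult_diff_rdistrib[symmetric] scaleR_matrix_vector_assoc[symmetric])
    from this[of ?t] this[of \<nu>] have "tpoly k ?c2 s 0 - tpoly k ?d2 s 0 = y * ((T *v ?t) \<bullet> ?t)" "tpoly k ?c1 s 0 - tpoly k ?d1 s 0 = y * ((T *v ?t) \<bullet> \<nu>)"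
      unfolding tf.matrix_field_frame[OF mf] tf.matrix_field_frame[OF mf'] by simp_all
    then show ?thesis using \<theta>(1) by (simp add: tpoly_diff tpoly_cmult)
  qed
  have "(?c1 i 0 - ?d1 i 0) - \<theta> * (?c2 i 0 - ?d2 i 0) = 0"
    by (rule tpoly_trace_coeffs[where ?s0.0 = "1/4" and ?s1.0 = "3/4", OF z _ i]) auto
  then have "\<bar>?c1 i 0 - ?d1 i 0\<bar> = \<bar>\<theta>\<bar> * \<bar>?c2 i 0 - ?d2 i 0\<bar>" by (simp add: abs_mult)
  also have "\<dots> \<le> \<rho> * \<bar>?c2 i 0 - ?d2 i 0\<bar>" using \<theta>(2) by (intro mult_right_mono) auto
  finally show ?thesis .
qed

end

section \<open>Efficiency of the estimator\<close>

lemma trace_integral_bound: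
  assumes "\<And>i. i \<le> k \<Longrightarrow> (c i 0)\<^sup>2 \<le> Q"
  shows "integral {0..1} (\<lambda>s. (tpoly k c s 0)\<^sup>2) \<le> (real (Suc k))\<^sup>2 * Q"
proof -
  have Q: "0 \<le> Q" by (rule order_trans[OF zero_le_power2 assms[of 0]]) simp
  have "(tpoly k c s 0)\<^sup>2 \<le> (real (Suc k))\<^sup>2 * Q" if s: "s \<in> {0..1}" for s
  proof -
    have "\<bar>c i 0 * s ^ i\<bar> \<le> sqrt Q" if "i \<le> k" for i
    proof -
      have "\<bar>c i 0\<bar> \<le> sqrt Q" using assms[OF that] by (simp add: real_le_rsqrt)
      moreover have "\<bar>s ^ i\<bar> \<le> 1" using s by (simp add: power_le_one)
      ultimately have "\<bar>c i 0\<bar> * \<bar>s ^ i\<bar> \<le> sqrt Q * 1" by (intro mult_mono) (auto simp: Q)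
      then show ?thesis by (simp add: abs_mult)
    qed
    then have "\<bar>tpoly k c s 0\<bar> \<le> (\<Sum>i\<le>k. sqrt Q)"
      unfolding tpoly_0 by (intro order_trans[OF sum_abs] sum_mono) auto
    then have "\<bar>tpoly k c s 0\<bar> \<le> real (Suc k) * sqrt Q" by simp
    then have "\<bar>tpoly k c s 0\<bar>\<^sup>2 \<le> (real (Suc k) * sqrt Q)\<^sup>2" by (rule power_mono) simp
    then show ?thesis using Q by (simp only: power2_abs power_mult_distrib real_sqrt_pow2)
  qed
  then have "integral {0..1} (\<lambda>s. (tpoly k c s 0)\<^sup>2) \<le> integral {0..1::real} (\<lambda>s. (real (Suc k))\<^sup>2 * Q)"
    by (intro integral_le integrable_continuous_real continuous_intros) auto
  then show ?thesis by simp
qed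

lemma (in triangle_frame) measure_K_le:
  assumes "\<And>x. x \<in> K \<Longrightarrow> \<bar>S x\<bar> \<le> D" "\<And>x. x \<in> K \<Longrightarrow> \<bar>R x\<bar> \<le> D" "0 \<le> D"
  shows "measure lebesgue K \<le> h\<^sup>2 * (2 * D)\<^sup>2"
proof -
  have "K \<subseteq> rect (- D) D (- D) D" using assms by (force simp: rect_def)
  then have "measure lebesgue K \<le> measure lebesgue (rect (- D) D (- D) D)"
    using compact_K by (intro measure_mono_fmeasurable) (auto simp: lmeasurable_compact compact_imp_closed)
  also have "\<dots> = (LINT x:rect (- D) D (- D) D|lebesgue. (1::real))"
    by (simp add: set_lebesgue_integral_def)
  also have "\<dots> = h\<^sup>2 * integral (cbox (- D, - D) (D, D)) (\<lambda>p. 1)"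
    by (subst rect_integral(2)) auto
  also have "integral (cbox (- D, - D) (D, D)) (\<lambda>p. 1) = (2 * D) * (2 * D)"
    using assms(3) by (simp add: content_Pair)
  finally show ?thesis by (simp add: power2_eq_square)
qed

text \<open>The factors come from diameter at most \<kappa> h, from the supremum bound
  \<open>abs_tpoly_le\<close>, from the area of a square of side 2 \<kappa> h containing the
  triangle, and from the bound on a coefficient.\<close>

definition element_const :: "nat \<Rightarrow> real \<Rightarrow> real \<Rightarrow> real \<Rightarrow> real" where
  "element_const k \<kappa> \<beta> N = \<kappa> ^ 4 * ((real (Suc k))\<^sup>2 * \<kappa> ^ (2 * k))\<^sup>2 * (2 * \<kappa>)\<^sup>2 * (\<beta> * N)"

text \<open>The summand 1 belongs to the first edge residual, (1 + k \<rho>) ^ 2 to the second,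
  where k \<rho> pays for the tangential derivative of the tn jump. The factor 2 is that of the
  two-sided test tensor, and (k + 1) ^ 2 passes from coefficients to the norm on the edge.\<close>

definition edge_const :: "nat \<Rightarrow> real \<Rightarrow> real \<Rightarrow> real \<Rightarrow> real" where
  "edge_const k \<rho> \<beta> N = 2 * (real (Suc k))\<^sup>2 * (1 + (1 + real k * \<rho>)\<^sup>2) * (\<beta> * N)"

lemma edge_const_nonneg: "0 \<le> \<beta> \<Longrightarrow> 0 \<le> N \<Longrightarrow> 0 \<le> edge_const k \<rho> \<beta> N"
  and element_const_nonneg: "0 \<le> \<beta> \<Longrightarrow> 0 \<le> N \<Longrightarrow> 0 \<le> \<kappa> \<Longrightarrow> 0 \<le> element_const k \<kappa> \<beta> N"
  by (simp_all add: edge_const_def element_const_def)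

section \<open>The terms of the estimator against the local energy\<close>

context discrete_problem
begin

lemma norm_A_nonneg: "0 \<le> norm_A \<Omega> A err"
proof -
  have "0 \<le> L2_inner \<Omega> (\<lambda>x. A (err x)) err"
    unfolding L2_inner_def using AE_energy_nonneg by (rule integral_nonneg_AE)
  then show ?thesis by (simp add: norm_A_def)
qed

context
  fixes N B D Cm Cp
  assumes ref: "reference_bumps k width N B D Cm Cp"
begin

lemma N_nonneg: "0 \<le> N" 
  by (rule order_trans[OF airy_sq_nonneg ref_N(1)[OF ref le0 le0]])

text \<open>The powers of h balance: h ^ 4 from the weight, h ^ 2 from the area, 1 / h ^ 4 from the
  squared second-order operator and 1 / h ^ 2 from the coefficient bound.\<close>

lemma element_term:
  assumes K: "K \<in> \<T>"
  shows "diameter K ^ 4 * (LINT x|lebesgue_on K. (curl_vec (curl_tensor (stress K)) x)\<^sup>2) \<le> element_const k \<kappa> \<beta> N * energy K"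
proof -
  obtain e where e: "e edge_of K" using finite_edges(3)[OF mesh_element(1)[OF K]] by blast
  obtain a \<nu> h w where tf: "triangle_frame a \<nu> h w" and Keq: "K = triangle_frame.K a \<nu> h w" 
    using triangle_frame_of_edge[OF mesh_element(1)[OF K] e] .
  interpret tf: triangle_frame a \<nu> h w by (rule tf)
  obtain c11 c12 c22 where mf: "tf.matrix_field k c11 c12 c22 (stress K)"
    using tf.polys_Sym_matrix_field[OF stress_polys_Sym[OF K]] by blast
  let ?\<rho> = "rho k (tf.ctt c11 c12 c22) (tf.ctn c11 c12 c22) (tf.cnn c11 c12 c22)"
  define Q where "Q = \<beta> * N * energy K / h\<^sup>2"
  have Q: "(?\<rho> i j)\<^sup>2 \<le> Q" if "i \<le> k" "j \<le> k" for i j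
    unfolding Q_def Keq by (rule element_coeff_bound[OF ref tf _ _ that]) (use K mf Keq in auto)
  have Q0: "0 \<le> Q" unfolding Q_def using beta_nonneg N_nonneg energy_nonneg by simp
  note sb = tf.shape_regular_bounds[OF mesh_element(2)[OF K, unfolded Keq] kappa, folded Keq]
  define P where "P = (real (Suc k))\<^sup>2 * \<kappa> ^ (2 * k)"
  have bound: "(curl_vec (curl_tensor (stress K)) x)\<^sup>2 \<le> P\<^sup>2 * Q / h ^ 4" if x: "x \<in> K" for x
  proof -
    have "\<bar>tpoly k ?\<rho> (cs a \<nu> h x) (cr a \<nu> h x)\<bar> \<le> (real (Suc k))\<^sup>2 * sqrt Q * \<kappa> ^ (2 * k)"
      by (rule abs_tpoly_le[OF _ sb(3)[OF x] sb(4)[OF x] kappa]) (use Q in \<open>simp add: real_le_rsqrt\<close>)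
    also have "\<dots> = P * sqrt Q" by (simp add: P_def)
    finally have "\<bar>tpoly k ?\<rho> (cs a \<nu> h x) (cr a \<nu> h x)\<bar>\<^sup>2 \<le> (P * sqrt Q)\<^sup>2" by (rule power_mono) simp
    then have "(tpoly k ?\<rho> (cs a \<nu> h x) (cr a \<nu> h x))\<^sup>2 \<le> P\<^sup>2 * Q" using Q0 by (simp add: power_mult_distrib)
    then have "(tpoly k ?\<rho> (cs a \<nu> h x) (cr a \<nu> h x))\<^sup>2 / (h\<^sup>2)\<^sup>2 \<le> P\<^sup>2 * Q / (h\<^sup>2)\<^sup>2" by (intro divide_right_mono) auto
    then show ?thesis unfolding tf.matrix_field_curl_curl[OF mf] power_divide by simp
  qed
  have mK: "K \<in> sets lebesgue" "K \<in> lmeasurable" using mesh_element(3)[OF K] simplex_2_facts(2)[OF mesh_element(1)[OF K]] by (auto simp: lmeasurable_compact)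
  have "(LINT x|lebesgue_on K. (curl_vec (curl_tensor (stress K)) x)\<^sup>2) = (LINT x|lebesgue. indicator K x *\<^sub>R (curl_vec (curl_tensor (stress K)) x)\<^sup>2)"
    by (rule integral_lebesgue_on_eq[OF mK(1)])
  also have "\<dots> \<le> (LINT x|lebesgue. indicator K x *\<^sub>R (P\<^sup>2 * Q / h ^ 4))"
  proof (rule integral_mono)
    have "continuous_on K (\<lambda>x. (curl_vec (curl_tensor (stress K)) x)\<^sup>2)"
      unfolding tf.matrix_field_curl_curl[OF mf] using tf.h_pos by (intro continuous_intros tf.continuous_on_S tf.continuous_on_R) auto
    then have "integrable lborel (\<lambda>x. indicator K x *\<^sub>R (curl_vec (curl_tensor (stress K)) x)\<^sup>2)"
      using simplex_2_facts(2)[OF mesh_element(1)[OF K]] by (intro borel_integrable_compact)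
    then show "integrable lebesgue (\<lambda>x. indicator K x *\<^sub>R (curl_vec (curl_tensor (stress K)) x)\<^sup>2)"
      by (simp add: integrable_completion borel_measurable_integrable)
    show "integrable lebesgue (\<lambda>x. indicator K x *\<^sub>R (P\<^sup>2 * Q / h ^ 4))"
      using mK by (intro integrable_scaleR_left) (auto simp: integrable_indicator_iff fmeasurable_def)
  qed (use bound in \<open>auto simp: indicator_def\<close>)
  also have "\<dots> = measure lebesgue K * (P\<^sup>2 * Q / h ^ 4)" 
    using mK by (simp add: fmeasurable_def)
  also have "\<dots> \<le> (h\<^sup>2 * (2 * \<kappa>)\<^sup>2) * (P\<^sup>2 * Q / h ^ 4)"
    using tf.measure_K_le[OF sb(3,4)[unfolded Keq]] kappa Keq Q0 by (intro mult_right_mono) auto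
  finally have "diameter K ^ 4 * (LINT x|lebesgue_on K. (curl_vec (curl_tensor (stress K)) x)\<^sup>2) \<le> (\<kappa> * h) ^ 4 * ((h\<^sup>2 * (2 * \<kappa>)\<^sup>2) * (P\<^sup>2 * Q / h ^ 4))"
    using sb(1) diameter_ge_0[OF simplex_2_facts(4)[OF mesh_element(1)[OF K]]] by (intro mult_mono power_mono Bochner_Integration.integral_nonneg) auto
  also have "\<dots> = element_const k \<kappa> \<beta> N * energy K"
  proof -
    have "element_const k \<kappa> \<beta> N = \<kappa> ^ 4 * P\<^sup>2 * (2 * \<kappa>)\<^sup>2 * (\<beta> * N)" by (simp add: element_const_def P_def)
    moreover have "(\<kappa> * h) ^ 4 * ((h\<^sup>2 * (2 * \<kappa>)\<^sup>2) * (P\<^sup>2 * (X / h\<^sup>2) / h ^ 4)) = \<kappa> ^ 4 * P\<^sup>2 * (2 * \<kappa>)\<^sup>2 * X" for X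
      using tf.h_pos by (simp add: power_mult_distrib field_simps)
    ultimately show ?thesis unfolding Q_def by (simp add: mult.assoc)
  qed
  finally show ?thesis .
qed

lemma edge_frame:
  assumes e: "e \<in> edges \<T>"
  obtains a \<nu> h w where "triangle_frame a \<nu> h w" "K_plus \<T> e \<in> \<T>" "e edge_of K_plus \<T> e" "K_plus \<T> e = triangle_frame.K a \<nu> h w" "e = triangle_frame.e a \<nu> h"
    "edge_normal \<T> e = \<nu>" "edge_tangent \<T> e = perp \<nu>"
proof -
  have ex: "\<exists>K. K \<in> \<T> \<and> e edge_of K" using e by (auto simp: edges_def)
  from someI_ex[OF this] have Kp: "K_plus \<T> e \<in> \<T>" "e edge_of K_plus \<T> e" by (auto simp: K_plus_def)
  obtain a \<nu> h w where tf: "triangle_frame a \<nu> h w" and Keq: "K_plus \<T> e = triangle_frame.K a \<nu> h w" and eeq: "e = triangle_frame.e a \<nu> h"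
    using triangle_frame_of_edge[OF mesh_element(1)[OF Kp(1)] Kp(2)] .
  have n: "edge_normal \<T> e = \<nu>"
    unfolding edge_normal_def unfolding Keq unfolding eeq by (rule triangle_frame.outward_normal_eq[OF tf])
  show thesis by (rule that[OF tf Kp Keq eeq n]) (simp add: edge_tangent_def n perp_def)
qed

definition edge_term :: "(real^2) set \<Rightarrow> real" where
  "edge_term e = diameter e * edge_norm_sq e (J1 \<Omega> \<T> A \<sigma>h e) + diameter e ^ 3 * edge_norm_sq e (J2 \<Omega> \<T> A \<sigma>h e)"

text \<open>The edge norm contributes one h, and the second residual contains a derivative, hence 1
  / h. Both weighted terms become h ^ 2 times an integral over [0, 1], which cancels the 1 / h ^ 2
  of the coefficient bounds.\<close>

lemma edge_term_bound:
  assumes tf: "triangle_frame a \<nu> h w" and e: "e = triangle_frame.e a \<nu> h"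
    and J1: "\<And>s. J1 \<Omega> \<T> A \<sigma>h e (fr a \<nu> h s 0) = tpoly k g1 s 0" "\<And>i. i \<le> k \<Longrightarrow> (g1 i 0)\<^sup>2 \<le> Q1 / h\<^sup>2"
    and J2: "\<And>s. J2 \<Omega> \<T> A \<sigma>h e (fr a \<nu> h s 0) = tpoly k g2 s 0 / h" "\<And>i. i \<le> k \<Longrightarrow> (g2 i 0)\<^sup>2 \<le> Q2 / h\<^sup>2"
  shows "edge_term e \<le> (real (Suc k))\<^sup>2 * (Q1 + Q2)"
proof -
  interpret tf: triangle_frame a \<nu> h w by (rule tf)
  have "edge_term e = h * (h * integral {0..1} (\<lambda>s. (tpoly k g1 s 0)\<^sup>2)) + h ^ 3 * (h * integral {0..1} (\<lambda>s. (tpoly k g2 s 0 / h)\<^sup>2))"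
    unfolding edge_term_def e tf.edge_norm_sq_eq tf.diameter_e using J1(1) J2(1) by (simp add: e)
  also have "integral {0..1} (\<lambda>s. (tpoly k g2 s 0 / h)\<^sup>2) = integral {0..1} (\<lambda>s. (tpoly k g2 s 0)\<^sup>2) / h\<^sup>2"
    unfolding power_divide by (rule integral_divide)
  also have "h * (h * integral {0..1} (\<lambda>s. (tpoly k g1 s 0)\<^sup>2)) + h ^ 3 * (h * (integral {0..1} (\<lambda>s. (tpoly k g2 s 0)\<^sup>2) / h\<^sup>2)) = 
     h\<^sup>2 * integral {0..1} (\<lambda>s. (tpoly k g1 s 0)\<^sup>2) + h\<^sup>2 * integral {0..1} (\<lambda>s. (tpoly k g2 s 0)\<^sup>2)"
    using tf.h_pos by (simp add: power2_eq_square power3_eq_cube)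
  also have "\<dots> \<le> h\<^sup>2 * ((real (Suc k))\<^sup>2 * (Q1 / h\<^sup>2)) + h\<^sup>2 * ((real (Suc k))\<^sup>2 * (Q2 / h\<^sup>2))"
    using J1(2) J2(2) by (intro add_mono mult_left_mono trace_integral_bound) auto
  also have "\<dots> = (real (Suc k))\<^sup>2 * (Q1 + Q2)"
    using tf.h_pos by (simp add: field_simps)
  finally show ?thesis .
qed

lemma boundary_edge_term:
  assumes e: "e \<in> boundary_edges \<Omega> \<T>"
  shows "edge_term e \<le> edge_const k \<rho> \<beta> N * energy (K_plus \<T> e)"
proof -
  have ee: "e \<in> edges \<T>" "e \<subseteq> frontier \<Omega>" using e by (auto simp: boundary_edges_def)
  obtain a \<nu> h w where tf: "triangle_frame a \<nu> h w" and K: "K_plus \<T> e \<in> \<T>" "K_plus \<T> e = triangle_frame.K a \<nu> h w" and eeq: "e = triangle_frame.e a \<nu> h"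
    and n: "edge_normal \<T> e = \<nu>" "edge_tangent \<T> e = perp \<nu>"
    by (rule edge_frame[OF ee(1)])
  interpret tf: triangle_frame a \<nu> h w by (rule tf)
  let ?K = "K_plus \<T> e"
  obtain c11 c12 c22 where mf: "tf.matrix_field k c11 c12 c22 (stress ?K)"
    using tf.polys_Sym_matrix_field[OF stress_polys_Sym[OF K(1)]] by blast
  let ?ct = "tf.ctt c11 c12 c22" and ?cn = "tf.ctn c11 c12 c22"
  let ?Q = "\<beta> * N * energy ?K"
  note b = boundary_coeff_bound[OF ref tf _ _ _ , folded K(2) eeq, OF K(1) ee(2) mf]
  have "edge_term e \<le> (real (Suc k))\<^sup>2 * (?Q + ?Q)"
  proof (rule edge_term_bound[OF tf eeq])
    show "J1 \<Omega> \<T> A \<sigma>h e (fr a \<nu> h s 0) = tpoly k ?ct s 0" for s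
      using tf.matrix_field_frame(1)[OF mf, of "fr a \<nu> h s 0"] e by (simp add: J1_def n stress_def)
    show "(?ct i 0)\<^sup>2 \<le> ?Q / h\<^sup>2" if "i \<le> k" for i using b[OF that, of 0 1] by simp
    \<comment> \<open>On the boundary the estimator itself subtracts the tangential derivative of
      the tn component, so the residual is exactly - \<open>chi\<close> / h and is controlled
      without the ratio \<rho>.\<close>
    show "J2 \<Omega> \<T> A \<sigma>h e (fr a \<nu> h s 0) = tpoly k (\<lambda>i j. - 1 * chi k ?ct ?cn i j) s 0 / h" for s
      using tf.matrix_field_curl[OF mf, of "fr a \<nu> h s 0"] tf.matrix_field_tangential_derivative[OF mf, of "fr a \<nu> h s 0"] e
      unfolding tpoly_cmult by (simp add: J2_def n stress_def [abs_def] chi_def tpoly_diff tpoly_cmult diff_divide_distrib)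
    show "(- 1 * chi k ?ct ?cn i 0)\<^sup>2 \<le> ?Q / h\<^sup>2" if "i \<le> k" for i using b[OF that, of 1 0] by simp
  qed
  also have "\<dots> \<le> edge_const k \<rho> \<beta> N * energy ?K"
  proof -
    have "1 \<le> 1 + (1 + real k * \<rho>)\<^sup>2" by simp
    then have "2 * (real (Suc k))\<^sup>2 * 1 * (\<beta> * N) * energy ?K \<le> 2 * (real (Suc k))\<^sup>2 * (1 + (1 + real k * \<rho>)\<^sup>2) * (\<beta> * N) * energy ?K"
      using beta_nonneg N_nonneg energy_nonneg by (intro mult_right_mono mult_left_mono) auto
    then show ?thesis by (simp add: edge_const_def algebra_simps)
  qed
  finally show ?thesis .
qed

lemma interior_edge_term:
  assumes e: "e \<in> interior_edges \<Omega> \<T>"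
  shows "edge_term e \<le> edge_const k \<rho> \<beta> N * (energy (K_plus \<T> e) + energy (K_minus \<T> e))"
proof -
  have ee: "e \<in> edges \<T>" "e \<notin> boundary_edges \<Omega> \<T>" using e by (auto simp: interior_edges_def)
  obtain a \<nu> h w where tf: "triangle_frame a \<nu> h w" and K: "K_plus \<T> e \<in> \<T>" "K_plus \<T> e = triangle_frame.K a \<nu> h w" and eeq: "e = triangle_frame.e a \<nu> h"
    and eK: "e edge_of K_plus \<T> e" and n: "edge_normal \<T> e = \<nu>" "edge_tangent \<T> e = perp \<nu>"
    by (rule edge_frame[OF ee(1)])
  interpret tf: triangle_frame a \<nu> h w by (rule tf)
  note Km = K_minus_props(3-5)[OF domain mesh e]
  let ?K = "K_plus \<T> e" and ?K' = "K_minus \<T> e"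
  have ee': "tf.e edge_of ?K'" unfolding eeq[symmetric] by (rule Km(2))
  obtain w' where tf': "triangle_frame (fr a \<nu> h 1 0) (- \<nu>) h w'" and K': "?K' = triangle_frame.K (fr a \<nu> h 1 0) (- \<nu>) h w'"
    and eeq': "e = triangle_frame.e (fr a \<nu> h 1 0) (- \<nu>) h"
    using opposite_triangle_frame[OF mesh K(1)[unfolded K(2)] Km(1) Km(3)[unfolded K(2)] tf ee' regular kappa] unfolding eeq[symmetric] .
  interpret tf': triangle_frame "fr a \<nu> h 1 0" "- \<nu>" h w' by (rule tf')
  have sub': "tf.rect (1/4) (3/4) 0 width \<subseteq> ?K'"
    using tf'.rect_subset_K[of \<kappa>] mesh_element(2)[OF Km(1)] K' kappa unfolding width_def tf.rect_reversed by simp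
  obtain c11 c12 c22 where mf: "tf.matrix_field k c11 c12 c22 (stress ?K)"
    using tf.polys_Sym_matrix_field[OF stress_polys_Sym[OF K(1)]] by blast
  \<comment> \<open>The polynomial of the neighbour is defined on the whole plane and is expanded in
    the frame of \<open>K_plus\<close>, so that jumps become differences of coefficients.\<close>
  obtain d11 d12 d22 where mf': "tf.matrix_field k d11 d12 d22 (stress ?K')"
    using tf.polys_Sym_matrix_field[OF stress_polys_Sym[OF Km(1)]] by blast
  let ?ct = "tf.ctt c11 c12 c22" and ?cn = "tf.ctn c11 c12 c22" and ?dt = "tf.ctt d11 d12 d22" and ?dn = "tf.ctn d11 d12 d22"
  define Q where "Q = \<beta> * (2 * N) * (energy ?K + energy ?K')"
  note b = interior_coeff_bound[OF ref tf _ Km(1) sub', folded K(2), OF K(1) mf mf', folded Q_def]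
  have Q0: "0 \<le> Q" unfolding Q_def using beta_nonneg N_nonneg energy_nonneg by simp
  have jt: "(?ct i 0 - ?dt i 0)\<^sup>2 \<le> Q / h\<^sup>2" if "i \<le> k" for i using b[OF that, of 0 1] by simp
  have jc: "(chi k ?ct ?cn i 0 - chi k ?dt ?dn i 0)\<^sup>2 \<le> Q / h\<^sup>2" if "i \<le> k" for i using b[OF that, of 1 0] by simp
  have jn: "\<bar>?cn i 0 - ?dn i 0\<bar> \<le> \<rho> * \<bar>?ct i 0 - ?dt i 0\<bar>" if "i \<le> k" for i
    by (rule stress_jump_coeffs[OF tf K tf' Km(1) K' eeq eeq' eK Km(2) mf mf' that])
  let ?g2 = "\<lambda>i j. (dr k ?ct i j - ds k ?cn i j) - (dr k ?dt i j - ds k ?dn i j)"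
  have "edge_term e \<le> (real (Suc k))\<^sup>2 * (Q + (1 + real k * \<rho>)\<^sup>2 * Q)"
  proof (rule edge_term_bound[OF tf eeq])
    show "J1 \<Omega> \<T> A \<sigma>h e (fr a \<nu> h s 0) = tpoly k (\<lambda>i j. ?ct i j - ?dt i j) s 0" for s
      using tf.matrix_field_frame(1)[OF mf, of "fr a \<nu> h s 0"] tf.matrix_field_frame(1)[OF mf', of "fr a \<nu> h s 0"] ee by (simp add: J1_def n stress_def tpoly_diff)
    show "(?ct i 0 - ?dt i 0)\<^sup>2 \<le> Q / h\<^sup>2" if "i \<le> k" for i by (rule jt[OF that])
    show "J2 \<Omega> \<T> A \<sigma>h e (fr a \<nu> h s 0) = tpoly k ?g2 s 0 / h" for s
      using tf.matrix_field_curl[OF mf, of "fr a \<nu> h s 0"] tf.matrix_field_curl[OF mf', of "fr a \<nu> h s 0"] ee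
      by (simp add: J2_def n stress_def [abs_def] tpoly_diff diff_divide_distrib)
    show "(?g2 i 0)\<^sup>2 \<le> (1 + real k * \<rho>)\<^sup>2 * Q / h\<^sup>2" if i: "i \<le> k" for i
    proof -
      define q where "q = sqrt (Q / h\<^sup>2)"
      have q0: "0 \<le> q" using Q0 by (simp add: q_def)
      have c: "\<bar>chi k ?ct ?cn i 0 - chi k ?dt ?dn i 0\<bar> \<le> q" unfolding q_def using jc[OF i] by (simp add: real_le_rsqrt)
      have nle: "\<bar>ds k ?cn i 0 - ds k ?dn i 0\<bar> \<le> real k * \<rho> * q"
      proof (cases "i < k")
        \<comment> \<open>Coefficient i of the derivative is i + 1 times coefficient i + 1 of the
          trace, and i + 1 is at most k.\<close>
        case True
        have "\<bar>?cn (Suc i) 0 - ?dn (Suc i) 0\<bar> \<le> \<rho> * q"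
          using jn[of "Suc i"] jt[of "Suc i"] True rho_nonneg
          by (intro order_trans[OF jn[of "Suc i"]] mult_left_mono) (auto simp: q_def real_le_rsqrt)
        then have "real (Suc i) * \<bar>?cn (Suc i) 0 - ?dn (Suc i) 0\<bar> \<le> real k * (\<rho> * q)"
          using True by (intro mult_mono) auto
        moreover have "ds k ?cn i 0 - ds k ?dn i 0 = real (Suc i) * (?cn (Suc i) 0 - ?dn (Suc i) 0)"
          using True by (simp add: ds_def right_diff_distrib)
        ultimately show ?thesis by (simp add: abs_mult mult.assoc)
      next
        case False
        then show ?thesis using q0 rho_nonneg by (simp add: ds_def)
      qed
      \<comment> \<open>The second interior residual involves \<partial>s m_tn once, whereas
        \<open>chi\<close> involves it twice. The difference is the tangential derivative of the tn
        jump, bounded through the tt jump.\<close>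
      have "?g2 i 0 = - (chi k ?ct ?cn i 0 - chi k ?dt ?dn i 0) + (ds k ?cn i 0 - ds k ?dn i 0)"
        by (simp add: chi_def)
      then have "\<bar>?g2 i 0\<bar> \<le> q + real k * \<rho> * q" using c nle by linarith
      then have "\<bar>?g2 i 0\<bar> \<le> (1 + real k * \<rho>) * q" by (simp add: algebra_simps)
      then have "\<bar>?g2 i 0\<bar>\<^sup>2 \<le> ((1 + real k * \<rho>) * q)\<^sup>2" by (rule power_mono) simp
      then show ?thesis using Q0 by (simp add: power_mult_distrib q_def)
    qed
  qed
  also have "\<dots> = edge_const k \<rho> \<beta> N * (energy ?K + energy ?K')"
    by (simp add: Q_def edge_const_def algebra_simps)
  finally show ?thesis .
qed

lemma finite_mesh_edges: "finite (edges \<T>)"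
proof -
  have "edges \<T> = (\<Union>K\<in>\<T>. {e. e edge_of K})" by (auto simp: edges_def)
  then show ?thesis using mesh_facts(1)[OF mesh] finite_edges(1)[OF mesh_element(1)] by simp
qed

text \<open>Boundary and interior edges are brought to one form, a sum over all triangles having the
  edge, so that the two sums can be exchanged in \<open>estimator_bound\<close>.\<close>

lemma edge_term_le:
  assumes e: "e \<in> edges \<T>"
  shows "edge_term e \<le> edge_const k \<rho> \<beta> N * (\<Sum>K | K \<in> \<T> \<and> e edge_of K. energy K)"
proof -
  have fin: "finite {K. K \<in> \<T> \<and> e edge_of K}" using mesh_facts(1)[OF mesh] by simp
  have "K_plus \<T> e \<in> \<T> \<and> e edge_of K_plus \<T> e" by (rule edge_frame[OF e]) (rule conjI)
  then have Kp: "K_plus \<T> e \<in> \<T>" "e edge_of K_plus \<T> e" by auto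
  show ?thesis
  proof (cases "e \<in> boundary_edges \<Omega> \<T>")
    case True
    have "energy (K_plus \<T> e) \<le> (\<Sum>K | K \<in> \<T> \<and> e edge_of K. energy K)"
      by (rule member_le_sum) (use Kp fin energy_nonneg in auto)
    then show ?thesis using boundary_edge_term[OF True] mult_left_mono[OF _ edge_const_nonneg[OF beta_nonneg N_nonneg]] by (meson order_trans)
  next
    case False
    then have ie: "e \<in> interior_edges \<Omega> \<T>" using e by (simp add: interior_edges_def)
    note Km = K_minus_props(3-5)[OF domain mesh ie]
    have "energy (K_plus \<T> e) + energy (K_minus \<T> e) = (\<Sum>K\<in>{K_plus \<T> e, K_minus \<T> e}. energy K)"
      using Km(3) by auto
    also have "\<dots> \<le> (\<Sum>K | K \<in> \<T> \<and> e edge_of K. energy K)"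
      by (rule sum_mono2) (use Kp Km fin energy_nonneg in auto)
    finally show ?thesis using interior_edge_term[OF ie] mult_left_mono[OF _ edge_const_nonneg[OF beta_nonneg N_nonneg]] by (meson order_trans)
  qed
qed

lemma estimator_bound:
  "estimator \<Omega> \<T> A \<sigma>h \<le> sqrt (element_const k \<kappa> \<beta> N + 8 * edge_const k \<rho> \<beta> N) * norm_A \<Omega> A (\<lambda>x. \<sigma> x - \<sigma>h x)"
proof -
  have fin: "finite \<T>" using mesh_facts(1)[OF mesh] .
  have edges: "interior_edges \<Omega> \<T> \<union> boundary_edges \<Omega> \<T> = edges \<T>" by (auto simp: interior_edges_def boundary_edges_def)
  have "(\<Sum>K\<in>\<T>. diameter K ^ 4 * (LINT x|lebesgue_on K. (curl_vec (curl_tensor (\<lambda>y. A (piece \<sigma>h K y))) x)\<^sup>2)) \<le> (\<Sum>K\<in>\<T>. element_const k \<kappa> \<beta> N * energy K)"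
    using element_term unfolding stress_def [abs_def] by (rule sum_mono)
  moreover have "(\<Sum>e\<in>edges \<T>. edge_term e) \<le> 8 * edge_const k \<rho> \<beta> N * (\<Sum>K\<in>\<T>. energy K)"
  proof -
    have "(\<Sum>e\<in>edges \<T>. edge_term e) \<le> (\<Sum>e\<in>edges \<T>. edge_const k \<rho> \<beta> N * (\<Sum>K | K \<in> \<T> \<and> e edge_of K. energy K))"
      by (intro sum_mono edge_term_le)
    also have "\<dots> = edge_const k \<rho> \<beta> N * (\<Sum>e\<in>edges \<T>. \<Sum>K | K \<in> \<T> \<and> e edge_of K. energy K)"
      by (simp add: sum_distrib_left)
    \<comment> \<open>Double counting: after the exchange each triangle is weighted by the number of
      its edges.\<close>
    also have "(\<Sum>e\<in>edges \<T>. \<Sum>K | K \<in> \<T> \<and> e edge_of K. energy K) = (\<Sum>K\<in>\<T>. \<Sum>e | e \<in> edges \<T> \<and> e edge_of K. energy K)"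
      by (rule sum.swap_restrict[OF finite_mesh_edges fin])
    also have "\<dots> \<le> (\<Sum>K\<in>\<T>. 8 * energy K)"
    proof (rule sum_mono)
      fix K assume K: "K \<in> \<T>"
      have "card {e. e \<in> edges \<T> \<and> e edge_of K} \<le> card {e. e edge_of K}"
        by (rule card_mono[OF finite_edges(1)[OF mesh_element(1)[OF K]]]) auto
      also have "\<dots> \<le> 8" by (rule finite_edges(2)[OF mesh_element(1)[OF K]])
      finally have "real (card {e. e \<in> edges \<T> \<and> e edge_of K}) * energy K \<le> 8 * energy K"
        using energy_nonneg by (intro mult_right_mono) auto
      then show "(\<Sum>e | e \<in> edges \<T> \<and> e edge_of K. energy K) \<le> 8 * energy K" by simp
    qed
    finally show ?thesis using edge_const_nonneg[OF beta_nonneg N_nonneg] by (simp add: sum_distrib_left[symmetric] mult_left_mono mult.assoc)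
  qed
  ultimately have "(\<Sum>K\<in>\<T>. diameter K ^ 4 * (LINT x|lebesgue_on K. (curl_vec (curl_tensor (\<lambda>y. A (piece \<sigma>h K y))) x)\<^sup>2)) +
      (\<Sum>e\<in>edges \<T>. edge_term e) \<le> (element_const k \<kappa> \<beta> N + 8 * edge_const k \<rho> \<beta> N) * (\<Sum>K\<in>\<T>. energy K)"
    by (simp add: sum_distrib_left[symmetric] distrib_right)
  also have "\<dots> \<le> (element_const k \<kappa> \<beta> N + 8 * edge_const k \<rho> \<beta> N) * (norm_A \<Omega> A err)\<^sup>2"
    using sum_energy_le element_const_nonneg[OF beta_nonneg N_nonneg] edge_const_nonneg[OF beta_nonneg N_nonneg] kappa
    by (intro mult_left_mono) auto
  finally have "estimator \<Omega> \<T> A \<sigma>h \<le> sqrt ((element_const k \<kappa> \<beta> N + 8 * edge_const k \<rho> \<beta> N) * (norm_A \<Omega> A err)\<^sup>2)"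
    unfolding estimator_def edges edge_term_def by (rule real_sqrt_le_mono)
  also have "\<dots> = sqrt (element_const k \<kappa> \<beta> N + 8 * edge_const k \<rho> \<beta> N) * norm_A \<Omega> A err"
    using norm_A_nonneg by (simp add: real_sqrt_mult)
  finally show ?thesis unfolding err_def [abs_def] .
qed

end

end

section \<open>Constants uniform over the admissible tensors, and conclusion\<close>

lemma (in triangle_frame) inball_diameter_nonneg: "0 \<le> inball_diameter K"
  unfolding inball_diameter_def
proof (rule cSup_upper)
  show "0 \<in> {2 * r |r. 0 \<le> r \<and> (\<exists>x. cball x r \<subseteq> K)}"
    using vertices(1) by (intro CollectI exI[of _ 0]) (auto intro!: exI[of _ a])
  show "bdd_above {2 * r |r. 0 \<le> r \<and> (\<exists>x. cball x r \<subseteq> K)}"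
    by (rule bdd_aboveI[of _ h]) (use ball_radius_le(1) in blast)
qed

text \<open>Allows \<kappa> to be replaced by the maximum of 1 and \<kappa>, as the geometric bounds
  are formulated for values at least 1.\<close>

lemma shape_regular_mono:
  assumes m: "mesh \<Omega> \<T>" and sr: "shape_regular \<kappa> \<T>" and le: "\<kappa> \<le> \<kappa>'"
  shows "shape_regular \<kappa>' \<T>"
  unfolding shape_regular_def
proof
  fix K assume K: "K \<in> \<T>"
  note s = mesh_facts(2)[OF m K]
  obtain e where e: "e edge_of K" using finite_edges(3)[OF s] by blast
  obtain a \<nu> h w where tf: "triangle_frame a \<nu> h w" and Keq: "K = triangle_frame.K a \<nu> h w"
    using triangle_frame_of_edge[OF s e] .
  have "0 \<le> inball_diameter K" unfolding Keq by (rule triangle_frame.inball_diameter_nonneg[OF tf])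
  then have "\<kappa> * inball_diameter K \<le> \<kappa>' * inball_diameter K" using le by (rule mult_right_mono[rotated])
  moreover have "diameter K \<le> \<kappa> * inball_diameter K" using sr K by (auto simp: shape_regular_def)
  ultimately show "diameter K \<le> \<kappa>' * inball_diameter K" by linarith
qed

lemma norm_perp: "norm (perp \<nu>) = norm \<nu>"
  by (simp add: norm_eq_sqrt_inner inner_vec2)

lemma mat_1_inner: "mat 1 \<bullet> (M::real^2^2) = trace M"
  by (simp add: inner_mat2 mat_def trace_def sum_2)

text \<open>With q the symmetrised mixed tensor of the frame, the tn component of A T is its inner
  product with q. Positivity of A on T + q and T - q bounds twice this product by the energies of T
  and q, and the energy of q is at most \<beta> / \<alpha> times that of the unit tensor T.\<close>

lemma coercive_compliance_ratio:
  assumes A: "compliance_tensor A" and \<alpha>: "0 < \<alpha>" and \<beta>: "0 \<le> \<beta>"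
    and b: "\<And>\<tau>. \<tau> \<in> Sym \<Longrightarrow> \<alpha> * (norm \<tau>)\<^sup>2 \<le> A \<tau> \<bullet> \<tau>" "\<And>\<tau>. \<tau> \<in> Sym \<Longrightarrow> A \<tau> \<bullet> \<tau> \<le> \<beta> * (norm \<tau>)\<^sup>2"
    and \<nu>: "norm \<nu> = 1"
  defines "T \<equiv> outer (perp \<nu>) (perp \<nu>)"
  shows "\<bar>(A T *v perp \<nu>) \<bullet> \<nu>\<bar> \<le> (1 + \<beta> / \<alpha>) / 2 * ((A T *v perp \<nu>) \<bullet> perp \<nu>)"
proof -
  have lin: "linear A" and AS: "\<And>\<tau>. \<tau> \<in> Sym \<Longrightarrow> A \<tau> \<in> Sym"
    and sym: "\<And>\<tau> \<tau>'. \<tau> \<in> Sym \<Longrightarrow> \<tau>' \<in> Sym \<Longrightarrow> A \<tau> \<bullet> \<tau>' = \<tau> \<bullet> A \<tau>'"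
    using A by (auto simp: compliance_tensor_def)
  have n: "\<nu> \<bullet> \<nu> = 1" "perp \<nu> \<bullet> perp \<nu> = 1" "\<nu> \<bullet> perp \<nu> = 0" "perp \<nu> \<bullet> \<nu> = 0"
    using \<nu> norm_perp[of \<nu>] by (simp_all add: norm_eq_1 inner_vec2)
  define q where "q = (1/2) *\<^sub>R (outer (perp \<nu>) \<nu> + outer \<nu> (perp \<nu>))"
  have TS: "T \<in> Sym" by (simp add: T_def Sym_iff outer_def)
  have qS: "q \<in> Sym" by (simp add: q_def Sym_iff outer_def)
  have TT: "T \<bullet> T = 1" by (simp add: T_def outer_inner_outer n)
  have qq: "q \<bullet> q = 1/2" by (simp add: q_def outer_inner_outer n inner_add_left inner_add_right)
  have 1: "(A T *v perp \<nu>) \<bullet> \<nu> = A T \<bullet> q"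
    using Sym_matrix_inner_commute[OF AS[OF TS], of "perp \<nu>" \<nu>]
    by (simp add: q_def inner_add_right inner_outer)
  have 2: "(A T *v perp \<nu>) \<bullet> perp \<nu> = A T \<bullet> T" by (simp add: T_def inner_outer)
  have pos: "0 \<le> A \<tau> \<bullet> \<tau>" if "\<tau> \<in> Sym" for \<tau>
    by (rule order_trans[OF _ b(1)[OF that]]) (use \<alpha> in simp)
  have "A q \<bullet> T = A T \<bullet> q" using sym[OF qS TS] by (simp add: inner_commute)
  then have "A (T + q) \<bullet> (T + q) = A T \<bullet> T + 2 * (A T \<bullet> q) + A q \<bullet> q" "A (T - q) \<bullet> (T - q) = A T \<bullet> T - 2 * (A T \<bullet> q) + A q \<bullet> q"
    by (simp_all add: linear_add[OF lin] linear_diff[OF lin] inner_add_left inner_add_right inner_diff_left inner_diff_right)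
  moreover have "T + q \<in> Sym" "T - q \<in> Sym" using TS qS by (simp_all add: Sym_iff)
  ultimately have "2 * \<bar>A T \<bullet> q\<bar> \<le> A T \<bullet> T + A q \<bullet> q" using pos[of "T + q"] pos[of "T - q"] by linarith
  moreover have "A q \<bullet> q \<le> \<beta> / \<alpha> * (A T \<bullet> T)"
  proof -
    have "A q \<bullet> q \<le> \<beta>" using b(2)[OF qS] qq \<beta> by (simp add: power2_norm_eq_inner)
    also have "\<beta> = \<beta> / \<alpha> * \<alpha>" using \<alpha> by simp
    also have "\<dots> \<le> \<beta> / \<alpha> * (A T \<bullet> T)" using b(1)[OF TS] TT \<alpha> \<beta> by (intro mult_left_mono) (auto simp: power2_norm_eq_inner)
    finally show ?thesis .
  qed
  ultimately show ?thesis unfolding 1 2 by (simp add: algebra_simps)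
qed

text \<open>In the isotropic class the trace term only lowers the energy, which gives the bound 1 /
  (2 \<mu>) for every \<open>lam\<close>; and A (t x t) t is parallel to t, so the ratio is 0. No
  lower bound, which would degenerate with \<open>lam\<close>, is involved.\<close>

lemma compliance_bounds:
  fixes \<A> :: "(real^2^2 \<Rightarrow> real^2^2) set"
  assumes comp: "\<forall>A\<in>\<A>. compliance_tensor A"
    and "(\<exists>\<alpha>>0. \<exists>\<beta>. \<forall>A\<in>\<A>. \<forall>\<tau>\<in>Sym. \<alpha> * (norm \<tau>)\<^sup>2 \<le> A \<tau> \<bullet> \<tau> \<and> A \<tau> \<bullet> \<tau> \<le> \<beta> * (norm \<tau>)\<^sup>2) \<or>
         (\<exists>\<mu>>0. \<forall>A\<in>\<A>. \<exists>lam\<ge>0. \<forall>\<tau>\<in>Sym. A \<tau> = isotropic_compliance \<mu> lam \<tau>)"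
  obtains \<beta> \<rho> where "0 \<le> \<beta>" "0 \<le> \<rho>"
    "\<And>A \<tau>. A \<in> \<A> \<Longrightarrow> \<tau> \<in> Sym \<Longrightarrow> A \<tau> \<bullet> \<tau> \<le> \<beta> * (norm \<tau>)\<^sup>2"
    "\<And>A \<nu>. A \<in> \<A> \<Longrightarrow> norm \<nu> = 1 \<Longrightarrow> \<bar>(A (outer (perp \<nu>) (perp \<nu>)) *v perp \<nu>) \<bullet> \<nu>\<bar> \<le>
       \<rho> * ((A (outer (perp \<nu>) (perp \<nu>)) *v perp \<nu>) \<bullet> perp \<nu>)"
  using assms(2)
proof
  assume "\<exists>\<alpha>>0. \<exists>\<beta>. \<forall>A\<in>\<A>. \<forall>\<tau>\<in>Sym. \<alpha> * (norm \<tau>)\<^sup>2 \<le> A \<tau> \<bullet> \<tau> \<and> A \<tau> \<bullet> \<tau> \<le> \<beta> * (norm \<tau>)\<^sup>2"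
  then obtain \<alpha> \<beta>0 where \<alpha>: "0 < \<alpha>" and b0: "\<And>A \<tau>. A \<in> \<A> \<Longrightarrow> \<tau> \<in> Sym \<Longrightarrow> \<alpha> * (norm \<tau>)\<^sup>2 \<le> A \<tau> \<bullet> \<tau>"
    "\<And>A \<tau>. A \<in> \<A> \<Longrightarrow> \<tau> \<in> Sym \<Longrightarrow> A \<tau> \<bullet> \<tau> \<le> \<beta>0 * (norm \<tau>)\<^sup>2" by blast
  define \<beta> where "\<beta> = max \<beta>0 0"
  have \<beta>: "0 \<le> \<beta>" by (simp add: \<beta>_def)
  have b: "A \<tau> \<bullet> \<tau> \<le> \<beta> * (norm \<tau>)\<^sup>2" if "A \<in> \<A>" "\<tau> \<in> Sym" for A \<tau>
    by (rule order_trans[OF b0(2)[OF that]]) (auto simp: \<beta>_def intro!: mult_right_mono)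
  have r: "\<bar>(A (outer (perp \<nu>) (perp \<nu>)) *v perp \<nu>) \<bullet> \<nu>\<bar> \<le> (1 + \<beta> / \<alpha>) / 2 * ((A (outer (perp \<nu>) (perp \<nu>)) *v perp \<nu>) \<bullet> perp \<nu>)"
    if "A \<in> \<A>" "norm \<nu> = 1" for A \<nu>
    by (rule coercive_compliance_ratio[OF _ \<alpha> \<beta> b0(1)[OF that(1)] b[OF that(1)] that(2)]) (use comp that in auto)
  have "0 \<le> (1 + \<beta> / \<alpha>) / 2" using \<alpha> \<beta> by simp
  from that[OF \<beta> this] b r show thesis by blast
next
  assume "\<exists>\<mu>>0. \<forall>A\<in>\<A>. \<exists>lam\<ge>0. \<forall>\<tau>\<in>Sym. A \<tau> = isotropic_compliance \<mu> lam \<tau>"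
  then obtain \<mu> where \<mu>: "0 < \<mu>" and iso: "\<And>A. A \<in> \<A> \<Longrightarrow> \<exists>lam\<ge>0. \<forall>\<tau>\<in>Sym. A \<tau> = isotropic_compliance \<mu> lam \<tau>" by blast
  show thesis
  proof (rule that[of "1 / (2 * \<mu>)" 0])
    fix A \<tau> assume A: "A \<in> \<A>" and \<tau>: "\<tau> \<in> Sym"
    obtain lam where lam: "0 \<le> lam" "\<forall>\<tau>\<in>Sym. A \<tau> = isotropic_compliance \<mu> lam \<tau>" using iso[OF A] by blast
    define c where "c = lam / (2 * \<mu> + 2 * lam)"
    have "A \<tau> \<bullet> \<tau> = (1 / (2 * \<mu>)) * ((norm \<tau>)\<^sup>2 - c * (trace \<tau>)\<^sup>2)"
      using lam(2) \<tau> by (simp add: isotropic_compliance_def c_def inner_diff_left mat_1_inner power2_norm_eq_inner power2_eq_square[of "trace \<tau>"])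
    also have "\<dots> \<le> (1 / (2 * \<mu>)) * (norm \<tau>)\<^sup>2"
      using \<mu> lam(1) by (intro mult_left_mono) (auto simp: c_def)
    finally show "A \<tau> \<bullet> \<tau> \<le> 1 / (2 * \<mu>) * (norm \<tau>)\<^sup>2" .
  next
    fix A \<nu> assume A: "A \<in> \<A>"
    obtain lam where lam: "0 \<le> lam" "\<forall>\<tau>\<in>Sym. A \<tau> = isotropic_compliance \<mu> lam \<tau>" using iso[OF A] by blast
    define c where "c = lam / (2 * \<mu> + 2 * lam) * trace (outer (perp \<nu>) (perp \<nu>))"
    have "outer (perp \<nu>) (perp \<nu>) \<in> Sym" by (simp add: Sym_iff outer_def)
    then have "A (outer (perp \<nu>) (perp \<nu>)) = (1 / (2 * \<mu>)) *\<^sub>R (outer (perp \<nu>) (perp \<nu>) - c *\<^sub>R mat 1)"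
      using lam(2) by (simp add: isotropic_compliance_def c_def)
    then have "A (outer (perp \<nu>) (perp \<nu>)) *v perp \<nu> = (1 / (2 * \<mu>)) *\<^sub>R ((perp \<nu> \<bullet> perp \<nu>) *\<^sub>R perp \<nu> - c *\<^sub>R perp \<nu>)"
      by (simp add: scaleR_matrix_vector_assoc[symmetric] matrix_vector_mult_diff_rdistrib outer_mult_vec)
    moreover have "perp \<nu> \<bullet> \<nu> = 0" by (simp add: inner_vec2)
    ultimately show "\<bar>(A (outer (perp \<nu>) (perp \<nu>)) *v perp \<nu>) \<bullet> \<nu>\<bar> \<le> 0 * ((A (outer (perp \<nu>) (perp \<nu>)) *v perp \<nu>) \<bullet> perp \<nu>)"
      by (simp add: inner_diff_left)
  qed (use \<mu> in auto)
qed

text \<open>The constant is fixed before the tensor, the domain and the mesh. Quantifying over a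
  class of tensors expresses uniformity: in the isotropic alternative \<mu> is fixed while
  \<open>lam\<close> may differ from tensor to tensor, so the constant is independent of
  \<open>lam\<close> and of the mesh size.\<close>

theorem theorem3p2:
  fixes k :: nat and \<kappa> :: real and \<A> :: "(real^2^2 \<Rightarrow> real^2^2) set"
  assumes "k \<ge> 3"
    and "\<forall>A\<in>\<A>. compliance_tensor A"
    and "(\<exists>\<alpha>>0. \<exists>\<beta>. \<forall>A\<in>\<A>. \<forall>\<tau>\<in>Sym. \<alpha> * (norm \<tau>)\<^sup>2 \<le> A \<tau> \<bullet> \<tau> \<and> A \<tau> \<bullet> \<tau> \<le> \<beta> * (norm \<tau>)\<^sup>2) \<or>
         (\<exists>\<mu>>0. \<forall>A\<in>\<A>. \<exists>lam\<ge>0. \<forall>\<tau>\<in>Sym. A \<tau> = isotropic_compliance \<mu> lam \<tau>)"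
  shows "\<exists>C\<^sub>2>0. \<forall>A\<in>\<A>. \<forall>\<Omega> \<T> f \<sigma> u \<sigma>h uh.
           polygonal_domain \<Omega> \<longrightarrow> mesh \<Omega> \<T> \<longrightarrow> shape_regular \<kappa> \<T> \<longrightarrow> f \<in> L2 \<Omega> \<longrightarrow>
           mixed_solution \<Omega> A f (Hdiv_Sym \<Omega>) (L2 \<Omega>) \<sigma> u \<longrightarrow>
           mixed_solution \<Omega> A f (Sigma_h k \<Omega> \<T>) (V_h k \<Omega> \<T>) \<sigma>h uh \<longrightarrow>
           C\<^sub>2 * estimator \<Omega> \<T> A \<sigma>h \<le> norm_A \<Omega> A (\<lambda>x. \<sigma> x - \<sigma>h x)"
proof -
  obtain \<beta> \<rho> where b: "0 \<le> \<beta>" "0 \<le> \<rho>"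
    "\<And>A \<tau>. A \<in> \<A> \<Longrightarrow> \<tau> \<in> Sym \<Longrightarrow> A \<tau> \<bullet> \<tau> \<le> \<beta> * (norm \<tau>)\<^sup>2"
    "\<And>A \<nu>. A \<in> \<A> \<Longrightarrow> norm \<nu> = 1 \<Longrightarrow> \<bar>(A (outer (perp \<nu>) (perp \<nu>)) *v perp \<nu>) \<bullet> \<nu>\<bar> \<le>
       \<rho> * ((A (outer (perp \<nu>) (perp \<nu>)) *v perp \<nu>) \<bullet> perp \<nu>)"
    using compliance_bounds[OF assms(2,3)] by blast
  define \<kappa>' where "\<kappa>' = max 1 \<kappa>"
  have \<kappa>': "1 \<le> \<kappa>'" by (simp add: \<kappa>'_def)
  obtain N B D Cm Cp where N: "0 \<le> N" and ref: "reference_bumps k (1 / (4 * \<kappa>' * (1 + \<kappa>'))) N B D Cm Cp"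
    using reference_bumps_exist[of "1 / (4 * \<kappa>' * (1 + \<kappa>'))" k] \<kappa>' by auto
  \<comment> \<open>The added 1 keeps M positive even if both constants vanish, so that 1 / M is an
    admissible constant.\<close>
  define M where "M = sqrt (element_const k \<kappa>' \<beta> N + 8 * edge_const k \<rho> \<beta> N) + 1"
  have M: "0 < M"
    unfolding M_def using element_const_nonneg[OF b(1) N] edge_const_nonneg[OF b(1) N] \<kappa>' by (intro add_nonneg_pos) auto
  show ?thesis
  proof (intro exI[of _ "1 / M"] conjI ballI allI impI)
    show "0 < 1 / M" using M by simp
    fix A \<Omega> \<T> f \<sigma> u \<sigma>h uh
    assume A: "A \<in> \<A>" and \<Omega>: "polygonal_domain \<Omega>" "mesh \<Omega> \<T>" "shape_regular \<kappa> \<T>"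
      and sol: "mixed_solution \<Omega> A f (Hdiv_Sym \<Omega>) (L2 \<Omega>) \<sigma> u" "mixed_solution \<Omega> A f (Sigma_h k \<Omega> \<T>) (V_h k \<Omega> \<T>) \<sigma>h uh"
    interpret discrete_problem k \<kappa>' \<beta> \<rho> A \<Omega> \<T> f u \<sigma> \<sigma>h
    proof
      show "shape_regular \<kappa>' \<T>" by (rule shape_regular_mono[OF \<Omega>(2,3)]) (simp add: \<kappa>'_def)
      show "compliance_tensor A" using assms(2) A by blast
      show "\<sigma>h \<in> Sigma_h k \<Omega> \<T>" using sol(2) by (simp add: mixed_solution_def)
    qed (fact \<kappa>' b(1,2) b(3,4)[OF A] \<Omega> sol(1))+
    let ?n = "norm_A \<Omega> A (\<lambda>x. \<sigma> x - \<sigma>h x)"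
    have "reference_bumps k width N B D Cm Cp" unfolding width_def by (rule ref)
    then have "estimator \<Omega> \<T> A \<sigma>h \<le> sqrt (element_const k \<kappa>' \<beta> N + 8 * edge_const k \<rho> \<beta> N) * ?n"
      by (rule estimator_bound)
    also have "\<dots> \<le> M * ?n"
      unfolding M_def using norm_A_nonneg unfolding err_def [abs_def] by (intro mult_right_mono) auto
    finally show "1 / M * estimator \<Omega> \<T> A \<sigma>h \<le> ?n" using M by (simp add: field_simps)
  qed
qed

end
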